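(* Let $G_1=(V_1,E_1)$ be a graph with $v_2v_3\in E_1$ such that $G_1-v_2v_3$ is rigid on the cylinder, and let $G=(V,E)$ be obtained from $G_1$ by a $K_4^-$-extension on the edge $v_2v_3$. Let $(G,p)$ be a generic framework on the unit cylinder $\mathcal{Y}$ and let $p_1$ be the restriction of $p$ to $V_1$. If $(G_1,p_1)$ has a maximum rank equilibrium stress on $\mathcal{Y}$, then $(G,p)$ has a maximum rank equilibrium stress on $\mathcal{Y}$.
   Context: Let $\mathcal{Y}=\{(x,y,z): x^2+y^2=1\}$. A framework $(G,p)$ on $\mathcal{Y}$ ($G$ finite simple, $V=\{v_1,\dots,v_n\}$) is a map $p:V\to\mathcal{Y}$; it is generic if the coordinates of $p$ generate a field of transcendence degree $2n$ over $\mathbb{Q}$. A graph is rigid on the cylinder if some (equivalently every) generic framework of it on $\mathcal{Y}$ is rigid (every continuous edge-length-preserving motion on $\mathcal{Y}$ near $p$ yields a congruent framework). A $K_4^-$-extension on an edge $xy$ deletes $xy$, adds new vertices $u_1,u_2$ and the five edges $u_1u_2,u_1x,u_1y,u_2x,u_2y$. Writing $p(v_i)=(x_i,y_i,z_i)$ and $\bar p(v_i)=(x_i,y_i,0)$, an equilibrium stress of $(G,p)$ on $\mathcal{Y}$ is a pair $(\omega,\lambda)$, $\omega:E\to\mathbb{R}$, $\lambda:V\to\mathbb{R}$, with $\sum_{j}\omega_{ij}(p(v_i)-p(v_j))+\lambda_i\bar p(v_i)=0$ for all $i$, where $\omega_{ij}=\omega_e$ if $e=v_iv_j\in E$ and $0$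 otherwise. Let $\Omega$ be the $n\times n$ symmetric matrix with off-diagonal entries $-\omega_{ij}$ and diagonal entries $\sum_j\omega_{ij}$, $\Lambda=\mathrm{diag}(\lambda_1,\dots,\lambda_n)$, and $\Omega_{\mathrm{cyl}}(\omega,\lambda)=\mathrm{diag}(\Omega+\Lambda,\Omega+\Lambda,\Omega)$ (a $3n\times3n$ block diagonal matrix). One always has $\operatorname{rank}\Omega_{\mathrm{cyl}}\le 3n-6$; the stress has maximum rank if $\operatorname{rank}\Omega_{\mathrm{cyl}}(\omega,\lambda)=3n-6$, where $n$ is the number of vertices of the graph in question. *)

theory Defs
  imports "HOL-Analysis.Analysis" "HOL-Library.Poly_Mapping"
begin

section \<open>Transcendence degree over the rationals\<close>

definition is_subfield :: "real set \<Rightarrow> bool" where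
  "is_subfield K \<longleftrightarrow> 1 \<in> K \<and> (\<forall>x\<in>K. \<forall>y\<in>K. x - y \<in> K \<and> x * y \<in> K) \<and> (\<forall>x\<in>K. inverse x \<in> K)"

text \<open>Every subfield of the reals contains the rationals, so this is the extension of the
  rationals generated by \<open>S\<close>.\<close>

definition generated_field :: "real set \<Rightarrow> real set" where
  "generated_field S = is_subfield hull S"

text \<open>The indeterminates of a rational polynomial are named by real numbers, and the
  indeterminate named \<open>x\<close> is evaluated at \<open>x\<close> itself.\<close>

definition eval_rat_poly :: "((real \<Rightarrow>\<^sub>0 nat) \<Rightarrow>\<^sub>0 rat) \<Rightarrow> real" where
  "eval_rat_poly P =
     (\<Sum>m\<in>Poly_Mapping.keys P. of_rat (Poly_Mapping.lookup P m) *
        (\<Prod>x\<in>Poly_Mapping.keys m. x ^ Poly_Mapping.lookup m x))"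

definition alg_independent :: "real set \<Rightarrow> bool" where
  "alg_independent S \<longleftrightarrow>
     (\<forall>P. (\<forall>m\<in>Poly_Mapping.keys P. Poly_Mapping.keys m \<subseteq> S) \<and> eval_rat_poly P = 0 \<longrightarrow> P = 0)"

definition transcendence_basis :: "real set \<Rightarrow> real set \<Rightarrow> bool" where
  "transcendence_basis K B \<longleftrightarrow>
     B \<subseteq> K \<and> alg_independent B \<and> (\<forall>C. B \<subset> C \<and> C \<subseteq> K \<longrightarrow> \<not> alg_independent C)"

definition has_transcendence_degree :: "real set \<Rightarrow> nat \<Rightarrow> bool" where
  "has_transcendence_degree K d \<longleftrightarrow> (\<exists>B. transcendence_basis K B \<and> finite B \<and> card B = d)"

section \<open>Frameworks on the cylinder\<close>

text \<open>The vertex set of a graph is a finite type, and a graph is given by its set of edges.\<close>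

definition simple_graph :: "'v::finite set set \<Rightarrow> bool" where
  "simple_graph E \<longleftrightarrow> (\<forall>e\<in>E. card e = 2)"

definition cylinder :: "(real^3) set" where
  "cylinder = {q. (q $ 1)\<^sup>2 + (q $ 2)\<^sup>2 = 1}"

definition on_cylinder :: "('v::finite \<Rightarrow> real^3) \<Rightarrow> bool" where
  "on_cylinder p \<longleftrightarrow> (\<forall>v. p v \<in> cylinder)"

definition generic_on_cylinder :: "('v::finite \<Rightarrow> real^3) \<Rightarrow> bool" where
  "generic_on_cylinder p \<longleftrightarrow> on_cylinder p \<and>
     has_transcendence_degree (generated_field {p v $ k | v k. True}) (2 * CARD('v))"

definition equivalent_frameworks :: "'v::finite set set \<Rightarrow> ('v \<Rightarrow> real^3) \<Rightarrow> ('v \<Rightarrow> real^3) \<Rightarrow> bool" where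
  "equivalent_frameworks E p q \<longleftrightarrow> (\<forall>u v. {u, v} \<in> E \<longrightarrow> dist (p u) (p v) = dist (q u) (q v))"

definition congruent_frameworks :: "('v::finite \<Rightarrow> real^3) \<Rightarrow> ('v \<Rightarrow> real^3) \<Rightarrow> bool" where
  "congruent_frameworks p q \<longleftrightarrow> (\<forall>u v. dist (p u) (p v) = dist (q u) (q v))"

definition cylinder_motion ::
  "'v::finite set set \<Rightarrow> ('v \<Rightarrow> real^3) \<Rightarrow> (real \<Rightarrow> 'v \<Rightarrow> real^3) \<Rightarrow> bool" where
  "cylinder_motion E p P \<longleftrightarrow> P 0 = p \<and> (\<forall>v. continuous_on {0..1} (\<lambda>t. P t v)) \<and>
     (\<forall>t\<in>{0..1}. on_cylinder (P t) \<and> equivalent_frameworks E p (P t))"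

definition rigid_framework :: "'v::finite set set \<Rightarrow> ('v \<Rightarrow> real^3) \<Rightarrow> bool" where
  "rigid_framework E p \<longleftrightarrow>
     (\<exists>\<epsilon>>0. \<forall>P. cylinder_motion E p P \<and> (\<forall>t\<in>{0..1}. \<forall>v. dist (P t v) (p v) < \<epsilon>) \<longrightarrow>
        (\<forall>t\<in>{0..1}. congruent_frameworks p (P t)))"

definition rigid_on_cylinder :: "'v::finite set set \<Rightarrow> bool" where
  "rigid_on_cylinder E \<longleftrightarrow> (\<exists>p. generic_on_cylinder p \<and> rigid_framework E p)"

section \<open>Equilibrium stresses\<close>

definition weight :: "'v::finite set set \<Rightarrow> ('v set \<Rightarrow> real) \<Rightarrow> 'v \<Rightarrow> 'v \<Rightarrow> real" where
  "weight E \<omega> i j = (if {i, j} \<in> E then \<omega> {i, j} else 0)"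

definition horizontal :: "real^3 \<Rightarrow> real^3" where
  "horizontal q = vector [q $ 1, q $ 2, 0]"

definition equilibrium_stress ::
  "'v::finite set set \<Rightarrow> ('v \<Rightarrow> real^3) \<Rightarrow> ('v set \<Rightarrow> real) \<Rightarrow> ('v \<Rightarrow> real) \<Rightarrow> bool" where
  "equilibrium_stress E p \<omega> l \<longleftrightarrow>
     (\<forall>i. (\<Sum>j\<in>UNIV. weight E \<omega> i j *\<^sub>R (p i - p j)) + l i *\<^sub>R horizontal (p i) = 0)"

definition stress_matrix :: "'v::finite set set \<Rightarrow> ('v set \<Rightarrow> real) \<Rightarrow> real^'v^'v" where
  "stress_matrix E \<omega> = (\<chi> i j. if i = j then (\<Sum>k\<in>UNIV. weight E \<omega> i k) else - weight E \<omega> i j)"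

definition diag_matrix :: "('v::finite \<Rightarrow> real) \<Rightarrow> real^'v^'v" where
  "diag_matrix d = (\<chi> i j. if i = j then d i else 0)"

definition block_diag ::
  "real^'m::finite^'m \<Rightarrow> real^'n::finite^'n \<Rightarrow> real^('m + 'n)^('m + 'n)" where
  "block_diag A B = (\<chi> a b. case (a, b) of
       (Inl i, Inl j) \<Rightarrow> A $ i $ j
     | (Inr i, Inr j) \<Rightarrow> B $ i $ j
     | _ \<Rightarrow> 0)"

definition cyl_stress_matrix ::
  "'v::finite set set \<Rightarrow> ('v set \<Rightarrow> real) \<Rightarrow> ('v \<Rightarrow> real) \<Rightarrow> real^('v + 'v + 'v)^('v + 'v + 'v)" where
  "cyl_stress_matrix E \<omega> l =
     block_diag (stress_matrix E \<omega> + diag_matrix l)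
       (block_diag (stress_matrix E \<omega> + diag_matrix l) (stress_matrix E \<omega>))"

definition has_max_rank_stress :: "'v::finite set set \<Rightarrow> ('v \<Rightarrow> real^3) \<Rightarrow> bool" where
  "has_max_rank_stress E p \<longleftrightarrow>
     (\<exists>\<omega> l. equilibrium_stress E p \<omega> l \<and>
        int (rank (cyl_stress_matrix E \<omega> l)) = 3 * int CARD('v) - 6)"

section \<open>The extension\<close>

text \<open>The old vertices are \<open>Inl v\<close>; the two new vertices are \<open>Inr False\<close> and \<open>Inr True\<close>.\<close>

definition K4_minus_extension :: "'v::finite set set \<Rightarrow> 'v \<Rightarrow> 'v \<Rightarrow> ('v + bool) set set" where
  "K4_minus_extension E x y =
     (`) Inl ` (E - {{x, y}}) \<union>
     {{Inr False, Inr True}, {Inr False, Inl x}, {Inr False, Inl y},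
      {Inr True, Inl x}, {Inr True, Inl y}}"

end

theory Submission
  imports Defs
begin

text \<open>Write \<open>H\<close> for \<open>G\<^sub>1\<close> without the edge \<open>xy = v\<^sub>2v\<^sub>3\<close>. A generic framework on the cylinder satisfies no polynomial equation
  with rational coefficients that does not hold on the whole configuration space. Hence it suffices to find
  a single, not necessarily generic, position \<open>q\<close> of \<open>G\<close> that has a stress of maximum rank and whose
  rigidity matrix has the rank attained at generic positions: stresses can be written as
  polynomials in the position, and the nonvanishing of a minor passes from \<open>q\<close> to \<open>p\<close>.

  To construct \<open>q\<close>, keep \<open>p\<^sub>1\<close> and choose the new vertices \<open>u\<^sub>1, u\<^sub>2\<close> so that the complete graph on
  \<open>x, y, u\<^sub>1, u\<^sub>2\<close>, which has no stress generically, carries one. Because \<open>H\<close> is rigid, \<open>G\<^sub>1\<close> has a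
  stress of maximum rank that is nonzero on \<open>xy\<close>, and adding a multiple of the stress of the complete
  graph cancels it there. The equilibrium equations at \<open>u\<^sub>1\<close> and \<open>u\<^sub>2\<close> show that the kernel of the sum is no
  larger than it has to be. Rigidity of \<open>H\<close> also shows that \<open>G\<close> has only trivial infinitesimal motions at \<open>q\<close>.\<close>

section \<open>Polynomials with rational coefficients\<close>

text \<open>On the cylinder a complete graph on four vertices has 6 = 2 * 4 - 2 edges, just enough
  to fix it up to the two trivial motions. Its edges are therefore generically independent, and the
  sum of stresses exists only on a thin set of positions; this forces the detour through q. The way
  back to p is safe only because the rigidity matrices at q and p have the same rank: where the rank
  drops, a stress may have no counterpart at generic positions. Two gaps separate the definitions
  from this plan. Genericity is given by a transcendence degree; the half-angle parametrisation,
  with exactly \<open>2 * CARD('v)\<close> parameters, and a count of monomials turn it into a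
  statement about equations. Rigidity is given by continuous motions, whereas ranks see only
  infinitesimal ones; at a generic point the inverse function theorem closes the gap. The special
  position is made symmetric: one half-turn exchanges x with y and the two new vertices with each
  other. This halves the equilibrium equations, so that the stress can be written down
  explicitly.\<close>

lemma homogeneous_system_nontrivial:
  fixes a :: "'r \<Rightarrow> 'c \<Rightarrow> 'k::field"
  assumes "finite S" "finite A" "card S < card A"
  shows "\<exists>c. (\<exists>x\<in>A. c x \<noteq> 0) \<and> (\<forall>s\<in>S. (\<Sum>x\<in>A. c x * a s x) = 0)"
  using assms
proof (induction S arbitrary: A a rule: finite_induct)
  case empty
  then have "A \<noteq> {}" by auto
  then show ?case by (intro exI[of _ "\<lambda>_. 1"]) auto
next
  case (insert s S)
  show ?case
  proof (cases "\<forall>x\<in>A. a s x = 0")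
    case True
    have "card S < card A" using insert by simp
    from insert.IH[OF insert.prems(1) this] True show ?thesis by auto
  next
    case False
    then obtain y where y: "y \<in> A" "a s y \<noteq> 0" by blast
    \<comment> \<open>Gaussian elimination: equation \<open>s\<close> is solved for the unknown
      \<open>y\<close> and substituted into the others.\<close>
    let ?A = "A - {y}"
    have "card S < card ?A" using insert y by simp
    from insert.IH[of ?A "\<lambda>t x. a t x - a t y * a s x / a s y", OF _ this] insert.prems(1)
    obtain c where c: "\<exists>x\<in>?A. c x \<noteq> 0"
      "\<And>t. t \<in> S \<Longrightarrow> (\<Sum>x\<in>?A. c x * (a t x - a t y * a s x / a s y)) = 0" by auto
    define m where "m = (\<Sum>x\<in>?A. c x * a s x)"
    define d where "d x = (if x = y then - m / a s y else c x)" for x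
    have split: "(\<Sum>x\<in>A. d x * a t x) = - m / a s y * a t y + (\<Sum>x\<in>?A. c x * a t x)" for t
    proof -
      have "(\<Sum>x\<in>A. d x * a t x) = d y * a t y + (\<Sum>x\<in>?A. d x * a t x)"
        using insert.prems(1) y by (simp add: sum.remove)
      also have "(\<Sum>x\<in>?A. d x * a t x) = (\<Sum>x\<in>?A. c x * a t x)"
        by (rule sum.cong) (auto simp: d_def)
      finally show ?thesis by (simp add: d_def)
    qed
    have "(\<Sum>x\<in>A. d x * a t x) = 0" if "t \<in> S" for t
    proof -
      have "0 = (\<Sum>x\<in>?A. c x * a t x - a t y / a s y * (c x * a s x))"
        using c(2)[OF that] by (simp add: algebra_simps)
      also have "\<dots> = (\<Sum>x\<in>?A. c x * a t x) - a t y / a s y * m"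
        by (simp add: sum_subtractf sum_distrib_left m_def)
      finally show ?thesis by (simp add: split mult.commute)
    qed
    moreover have "(\<Sum>x\<in>A. d x * a s x) = 0"
      using y by (simp add: split m_def)
    moreover have "\<exists>x\<in>A. d x \<noteq> 0" using c(1) by (auto simp: d_def)
    ultimately show ?thesis by (intro exI[of _ d]) auto
  qed
qed

text \<open>Degrees are bounded in each variable separately: such boxes are counted by a plain
  power, and their bounds add under multiplication. \<open>PiE\<close> fixes the values off
  \<open>I\<close>, which keeps the box finite over an infinite type.\<close>

definition expbox :: "'i set \<Rightarrow> nat \<Rightarrow> ('i \<Rightarrow> nat) set" where
  "expbox I N = PiE I (\<lambda>_. {..N})"

definition monom_at :: "'i set \<Rightarrow> ('i \<Rightarrow> nat) \<Rightarrow> ('i \<Rightarrow> real) \<Rightarrow> real" where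
  "monom_at I a x = (\<Prod>i\<in>I. x i ^ a i)"

lemma finite_expbox [simp]: "finite I \<Longrightarrow> finite (expbox I N)"
  by (simp add: expbox_def finite_PiE)

lemma card_expbox: "finite I \<Longrightarrow> card (expbox I N) = (N + 1) ^ card I"
  by (simp add: expbox_def card_PiE)

text \<open>Induction on the variables: with all variables but \<open>j\<close> fixed, the sum is a
  univariate polynomial in \<open>t\<close> that vanishes everywhere, so each of its coefficients
  vanishes as a function of the remaining variables.\<close>

lemma monomials_independent:
  fixes e :: "('i \<Rightarrow> nat) \<Rightarrow> real"
  assumes "finite I" "\<And>x. (\<Sum>a\<in>expbox I N. e a * monom_at I a x) = 0" "a \<in> expbox I N"
  shows "e a = 0"
  using assms
proof (induction I arbitrary: e a rule: finite_induct)
  case empty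
  then show ?case by (auto simp: expbox_def monom_at_def)
next
  case (insert j I)
  have eq: "expbox (insert j I) N = (\<lambda>(y, g). g(j := y)) ` ({..N} \<times> expbox I N)"
    by (simp add: expbox_def PiE_insert_eq)
  have inj: "inj_on (\<lambda>(y, g). g(j := y)) ({..N} \<times> expbox I N)"
    unfolding expbox_def using insert.hyps(2) by (rule inj_combinator)
  have mon: "monom_at (insert j I) (g(j := y)) x = x j ^ y * monom_at I g x" for g y x
  proof -
    have "(\<Prod>i\<in>I. x i ^ (g(j := y)) i) = (\<Prod>i\<in>I. x i ^ g i)"
      using insert.hyps by (intro prod.cong) auto
    then show ?thesis
      unfolding monom_at_def using insert.hyps by simp
  qed
  have upd: "monom_at I g (x(j := t)) = monom_at I g x" for g x t
    unfolding monom_at_def using insert.hyps by (intro prod.cong) auto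
  have z: "(\<Sum>g\<in>expbox I N. e (g(j := y)) * monom_at I g x) = 0" if "y \<le> N" for y x
  proof -
    have "(\<Sum>y\<le>N. (\<Sum>g\<in>expbox I N. e (g(j := y)) * monom_at I g x) * t ^ y) = 0" for t
    proof -
      have "0 = (\<Sum>(y,g)\<in>{..N} \<times> expbox I N. e (g(j := y)) * monom_at (insert j I) (g(j := y)) (x(j := t)))"
        using insert.prems(1)[of "x(j := t)"] unfolding eq
        by (subst (asm) sum.reindex[OF inj]) (simp add: case_prod_unfold)
      also have "\<dots> = (\<Sum>y\<le>N. \<Sum>g\<in>expbox I N. e (g(j := y)) * (t ^ y * monom_at I g x))"
        by (subst sum.cartesian_product[symmetric]) (simp add: mon upd)
      finally show ?thesis by (simp add: sum_distrib_right sum_distrib_left algebra_simps)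
    qed
    then have "\<forall>y\<le>N. (\<Sum>g\<in>expbox I N. e (g(j := y)) * monom_at I g x) = 0"
      using Transcendental.polyfun_eq_0[of "\<lambda>y. \<Sum>g\<in>expbox I N. e (g(j := y)) * monom_at I g x" N] by blast
    with that show ?thesis by blast
  qed
  from insert.prems(2) obtain y g where yg: "y \<le> N" "g \<in> expbox I N" "a = g(j := y)"
    unfolding eq by auto
  show ?case
    using insert.IH[of "\<lambda>g. e (g(j := y))" g, OF z[OF yg(1)] yg(2)] yg(3) by (simp only:)
qed

text \<open>Closure under operations replaces a syntax of polynomials, since only values at points
  matter. The generators \<open>X\<close> are a parameter: they are plain variables, coordinates of
  a framework, or entries of a stress vector.\<close>

inductive ratpoly :: "('i \<Rightarrow> 'x \<Rightarrow> real) \<Rightarrow> ('x \<Rightarrow> real) \<Rightarrow> bool" for X where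
  const: "ratpoly X (\<lambda>_. of_rat c)"
| var: "ratpoly X (X i)"
| add: "ratpoly X f \<Longrightarrow> ratpoly X g \<Longrightarrow> ratpoly X (\<lambda>x. f x + g x)"
| mult: "ratpoly X f \<Longrightarrow> ratpoly X g \<Longrightarrow> ratpoly X (\<lambda>x. f x * g x)"

lemma ratpoly_of_int: "ratpoly X (\<lambda>_. of_int k)"
  using ratpoly.const[of X "of_int k"] by simp

lemma ratpoly_0: "ratpoly X (\<lambda>_. 0)" and ratpoly_1: "ratpoly X (\<lambda>_. 1)"
  and ratpoly_numeral: "ratpoly X (\<lambda>_. numeral k)"
  using ratpoly_of_int[of X 0] ratpoly_of_int[of X 1] ratpoly_of_int[of X "numeral k"] by simp_all

lemma ratpoly_uminus: "ratpoly X f \<Longrightarrow> ratpoly X (\<lambda>x. - f x)"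
  using ratpoly.mult[OF ratpoly_of_int[of X "-1"]] by fastforce

lemma ratpoly_diff: "ratpoly X f \<Longrightarrow> ratpoly X g \<Longrightarrow> ratpoly X (\<lambda>x. f x - g x)"
  using ratpoly.add[OF _ ratpoly_uminus] by fastforce

lemma ratpoly_sum: "(\<And>a. a \<in> A \<Longrightarrow> ratpoly X (f a)) \<Longrightarrow> ratpoly X (\<lambda>x. \<Sum>a\<in>A. f a x)"
  by (induction A rule: infinite_finite_induct) (auto intro: ratpoly_0 ratpoly.add)

lemma ratpoly_prod: "(\<And>a. a \<in> A \<Longrightarrow> ratpoly X (f a)) \<Longrightarrow> ratpoly X (\<lambda>x. \<Prod>a\<in>A. f a x)"
  by (induction A rule: infinite_finite_induct) (auto intro: ratpoly_1 ratpoly.mult)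

lemma ratpoly_power: "ratpoly X f \<Longrightarrow> ratpoly X (\<lambda>x. f x ^ n)"
  by (induction n) (auto intro: ratpoly_1 ratpoly.mult)

lemma ratpoly_if: "(b \<Longrightarrow> ratpoly X f) \<Longrightarrow> (\<not> b \<Longrightarrow> ratpoly X g) \<Longrightarrow> ratpoly X (\<lambda>x. if b then f x else g x)"
  by (cases b) simp_all

lemma ratpoly_det:
  "(\<And>i j. ratpoly X (\<lambda>x. A x $ i $ j)) \<Longrightarrow> ratpoly X (\<lambda>x. det (A x :: real^'n^'n))"
  unfolding det_def by (intro ratpoly_sum ratpoly.mult ratpoly_prod ratpoly_of_int) auto

lemma ratpoly_comp:
  assumes "ratpoly X f" "\<And>i. ratpoly Y (\<lambda>y. X i (h y))"
  shows "ratpoly Y (\<lambda>y. f (h y))"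
  using assms by (induction rule: ratpoly.induct) (auto intro: ratpoly.intros)

text \<open>\<open>ratpoly\<close> records no degree; this normal form does, as the counting
  argument requires.\<close>

definition qpoly :: "nat \<Rightarrow> (('i::finite \<Rightarrow> real) \<Rightarrow> real) \<Rightarrow> bool" where
  "qpoly N F \<longleftrightarrow> (\<exists>c::('i \<Rightarrow> nat) \<Rightarrow> rat. \<forall>x. F x = (\<Sum>a\<in>expbox UNIV N. of_rat (c a) * monom_at UNIV a x))"

lemma expbox_UNIV: "a \<in> expbox UNIV N \<longleftrightarrow> (\<forall>i. a i \<le> N)"
  by (auto simp: expbox_def PiE_UNIV_domain)

lemma qpoly_zero: "qpoly N (\<lambda>_. 0)"
  unfolding qpoly_def by (intro exI[of _ "\<lambda>_. 0"]) simp

lemma qpoly_add: "qpoly N F \<Longrightarrow> qpoly N G \<Longrightarrow> qpoly N (\<lambda>x. F x + G x)"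
  unfolding qpoly_def
proof (elim exE)
  fix c d :: "('a \<Rightarrow> nat) \<Rightarrow> rat"
  assume "\<forall>x. F x = (\<Sum>a\<in>expbox UNIV N. of_rat (c a) * monom_at UNIV a x)"
    "\<forall>x. G x = (\<Sum>a\<in>expbox UNIV N. of_rat (d a) * monom_at UNIV a x)"
  then show "\<exists>c::('a \<Rightarrow> nat) \<Rightarrow> rat. \<forall>x. F x + G x = (\<Sum>a\<in>expbox UNIV N. of_rat (c a) * monom_at UNIV a x)"
    by (intro exI[of _ "\<lambda>a. c a + d a"]) (simp add: of_rat_add distrib_right sum.distrib)
qed

lemma qpoly_sum: "(\<And>a. a \<in> A \<Longrightarrow> qpoly N (F a)) \<Longrightarrow> qpoly N (\<lambda>x. \<Sum>a\<in>A. F a x)"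
  by (induction A rule: infinite_finite_induct) (auto intro: qpoly_zero qpoly_add)

lemma qpoly_monom:
  assumes "\<And>i. a i \<le> N"
  shows "qpoly N (\<lambda>x. of_rat r * monom_at UNIV a x)"
  unfolding qpoly_def
proof (intro exI[of _ "\<lambda>b. if b = a then r else 0"] allI)
  fix x :: "'a \<Rightarrow> real"
  have "a \<in> expbox UNIV N" using assms by (simp add: expbox_UNIV)
  moreover have "(\<Sum>b\<in>expbox UNIV N. of_rat (if b = a then r else 0) * monom_at UNIV b x)
      = (\<Sum>b\<in>expbox UNIV N. if b = a then of_rat r * monom_at UNIV a x else 0)"
    by (intro sum.cong) auto
  ultimately show "of_rat r * monom_at UNIV a x
      = (\<Sum>b\<in>expbox UNIV N. of_rat (if b = a then r else 0) * monom_at UNIV b x)"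
    by simp
qed

lemma qpoly_mult:
  assumes "qpoly N F" "qpoly M G"
  shows "qpoly (N + M) (\<lambda>x. F x * G x)"
proof -
  obtain c where c: "\<And>x. F x = (\<Sum>a\<in>expbox UNIV N. of_rat (c a) * monom_at UNIV a x)"
    using assms(1) unfolding qpoly_def by blast
  obtain d where d: "\<And>x. G x = (\<Sum>a\<in>expbox UNIV M. of_rat (d a) * monom_at UNIV a x)"
    using assms(2) unfolding qpoly_def by blast
  have "F x * G x = (\<Sum>a\<in>expbox UNIV N. \<Sum>b\<in>expbox UNIV M.
      of_rat (c a * d b) * monom_at UNIV (\<lambda>i. a i + b i) x)" for x
    unfolding c d sum_product
    by (intro sum.cong refl) (simp add: of_rat_mult monom_at_def power_add prod.distrib)
  then have "(\<lambda>x. F x * G x) = (\<lambda>x. \<Sum>a\<in>expbox UNIV N. \<Sum>b\<in>expbox UNIV M.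
      of_rat (c a * d b) * monom_at UNIV (\<lambda>i. a i + b i) x)" by blast
  then show ?thesis
    by (auto intro!: qpoly_sum qpoly_monom add_mono simp: expbox_UNIV)
qed

lemma qpoly_mono:
  assumes "qpoly N F" "N \<le> M"
  shows "qpoly M F"
proof -
  obtain c where c: "\<And>x. F x = (\<Sum>a\<in>expbox UNIV N. of_rat (c a) * monom_at UNIV a x)"
    using assms(1) unfolding qpoly_def by blast
  then have "F = (\<lambda>x. \<Sum>a\<in>expbox UNIV N. of_rat (c a) * monom_at UNIV a x)" by blast
  then show ?thesis
    by (auto intro!: qpoly_sum qpoly_monom le_trans[OF _ assms(2)] simp: expbox_UNIV)
qed

lemma qpoly_const: "qpoly N (\<lambda>_. of_rat r)"
  using qpoly_monom[of "\<lambda>_. 0" N r] by (simp add: monom_at_def)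

lemma qpoly_var: "qpoly 1 (\<lambda>x. x i)"
proof -
  have "monom_at UNIV (\<lambda>j. if j = i then 1 else 0) x = x i" for x :: "'a \<Rightarrow> real"
    unfolding monom_at_def by (subst prod.remove[of _ i]) auto
  then show ?thesis
    using qpoly_monom[of "\<lambda>j. if j = i then 1 else 0" 1 1] by simp
qed

lemma ratpoly_imp_qpoly:
  fixes F :: "('i::finite \<Rightarrow> real) \<Rightarrow> real"
  assumes "ratpoly (\<lambda>i x. x i) F"
  shows "\<exists>N. qpoly N F"
  using assms
proof (induction rule: ratpoly.induct)
  case (const c)
  show ?case using qpoly_const by blast
next
  case (var i)
  show ?case using qpoly_var by blast
next
  case (add f g)
  then obtain N M where "qpoly N f" "qpoly M g" by blast
  then have "qpoly (max N M) f" "qpoly (max N M) g" by (auto intro: qpoly_mono)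
  then show ?case using qpoly_add by blast
next
  case (mult f g)
  then show ?case using qpoly_mult by blast
qed

lemma qpoly_power: "qpoly N F \<Longrightarrow> qpoly (k * N) (\<lambda>x. F x ^ k)"
proof (induction k)
  case 0
  show ?case using qpoly_const[of 0 1] by simp
next
  case (Suc k)
  then show ?case using qpoly_mult[of N F "k * N" "\<lambda>x. F x ^ k"] by simp
qed

lemma qpoly_prod:
  "finite B \<Longrightarrow> (\<And>b. b \<in> B \<Longrightarrow> qpoly K (f b)) \<Longrightarrow> qpoly (card B * K) (\<lambda>x. \<Prod>b\<in>B. f b x)"
proof (induction B rule: finite_induct)
  case empty
  show ?case using qpoly_const[of 0 1] by simp
next
  case (insert b B)
  then show ?case using qpoly_mult[of K "f b" "card B * K" "\<lambda>x. \<Prod>b\<in>B. f b x"] by simp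
qed

lemma qpoly_on_line:
  assumes "qpoly N F"
  shows "\<exists>p. \<forall>s. F (\<lambda>i. a i + s * b i) = poly p s"
proof -
  obtain c where c: "\<And>x. F x = (\<Sum>a\<in>expbox UNIV N. of_rat (c a) * monom_at UNIV a x)"
    using assms(1) unfolding qpoly_def by blast
  show ?thesis
    by (intro exI[of _ "\<Sum>e\<in>expbox UNIV N. [:of_rat (c e):] * (\<Prod>i\<in>UNIV. [:a i, b i:] ^ e i)"])
      (simp add: c monom_at_def poly_sum poly_prod mult.commute)
qed

text \<open>No zero divisors: on the line through \<open>a\<close> and \<open>b\<close> both factors
  become univariate polynomials, and the first of them is nonzero because of its value at
  \<open>a\<close>.\<close>

lemma qpoly_mult_eq_zero:
  assumes "qpoly N F" "qpoly M G" "\<And>x. F x * G x = 0" "F a \<noteq> 0"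
  shows "G b = 0"
proof -
  obtain p where p: "\<And>s. F (\<lambda>i. a i + s * (b i - a i)) = poly p s"
    using qpoly_on_line[OF assms(1)] by meson
  obtain q where q: "\<And>s. G (\<lambda>i. a i + s * (b i - a i)) = poly q s"
    using qpoly_on_line[OF assms(2)] by meson
  have "poly (p * q) s = 0" for s
    using assms(3) by (simp flip: p q)
  then have "p * q = 0" using poly_all_0_iff_0 by blast
  moreover have "p \<noteq> 0" using p[of 0] assms(4) by auto
  ultimately have "q = 0" by simp
  then show ?thesis using q[of 1] by simp
qed

text \<open>A discrete mean value bound: enlarging a box of side \<open>B\<close> by
  \<open>d\<close> adds a number of points that is of lower order in the side. With
  \<open>B = K + 1\<close> it bounds the monomials that the multiples of \<open>F\<close> leave
  unaccounted for.\<close>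

lemma binomial_growth: "(B + d) ^ m \<le> B ^ m + m * d * (B + d) ^ (m - 1)" for B d m :: nat
proof (induction m)
  case (Suc m)
  have "(B + d) ^ Suc m = B * (B + d) ^ m + d * (B + d) ^ m"
    by (simp add: algebra_simps)
  also have "B * (B + d) ^ m \<le> B * (B ^ m + m * d * (B + d) ^ (m - 1))"
    using Suc by (rule mult_left_mono) simp
  also have "\<dots> = B ^ Suc m + m * d * (B * (B + d) ^ (m - 1))"
    by (simp add: algebra_simps)
  also have "m * d * (B * (B + d) ^ (m - 1)) \<le> m * d * (B + d) ^ m"
    by (cases m) auto
  finally show ?case by (simp add: algebra_simps)
qed simp

section \<open>Transcendence degree and rational equations\<close>

lemma not_alg_independentI:
  fixes c :: "(real \<Rightarrow> nat) \<Rightarrow> rat"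
  assumes B: "finite B"
    and sum0: "(\<Sum>a\<in>expbox B M. of_rat (c a) * monom_at B a (\<lambda>b. b)) = 0"
    and a0: "a0 \<in> expbox B M" "c a0 \<noteq> 0"
  shows "\<not> alg_independent B"
proof
  assume ind: "alg_independent B"
  \<comment> \<open>Off \<open>B\<close> a box function has the default value of \<open>PiE\<close>,
    so the exponents are reset to 0 there to obtain finite support.\<close>
  define pm where "pm a = Abs_poly_mapping (\<lambda>b. if b \<in> B then a b else 0)" for a :: "real \<Rightarrow> nat"
  have lookup_pm: "Poly_Mapping.lookup (pm a) = (\<lambda>b. if b \<in> B then a b else 0)" for a
    unfolding pm_def by (rule Abs_poly_mapping_inverse) (use B in \<open>auto intro: finite_subset\<close>)
  have keys_pm: "Poly_Mapping.keys (pm a) \<subseteq> B" for a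
    by (auto simp: in_keys_iff lookup_pm split: if_splits)
  have inj: "inj_on pm (expbox B M)"
  proof (rule inj_onI)
    fix a a' assume *: "a \<in> expbox B M" "a' \<in> expbox B M" "pm a = pm a'"
    then have "(if b \<in> B then a b else 0) = (if b \<in> B then a' b else 0)" for b
      using fun_cong[OF lookup_pm[of a], of b] fun_cong[OF lookup_pm[of a'], of b] by simp
    then have "b \<in> B \<Longrightarrow> a b = a' b" for b by presburger
    with * show "a = a'" unfolding expbox_def by (intro PiE_ext) auto
  qed
  define P where "P = (\<Sum>a\<in>expbox B M. Poly_Mapping.single (pm a) (c a))"
  have lookupP: "Poly_Mapping.lookup P m = (\<Sum>a\<in>expbox B M. if pm a = m then c a else 0)" for m
    unfolding P_def lookup_sum lookup_single when_def ..
  have lookup_P_pm: "Poly_Mapping.lookup P (pm a) = c a" if "a \<in> expbox B M" for a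
  proof -
    have "Poly_Mapping.lookup P (pm a) = (\<Sum>a'\<in>expbox B M. if a' = a then c a' else 0)"
      unfolding lookupP using that inj by (intro sum.cong) (auto dest: inj_onD)
    then show ?thesis using that B by simp
  qed
  have keysP: "Poly_Mapping.keys P \<subseteq> pm ` expbox B M"
  proof
    fix m assume "m \<in> Poly_Mapping.keys P"
    then have "(\<Sum>a\<in>expbox B M. if pm a = m then c a else 0) \<noteq> 0" by (simp add: in_keys_iff lookupP)
    then obtain a where "a \<in> expbox B M" "(if pm a = m then c a else 0) \<noteq> 0"
      by (rule sum.not_neutral_contains_not_neutral)
    then show "m \<in> pm ` expbox B M" by (auto split: if_splits)
  qed
  have ev: "(\<Prod>x\<in>Poly_Mapping.keys (pm a). x ^ Poly_Mapping.lookup (pm a) x) = monom_at B a (\<lambda>b. b)" for a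
  proof -
    have "(\<Prod>x\<in>Poly_Mapping.keys (pm a). x ^ Poly_Mapping.lookup (pm a) x) = (\<Prod>x\<in>B. x ^ Poly_Mapping.lookup (pm a) x)"
      by (rule prod.mono_neutral_left) (use B keys_pm in \<open>auto simp: in_keys_iff\<close>)
    then show ?thesis by (simp add: lookup_pm monom_at_def)
  qed
  have "eval_rat_poly P = (\<Sum>m\<in>pm ` expbox B M. of_rat (Poly_Mapping.lookup P m) *
        (\<Prod>x\<in>Poly_Mapping.keys m. x ^ Poly_Mapping.lookup m x))"
    unfolding eval_rat_poly_def
    by (rule sum.mono_neutral_left) (use B keysP in \<open>auto simp: in_keys_iff\<close>)
  also have "\<dots> = (\<Sum>a\<in>expbox B M. of_rat (c a) * monom_at B a (\<lambda>b. b))"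
    by (subst sum.reindex[OF inj]) (simp add: lookup_P_pm ev)
  finally have "eval_rat_poly P = 0" using sum0 by simp
  then have "P = 0"
    using ind keysP keys_pm unfolding alg_independent_def by blast
  then show False using lookup_P_pm[OF a0(1)] a0(2) by simp
qed

text \<open>Counting: the products of powers of the elements of \<open>B\<close>, cleared of denominators, together
  with the multiples of \<open>F\<close> outnumber the monomials of the degree they all fit into. A rational
  linear relation between them becomes, at a zero of \<open>F\<close>, an algebraic relation on \<open>B\<close>.\<close>

lemma not_alg_independent_rational_functions:
  fixes g :: "'i::finite \<Rightarrow> real"
  assumes F: "qpoly d F" "F g = 0" "F x0 \<noteq> 0"
    and B: "finite B" "card B = CARD('i)"
    and num: "\<And>b. b \<in> B \<Longrightarrow> qpoly D (u b)" and den: "\<And>b. b \<in> B \<Longrightarrow> qpoly D (h b)"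
    and quot: "\<And>b. b \<in> B \<Longrightarrow> h b g \<noteq> 0 \<and> b = u b g / h b g"
  shows "\<not> alg_independent B"
proof -
  define m where "m = CARD('i)"
  \<comment> \<open>The multiples of \<open>F\<close> fall short of all monomials by at most
    \<open>m * d * (K + d + 1) ^ (m - 1)\<close>. Since \<open>K + d + 1\<close> is at most
    \<open>C * (M + 1)\<close> with \<open>C\<close> independent of \<open>M\<close>, this is at
    most \<open>m * d * C ^ (m - 1)\<close> times \<open>(M + 1) ^ (m - 1)\<close>. Taking that
    first factor as \<open>M\<close> makes the shortfall smaller than \<open>(M + 1) ^ m\<close>,
    the number of products \<open>H a\<close>.\<close>
  define C where "C = m * D + d + 1"
  define M where "M = m * d * C ^ (m - 1)"
  define K where "K = m * (M * D)"
  \<comment> \<open>The monomial with exponents \<open>a\<close> in the elements of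
    \<open>B\<close>, multiplied by the \<open>M\<close>-th powers of all denominators; every
    \<open>H a\<close> fits into the box of side \<open>K\<close>.\<close>
  define H where "H a x = (\<Prod>b\<in>B. h b x ^ (M - a b) * u b x ^ a b)" for a :: "real \<Rightarrow> nat" and x
  define W where "W = Inl ` expbox B M \<union> Inr ` expbox (UNIV::'i set) K"
  define \<Phi> where "\<Phi> w x = (case w of Inl a \<Rightarrow> H a x | Inr e \<Rightarrow> F x * monom_at UNIV e x)" for w x
  have H: "qpoly (K + d) (H a)" if "a \<in> expbox B M" for a
  proof -
    have "qpoly (M * D) (\<lambda>x. h b x ^ (M - a b) * u b x ^ a b)" if "b \<in> B" for b
    proof -
      have "a b \<le> M" using \<open>a \<in> expbox B M\<close> that by (auto simp: expbox_def)
      then have "(M - a b) * D + a b * D = M * D" by (simp add: distrib_right[symmetric])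
      then show ?thesis
        using qpoly_mult[OF qpoly_power[OF den[OF that], of "M - a b"] qpoly_power[OF num[OF that], of "a b"]]
        by simp
    qed
    then have "qpoly (card B * (M * D)) (H a)"
      unfolding H_def[abs_def] by (rule qpoly_prod[OF B(1)])
    moreover have "card B * (M * D) \<le> K + d" unfolding K_def m_def B(2) by (rule le_add1)
    ultimately show ?thesis by (rule qpoly_mono)
  qed
  have "\<exists>k. \<forall>x. \<Phi> w x = (\<Sum>e\<in>expbox UNIV (K + d). of_rat (k e) * monom_at UNIV e x)" if w: "w \<in> W" for w
  proof -
    consider a where "a \<in> expbox B M" "w = Inl a" | e where "e \<in> expbox UNIV K" "w = Inr e"
      using w by (auto simp: W_def)
    then have "qpoly (K + d) (\<Phi> w)"
    proof cases
      case 1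
      then show ?thesis using H by (simp add: \<Phi>_def[abs_def])
    next
      case 2
      then have "qpoly K (\<lambda>x. monom_at UNIV e x)"
        using qpoly_monom[of e K 1] by (simp add: expbox_UNIV)
      from qpoly_mult[OF F(1) this] 2 show ?thesis by (simp add: \<Phi>_def[abs_def] add.commute)
    qed
    then show ?thesis unfolding qpoly_def .
  qed
  then have "\<forall>w\<in>W. \<exists>k. \<forall>x. \<Phi> w x = (\<Sum>e\<in>expbox UNIV (K + d). of_rat (k e) * monom_at UNIV e x)" by blast
  from bchoice[OF this] obtain k where k: "\<And>w x. w \<in> W \<Longrightarrow>
      \<Phi> w x = (\<Sum>e\<in>expbox UNIV (K + d). of_rat (k w e) * monom_at UNIV e x)" by auto
  have finW: "finite W" using B by (simp add: W_def)
  have "card (expbox (UNIV::'i set) (K + d)) < card W"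
  proof -
    have "K + d + 1 \<le> C * (M + 1)" by (simp add: C_def K_def algebra_simps)
    then have "(K + d + 1) ^ (m - 1) \<le> (C * (M + 1)) ^ (m - 1)" by (rule power_mono) simp
    then have "m * d * (K + d + 1) ^ (m - 1) \<le> m * d * (C * (M + 1)) ^ (m - 1)" by (rule mult_left_mono) simp
    also have "\<dots> = M * (M + 1) ^ (m - 1)" unfolding power_mult_distrib by (simp only: M_def mult.assoc)
    also have "\<dots> < (M + 1) * (M + 1) ^ (m - 1)" by simp
    also have "\<dots> = (M + 1) ^ m" by (simp add: m_def flip: power_Suc)
    finally have "(K + d + 1) ^ m < (K + 1) ^ m + (M + 1) ^ m"
      using binomial_growth[of "K + 1" d m] by (simp add: add.commute add.left_commute)
    moreover have "card W = (M + 1) ^ m + (K + 1) ^ m"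
      unfolding W_def by (subst card_Un_disjoint) (use B in \<open>auto simp: card_image card_expbox m_def\<close>)
    ultimately show ?thesis by (simp add: card_expbox m_def)
  qed
  from homogeneous_system_nontrivial[OF _ finW this, of "\<lambda>e w. k w e"]
  obtain c where c: "\<exists>w\<in>W. c w \<noteq> 0"
    "\<And>e. e \<in> expbox (UNIV::'i set) (K + d) \<Longrightarrow> (\<Sum>w\<in>W. c w * k w e) = 0" by auto
  have rel: "(\<Sum>w\<in>W. of_rat (c w) * \<Phi> w x) = 0" for x
  proof -
    have "(\<Sum>w\<in>W. of_rat (c w) * \<Phi> w x) =
      (\<Sum>w\<in>W. \<Sum>e\<in>expbox UNIV (K + d). of_rat (c w * k w e) * monom_at UNIV e x)"
      by (intro sum.cong refl) (simp add: k sum_distrib_left of_rat_mult mult.assoc)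
    also have "\<dots> = (\<Sum>e\<in>expbox UNIV (K + d). of_rat (\<Sum>w\<in>W. c w * k w e) * monom_at UNIV e x)"
      by (subst sum.swap) (simp add: of_rat_sum sum_distrib_right)
    also have "\<dots> = 0" by (simp add: c(2))
    finally show ?thesis .
  qed
  have split: "(\<Sum>a\<in>expbox B M. of_rat (c (Inl a)) * H a x) +
      F x * (\<Sum>e\<in>expbox UNIV K. of_rat (c (Inr e)) * monom_at UNIV e x) = 0" for x
  proof -
    have "(\<Sum>w\<in>W. of_rat (c w) * \<Phi> w x) = (\<Sum>a\<in>expbox B M. of_rat (c (Inl a)) * H a x) +
      (\<Sum>e\<in>expbox UNIV K. of_rat (c (Inr e)) * (F x * monom_at UNIV e x))"
      unfolding W_def using B(1)
      by (subst sum.union_disjoint) (auto simp: sum.reindex \<Phi>_def)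
    then show ?thesis using rel[of x] by (simp add: sum_distrib_left algebra_simps)
  qed
  \<comment> \<open>A relation among the multiples of \<open>F\<close> alone is \<open>F\<close>
    times a polynomial. As \<open>F\<close> is not identically zero, that polynomial and then all
    its coefficients would vanish.\<close>
  have "\<exists>a\<in>expbox B M. c (Inl a) \<noteq> 0"
  proof (rule ccontr)
    assume no: "\<not> ?thesis"
    let ?G = "\<lambda>x. \<Sum>e\<in>expbox (UNIV::'i set) K. of_rat (c (Inr e)) * monom_at UNIV e x :: real"
    have "F x * ?G x = 0" for x using split[of x] no by simp
    moreover have "qpoly K ?G" unfolding qpoly_def by (intro exI[of _ "\<lambda>e. c (Inr e)"]) simp
    ultimately have "?G x = 0" for x using qpoly_mult_eq_zero[OF F(1) _ _ F(3)] by blast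
    then have "of_rat (c (Inr e)) = (0::real)" if "e \<in> expbox UNIV K" for e
      using monomials_independent[where I="UNIV::'i set" and N=K and e="\<lambda>e. of_rat (c (Inr e))" and a=e] that by simp
    then show False using c(1) no by (auto simp: W_def)
  qed
  then obtain a0 where a0: "a0 \<in> expbox B M" "c (Inl a0) \<noteq> 0" by blast
  have "H a g = (\<Prod>b\<in>B. h b g ^ M) * monom_at B a (\<lambda>b. b)" if "a \<in> expbox B M" for a
    unfolding H_def monom_at_def prod.distrib[symmetric]
  proof (rule prod.cong[OF refl])
    fix b assume b: "b \<in> B"
    have "a b \<le> M" using b that by (auto simp: expbox_def)
    then have "h b g ^ M = h b g ^ (M - a b) * h b g ^ a b" by (simp flip: power_add)
    moreover have "u b g = h b g * b" using quot[OF b] by (metis mult.commute nonzero_eq_divide_eq)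
    ultimately show "h b g ^ (M - a b) * u b g ^ a b = h b g ^ M * b ^ a b"
      by (simp add: power_mult_distrib)
  qed
  then have "(\<Sum>a\<in>expbox B M. of_rat (c (Inl a)) * H a g) =
    (\<Prod>b\<in>B. h b g ^ M) * (\<Sum>a\<in>expbox B M. of_rat (c (Inl a)) * monom_at B a (\<lambda>b. b))"
    unfolding sum_distrib_left by (intro sum.cong) auto
  moreover have "(\<Sum>a\<in>expbox B M. of_rat (c (Inl a)) * H a g) = 0"
    using split[of g] F(2) by simp
  moreover have "(\<Prod>b\<in>B. h b g ^ M) \<noteq> 0" using B(1) quot by simp
  ultimately have "(\<Sum>a\<in>expbox B M. of_rat (c (Inl a)) * monom_at B a (\<lambda>b. b)) = 0" by simp
  from not_alg_independentI[OF B(1) this a0] show ?thesis .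
qed

definition coord :: "'v::finite \<times> 3 \<Rightarrow> ('v \<Rightarrow> real^3) \<Rightarrow> real" where
  "coord i p = p (fst i) $ snd i"

text \<open>The form in which genericity is used once
  \<open>generic_avoids_rational_equations\<close> is proved. It compares \<open>p\<close> with
  other positions on the cylinder only, because the equation of the cylinder is itself rational. It
  passes easily to sub-frameworks.\<close>

definition avoids_rational_equations :: "('v::finite \<Rightarrow> real^3) \<Rightarrow> bool" where
  "avoids_rational_equations p \<longleftrightarrow> on_cylinder p \<and>
     (\<forall>f. ratpoly coord f \<longrightarrow> f p = 0 \<longrightarrow> (\<forall>q. on_cylinder q \<longrightarrow> f q = 0))"

lemma ratpoly_continuous:
  assumes "ratpoly X f" "\<And>i. continuous_on S (\<lambda>s. X i (h s))"
  shows "continuous_on S (\<lambda>s. f (h s))"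
  using assms by (induction rule: ratpoly.induct) (auto intro: continuous_intros)

text \<open>The quotients of rational polynomials at \<open>g\<close> form a subfield, and the hull
  is the least one containing \<open>S\<close>.\<close>

lemma generated_field_rational:
  fixes g :: "'i \<Rightarrow> real"
  assumes "\<And>s. s \<in> S \<Longrightarrow> \<exists>u h. ratpoly (\<lambda>i x. x i) u \<and> ratpoly (\<lambda>i x. x i) h \<and> h g \<noteq> 0 \<and> s = u g / h g"
    and "b \<in> generated_field S"
  shows "\<exists>u h. ratpoly (\<lambda>i x. x i) u \<and> ratpoly (\<lambda>i x. x i) h \<and> h g \<noteq> 0 \<and> b = u g / h g"
proof -
  define R where "R = {u g / h g | u h. ratpoly (\<lambda>i x. x i) u \<and> ratpoly (\<lambda>i x. x i) h \<and> h g \<noteq> 0}"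
  have RI: "u g / h g \<in> R" if "ratpoly (\<lambda>i x. x i) u" "ratpoly (\<lambda>i x. x i) h" "h g \<noteq> 0" for u h
    using that unfolding R_def by blast
  have "is_subfield R"
    unfolding is_subfield_def
  proof (intro conjI ballI)
    show "1 \<in> R" using RI[OF ratpoly_1 ratpoly_1] by simp
    fix x assume "x \<in> R"
    then obtain u h where x: "x = u g / h g" "ratpoly (\<lambda>i x. x i) u" "ratpoly (\<lambda>i x. x i) h" "h g \<noteq> 0"
      unfolding R_def by blast
    show "inverse x \<in> R"
    proof (cases "u g = 0")
      case True
      then show ?thesis using RI[OF ratpoly_0 ratpoly_1] x(1) by simp
    next
      case False
      then show ?thesis using RI[of h u] x by simp
    qed
    fix y assume "y \<in> R"
    then obtain u' h' where y: "y = u' g / h' g" "ratpoly (\<lambda>i x. x i) u'" "ratpoly (\<lambda>i x. x i) h'" "h' g \<noteq> 0"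
      unfolding R_def by blast
    show "x - y \<in> R"
      using RI[OF ratpoly_diff[OF ratpoly.mult[OF x(2) y(3)] ratpoly.mult[OF y(2) x(3)]] ratpoly.mult[OF x(3) y(3)]]
        x(1,4) y(1,4) by (simp add: diff_frac_eq)
    show "x * y \<in> R"
      using RI[OF ratpoly.mult[OF x(2) y(2)] ratpoly.mult[OF x(3) y(3)]] x(1,4) y(1,4) by simp
  qed
  moreover have "S \<subseteq> R" using assms(1) unfolding R_def by fastforce
  ultimately have "generated_field S \<subseteq> R"
    unfolding generated_field_def by (rule hull_minimal[rotated])
  then show ?thesis using assms(2) unfolding R_def by blast
qed

text \<open>A transcendence basis has as many elements as there are parameters \<open>g\<close>, and
  each is a rational function of them. A relation among the parameters would make these elements
  algebraically dependent by the counting argument.\<close>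

lemma transcendence_degree_full:
  fixes g :: "'i::finite \<Rightarrow> real"
  assumes gen: "\<And>s. s \<in> S \<Longrightarrow> \<exists>u h. ratpoly (\<lambda>i x. x i) u \<and> ratpoly (\<lambda>i x. x i) h \<and> h g \<noteq> 0 \<and> s = u g / h g"
    and deg: "has_transcendence_degree (generated_field S) CARD('i)"
    and F: "ratpoly (\<lambda>i x. x i) F" "F g = 0"
  shows "F x = 0"
proof (rule ccontr)
  assume "F x \<noteq> 0"
  obtain B where B: "B \<subseteq> generated_field S" "alg_independent B" "finite B" "card B = CARD('i)"
    using deg unfolding has_transcendence_degree_def transcendence_basis_def by blast
  have "\<exists>u h N. qpoly N u \<and> qpoly N h \<and> h g \<noteq> 0 \<and> b = u g / h g" if b: "b \<in> B" for b
  proof -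
    have "b \<in> generated_field S" using b B(1) by blast
    from generated_field_rational[OF gen this]
    obtain u h where uh: "ratpoly (\<lambda>i x. x i) u" "ratpoly (\<lambda>i x. x i) h" "h g \<noteq> 0" "b = u g / h g"
      by blast
    obtain N M where "qpoly N u" "qpoly M h"
      using ratpoly_imp_qpoly[OF uh(1)] ratpoly_imp_qpoly[OF uh(2)] by blast
    then have "qpoly (max N M) u" "qpoly (max N M) h" by (auto intro: qpoly_mono)
    with uh show ?thesis by blast
  qed
  then have "\<forall>b\<in>B. \<exists>w. qpoly (snd (snd w)) (fst w) \<and> qpoly (snd (snd w)) (fst (snd w)) \<and>
      fst (snd w) g \<noteq> 0 \<and> b = fst w g / fst (snd w) g" by simp
  from bchoice[OF this] obtain w where w: "\<And>b. b \<in> B \<Longrightarrow> qpoly (snd (snd (w b))) (fst (w b)) \<and>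
      qpoly (snd (snd (w b))) (fst (snd (w b))) \<and> fst (snd (w b)) g \<noteq> 0 \<and> b = fst (w b) g / fst (snd (w b)) g"
    by blast
  define D where "D = (\<Sum>b\<in>B. snd (snd (w b)))"
  have D: "snd (snd (w b)) \<le> D" if "b \<in> B" for b
    unfolding D_def using that B(3) by (intro member_le_sum) auto
  obtain d where d: "qpoly d F" using ratpoly_imp_qpoly[OF F(1)] by blast
  have "\<not> alg_independent B"
  proof (rule not_alg_independent_rational_functions[OF d F(2) \<open>F x \<noteq> 0\<close> B(3,4)])
    fix b assume b: "b \<in> B"
    show "qpoly D (fst (w b))" "qpoly D (fst (snd (w b)))"
      using w[OF b] D[OF b] by (auto intro: qpoly_mono)
    show "fst (snd (w b)) g \<noteq> 0 \<and> b = fst (w b) g / fst (snd (w b)) g" using w[OF b] by blast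
  qed
  with B(2) show False by blast
qed

section \<open>Rational parametrisation of the cylinder\<close>

lemma one_plus_square_nonzero: "1 + x\<^sup>2 \<noteq> (0::real)"
  using zero_le_power2[of x] by linarith

text \<open>The parameters of a vertex are the tangent of half its angle and its height. Only the
  line with first coordinate -1 is missed.\<close>

definition cyl_point :: "('v + 'v \<Rightarrow> real) \<Rightarrow> 'v \<Rightarrow> real^3" where
  "cyl_point g v = vector [(1 - (g (Inl v))\<^sup>2) / (1 + (g (Inl v))\<^sup>2),
     2 * g (Inl v) / (1 + (g (Inl v))\<^sup>2), g (Inr v)]"

text \<open>Induction, clearing denominators with a power of their product. The power has to vary: a
  product adds the powers, and a sum is brought to a common denominator.\<close>

lemma ratpoly_cyl_point:
  fixes f :: "('v::finite \<Rightarrow> real^3) \<Rightarrow> real"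
  assumes "ratpoly coord f"
  shows "\<exists>n F. ratpoly (\<lambda>i x. x i) F \<and>
    (\<forall>g. F g = f (cyl_point g) * (\<Prod>v\<in>UNIV. 1 + (g (Inl v))\<^sup>2) ^ n)"
  using assms
proof (induction rule: ratpoly.induct)
  case (const c)
  show ?case by (intro exI[of _ 0] exI[of _ "\<lambda>_. of_rat c"]) (simp add: ratpoly.const)
next
  case (var i)
  obtain v k where i: "i = (v, k)" by force
  define N :: "('v + 'v \<Rightarrow> real) \<Rightarrow> real" where
    "N g = (if k = 1 then 1 - (g (Inl v))\<^sup>2 else if k = 2 then 2 * g (Inl v)
       else g (Inr v) * (1 + (g (Inl v))\<^sup>2))" for g
  have N: "N g = coord i (cyl_point g) * (1 + (g (Inl v))\<^sup>2)" for g
  proof -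
    have "1 + (g (Inl v))\<^sup>2 \<noteq> 0" by (rule one_plus_square_nonzero)
    then show ?thesis
      using exhaust_3[of k] by (auto simp: N_def i coord_def cyl_point_def)
  qed
  have rN: "ratpoly (\<lambda>i x. x i) N"
    unfolding N_def[abs_def]
    by (intro ratpoly_if ratpoly_diff ratpoly.mult ratpoly.add ratpoly_power ratpoly_1 ratpoly_numeral ratpoly.var)
  show ?case
  proof (intro exI[of _ 1] exI[of _ "\<lambda>g. N g * (\<Prod>w\<in>UNIV - {v}. 1 + (g (Inl w))\<^sup>2)"] conjI allI)
    show "ratpoly (\<lambda>i x. x i) (\<lambda>g. N g * (\<Prod>w\<in>UNIV - {v}. 1 + (g (Inl w))\<^sup>2))"
      by (intro ratpoly.mult rN ratpoly_prod ratpoly.add ratpoly_power ratpoly_1 ratpoly.var)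
    show "N g * (\<Prod>w\<in>UNIV - {v}. 1 + (g (Inl w))\<^sup>2)
        = coord i (cyl_point g) * (\<Prod>v\<in>UNIV. 1 + (g (Inl v))\<^sup>2) ^ 1" for g
      unfolding N by (subst prod.remove[of UNIV v]) auto
  qed
next
  case (add f g)
  then obtain n F m G where *: "ratpoly (\<lambda>i x. x i) F" "ratpoly (\<lambda>i x. x i) G"
    "\<forall>x. F x = f (cyl_point x) * (\<Prod>v\<in>UNIV. 1 + (x (Inl v))\<^sup>2) ^ n"
    "\<forall>x. G x = g (cyl_point x) * (\<Prod>v\<in>UNIV. 1 + (x (Inl v))\<^sup>2) ^ m" by blast
  show ?case
  proof (intro exI[of _ "n + m"] conjI allI
      exI[of _ "\<lambda>x. F x * (\<Prod>v\<in>UNIV. 1 + (x (Inl v))\<^sup>2) ^ m + G x * (\<Prod>v\<in>UNIV. 1 + (x (Inl v))\<^sup>2) ^ n"])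
    show "ratpoly (\<lambda>i x. x i) (\<lambda>x. F x * (\<Prod>v\<in>UNIV. 1 + (x (Inl v))\<^sup>2) ^ m + G x * (\<Prod>v\<in>UNIV. 1 + (x (Inl v))\<^sup>2) ^ n)"
      by (intro ratpoly.add ratpoly.mult * ratpoly_prod ratpoly_power ratpoly_1 ratpoly.var)
  qed (simp add: * power_add algebra_simps)
next
  case (mult f g)
  then obtain n F m G where *: "ratpoly (\<lambda>i x. x i) F" "ratpoly (\<lambda>i x. x i) G"
    "\<forall>x. F x = f (cyl_point x) * (\<Prod>v\<in>UNIV. 1 + (x (Inl v))\<^sup>2) ^ n"
    "\<forall>x. G x = g (cyl_point x) * (\<Prod>v\<in>UNIV. 1 + (x (Inl v))\<^sup>2) ^ m" by blast
  show ?case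
    by (intro exI[of _ "n + m"] exI[of _ "\<lambda>x. F x * G x"] conjI allI ratpoly.mult *)
      (simp add: * power_add algebra_simps)
qed

lemma on_cylinder_iff: "on_cylinder q \<longleftrightarrow> (\<forall>v. (q v $ 1)\<^sup>2 + (q v $ 2)\<^sup>2 = 1)"
  by (simp add: on_cylinder_def cylinder_def)

text \<open>Stereographic projection from the point (-1, 0) of the unit circle inverts the
  half-angle formulas.\<close>

lemma cyl_point_surj:
  assumes "on_cylinder q" "q v $ 1 \<noteq> -1"
    "g (Inl v) = q v $ 2 / (1 + q v $ 1)" "g (Inr v) = q v $ 3"
  shows "cyl_point g v = q v"
proof -
  define x y where "x = q v $ 1" and "y = q v $ 2"
  have c: "x\<^sup>2 + y\<^sup>2 = 1" and n: "1 + x \<noteq> 0"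
    using assms(1,2) by (auto simp: on_cylinder_iff x_def y_def add_eq_0_iff)
  have "1 + (y / (1 + x))\<^sup>2 = ((1 + x)\<^sup>2 + y\<^sup>2) / (1 + x)\<^sup>2"
    using n by (simp add: power_divide add_divide_distrib)
  also have "(1 + x)\<^sup>2 + y\<^sup>2 = 2 * (1 + x)" using c by (simp add: power2_eq_square algebra_simps)
  also have "2 * (1 + x) / (1 + x)\<^sup>2 = 2 / (1 + x)"
    using n unfolding power2_eq_square by (rule mult_divide_mult_cancel_right)
  finally have den: "1 + (y / (1 + x))\<^sup>2 = 2 / (1 + x)" .
  have "(1 - (y / (1 + x))\<^sup>2) = 2 - 2 / (1 + x)" using den by simp
  also have "\<dots> = 2 * x / (1 + x)" using n by (simp add: field_simps)
  finally have num: "1 - (y / (1 + x))\<^sup>2 = 2 * x / (1 + x)" .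
  have "(1 - (y / (1 + x))\<^sup>2) / (1 + (y / (1 + x))\<^sup>2) = x" unfolding num den using n by simp
  moreover have "2 * (y / (1 + x)) / (1 + (y / (1 + x))\<^sup>2) = y" unfolding den using n by simp
  ultimately show ?thesis
    by (simp add: vec_eq_iff forall_3 cyl_point_def assms(3,4) x_def y_def)
qed

lemma generic_avoids_rational_equations:
  fixes p :: "'v::finite \<Rightarrow> real^3"
  assumes "generic_on_cylinder p"
  shows "avoids_rational_equations p"
proof -
  have cyl: "on_cylinder p"
    and deg: "has_transcendence_degree (generated_field {p v $ k | v k. True}) CARD('v + 'v)"
    using assms by (auto simp: generic_on_cylinder_def mult_2)
  \<comment> \<open>For a vertex on the missed line the value 0 is a placeholder; its horizontal
    coordinates are -1 and 0, which are rational anyway. Afterwards \<open>ne\<close> excludes the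
    case, because the placeholder would be a rational equation between the parameters.\<close>
  define g where "g i = (case i of Inl v \<Rightarrow> if p v $ 1 = -1 then 0 else p v $ 2 / (1 + p v $ 1)
    | Inr v \<Rightarrow> p v $ 3)" for i
  have gen: "\<exists>u h. ratpoly (\<lambda>i x. x i) u \<and> ratpoly (\<lambda>i x. x i) h \<and> h g \<noteq> 0 \<and> s = u g / h g"
    if "s \<in> {p v $ k | v k. True}" for s
  proof -
    from that obtain v k where s: "s = p v $ k" by blast
    show ?thesis
    proof (cases "p v $ 1 = -1 \<and> k \<noteq> 3")
      case True
      moreover have "(p v $ 1)\<^sup>2 + (p v $ 2)\<^sup>2 = 1" using cyl by (simp add: on_cylinder_iff)
      ultimately have "p v $ 2 = 0" by simp
      then have "s = -1 \<or> s = 0" using True s exhaust_3[of k] by auto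
      then show ?thesis
      proof
        assume "s = -1"
        then show ?thesis
          by (intro exI[of _ "\<lambda>_. -1"] exI[of _ "\<lambda>_. 1"]) (auto intro: ratpoly_1 ratpoly_uminus)
      next
        assume "s = 0"
        then show ?thesis
          by (intro exI[of _ "\<lambda>_. 0"] exI[of _ "\<lambda>_. 1"]) (auto intro: ratpoly_1 ratpoly_0)
      qed
    next
      case False
      have nz: "1 + (g (Inl v))\<^sup>2 \<noteq> 0" by (rule one_plus_square_nonzero)
      have "k = 3 \<or> cyl_point g v = p v"
        using False cyl_point_surj[OF cyl, of v g] by (auto simp: g_def)
      then consider "k = 3" | "cyl_point g v = p v" "k = 1" | "cyl_point g v = p v" "k = 2"
        using exhaust_3[of k] by blast
      then show ?thesis
      proof cases
        case 1
        then show ?thesis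
          by (intro exI[of _ "\<lambda>x. x (Inr v)"] exI[of _ "\<lambda>_. 1"]) (auto intro: ratpoly_1 ratpoly.var simp: s g_def)
      next
        case 2
        have "cyl_point g v $ 1 = (1 - (g (Inl v))\<^sup>2) / (1 + (g (Inl v))\<^sup>2)" by (simp add: cyl_point_def)
        with 2 nz show ?thesis
          by (intro exI[of _ "\<lambda>x. 1 - (x (Inl v))\<^sup>2"] exI[of _ "\<lambda>x. 1 + (x (Inl v))\<^sup>2"])
            (auto intro!: ratpoly_1 ratpoly.var ratpoly_diff ratpoly.add ratpoly_power simp: s)
      next
        case 3
        have "cyl_point g v $ 2 = 2 * g (Inl v) / (1 + (g (Inl v))\<^sup>2)" by (simp add: cyl_point_def)
        with 3 nz show ?thesis
          by (intro exI[of _ "\<lambda>x. 2 * x (Inl v)"] exI[of _ "\<lambda>x. 1 + (x (Inl v))\<^sup>2"])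
            (auto intro!: ratpoly_1 ratpoly.var ratpoly.mult ratpoly_numeral ratpoly.add ratpoly_power simp: s)
      qed
    qed
  qed
  have full: "F x = 0" if "ratpoly (\<lambda>i x. x i) F" "F g = 0" for F x
    by (rule transcendence_degree_full[OF _ deg that]) (fact gen)
  have ne: "p v $ 1 \<noteq> -1" for v
  proof
    assume "p v $ 1 = -1"
    then have "g (Inl v) = 0" by (simp add: g_def)
    from full[OF ratpoly.var this, of "\<lambda>_. 1"] show False by simp
  qed
  have p: "cyl_point g = p"
    by (rule ext, rule cyl_point_surj[OF cyl ne]) (simp_all add: g_def ne)
  show ?thesis
    unfolding avoids_rational_equations_def
  proof (intro conjI allI impI cyl)
    fix f q assume f: "ratpoly coord f" "f p = 0" and q: "on_cylinder (q :: 'v \<Rightarrow> real^3)"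
    obtain n F where F: "ratpoly (\<lambda>i x. x i) F"
      "\<And>g. F g = f (cyl_point g) * (\<Prod>v\<in>UNIV. 1 + (g (Inl v))\<^sup>2) ^ n"
      using ratpoly_cyl_point[OF f(1)] by blast
    have nz: "(\<Prod>v\<in>UNIV. 1 + (x (Inl v))\<^sup>2) ^ n \<noteq> 0" for x :: "'v + 'v \<Rightarrow> real"
    proof -
      have "1 + (x (Inl v))\<^sup>2 \<noteq> 0" for v by (rule one_plus_square_nonzero)
      then show ?thesis by simp
    qed
    have "F g = 0" using F(2)[of g] p f(2) by simp
    from full[OF F(1) this] have F0: "f (cyl_point x) = 0" for x
      using F(2)[of x] nz[of x] by (metis mult_eq_0_iff)
    have f0: "f r = 0" if "on_cylinder r" "\<And>v. r v $ 1 \<noteq> -1" for r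
    proof -
      define x where "x i = (case i of Inl v \<Rightarrow> r v $ 2 / (1 + r v $ 1) | Inr v \<Rightarrow> r v $ 3)" for i
      have "cyl_point x = r"
        by (rule ext, rule cyl_point_surj[OF that]) (simp_all add: x_def)
      with F0[of x] show ?thesis by simp
    qed
    \<comment> \<open>Vertices of \<open>q\<close> on the missed line are turned off it by the angle
      \<open>s\<close>. There \<open>f\<close> vanishes for \<open>0 < s < 1\<close>, hence by
      continuity also at \<open>s = 0\<close>.\<close>
    define r :: "real \<Rightarrow> 'v \<Rightarrow> real^3" where
      "r s v = (if q v $ 1 = -1 then vector [- cos s, sin s, q v $ 3] else q v)" for s v
    have r0: "r 0 = q"
    proof
      fix v
      have "(q v $ 1)\<^sup>2 + (q v $ 2)\<^sup>2 = 1" using q by (simp add: on_cylinder_iff)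
      then have "q v $ 1 = -1 \<Longrightarrow> q v $ 2 = 0" by simp
      then show "r 0 v = q v" by (simp add: r_def vec_eq_iff forall_3)
    qed
    have r_coord: "coord i (r s) = (if q (fst i) $ 1 \<noteq> -1 then q (fst i) $ snd i
        else if snd i = 1 then - cos s else if snd i = 2 then sin s else q (fst i) $ 3)" for i s
      using exhaust_3[of "snd i"] by (auto simp: coord_def r_def)
    have "continuous_on {0..1} (\<lambda>s. coord i (r s))" for i
      unfolding r_coord
      by (cases "q (fst i) $ 1 \<noteq> -1"; cases "snd i = 1"; cases "snd i = 2") (simp_all add: continuous_intros)
    then have "continuous_on {0..1} (\<lambda>s. f (r s))"
      by (rule ratpoly_continuous[OF f(1)])
    then have "continuous_on (closure {0<..<1}) (\<lambda>s. f (r s))" by simp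
    moreover have "f (r s) = 0" if "s \<in> {0<..<1}" for s
    proof (rule f0)
      show "on_cylinder (r s)" using q by (simp add: on_cylinder_iff r_def)
      have "cos s \<noteq> 1" using that cos_monotone_0_pi[of 0 s] pi_gt3 by simp
      then show "r s v $ 1 \<noteq> -1" for v by (simp add: r_def)
    qed
    ultimately have "f (r 0) = 0"
      by (rule continuous_constant_on_closure) auto
    then show "f q = 0" by (simp add: r0)
  qed
qed

section \<open>Rank and completion to an invertible matrix\<close>

lemma rows_eq_range: "rows A = range (($) A)"
  by (auto simp: rows_def row_def)

lemma nullspace_component: "A *v x = 0 \<longleftrightarrow> (\<forall>i. A $ i \<bullet> x = 0)" for A :: "real^'n^'m"
  by (simp add: vec_eq_iff matrix_vector_mul_component)

lemma subspace_nullspace: "subspace {x. A *v x = 0}" for A :: "real^'n^'m"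
  by (auto simp: subspace_def matrix_vector_right_distrib matrix_vector_mult_scaleR)

lemma dim_nullspace: "dim {x. A *v x = 0} + rank A = CARD('n)" for A :: "real^'n^'m"
proof -
  have "(\<forall>x\<in>span (rows A). orthogonal x y) \<longleftrightarrow> A *v y = 0" for y
  proof
    assume *: "\<forall>x\<in>span (rows A). orthogonal x y"
    have "A $ i \<in> span (rows A)" for i by (rule span_base) (simp add: rows_eq_range)
    with * show "A *v y = 0" by (auto simp: nullspace_component orthogonal_def)
  next
    assume "A *v y = 0"
    then have "orthogonal y r" if "r \<in> rows A" for r
      using that by (auto simp: nullspace_component rows_eq_range orthogonal_def inner_commute[of y])
    then show "\<forall>x\<in>span (rows A). orthogonal x y"
      by (metis orthogonal_to_span orthogonal_commute)
  qed
  then have "{y \<in> UNIV. \<forall>x\<in>span (rows A). orthogonal x y} = {x. A *v x = 0}" by simp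
  then show ?thesis
    using dim_subspace_orthogonal_to_vectors[of "span (rows A)" UNIV]
    by (simp add: row_rank_def)
qed

text \<open>A substitute for minors: a square matrix whose rows are rows of \<open>A\<close> or unit
  vectors, as \<open>\<tau>\<close> prescribes. Its determinant is polynomial in the entries of
  \<open>A\<close>, and if it is nonzero, the rows of \<open>A\<close> that occur are independent.
  So it certifies a lower bound on the rank that can be moved between positions.\<close>

definition completed_matrix :: "real^'j^'i \<Rightarrow> ('j \<Rightarrow> 'i + 'j) \<Rightarrow> real^'j^'j" where
  "completed_matrix A \<tau> = (\<chi> k. case \<tau> k of Inl i \<Rightarrow> A $ i | Inr l \<Rightarrow> axis l 1)"

definition selected :: "('j \<Rightarrow> 'i + 'j) \<Rightarrow> 'i set" where
  "selected \<tau> = {i. Inl i \<in> range \<tau>}"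

lemma completed_matrix_Inl: "\<tau> k = Inl i \<Longrightarrow> completed_matrix A \<tau> $ k = A $ i"
  and completed_matrix_Inr: "\<tau> k = Inr l \<Longrightarrow> completed_matrix A \<tau> $ k = axis l 1"
  by (simp_all add: completed_matrix_def)

lemma selected_rows_independent:
  fixes A :: "real^'j^'i"
  assumes "det (completed_matrix A \<tau>) \<noteq> 0"
  shows "independent ((($) A) ` selected \<tau>)" "inj_on (($) A) (selected \<tau>)"
    "card (selected \<tau>) \<le> rank A"
proof -
  let ?M = "completed_matrix A \<tau>"
  have ind: "independent (rows ?M)"
    using det_dependent_rows[of ?M] assms by (auto simp: dependent_vec_eq)
  have "(($) A) ` selected \<tau> \<subseteq> rows ?M"
  proof
    fix x assume "x \<in> (($) A) ` selected \<tau>"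
    then obtain i k where "x = A $ i" "\<tau> k = Inl i" by (force simp: selected_def)
    then have "?M $ k = x" by (simp add: completed_matrix_Inl)
    then show "x \<in> rows ?M" unfolding rows_eq_range by blast
  qed
  with ind show 1: "independent ((($) A) ` selected \<tau>)" by (rule independent_mono)
  show 2: "inj_on (($) A) (selected \<tau>)"
  proof (rule inj_onI)
    fix i j assume *: "i \<in> selected \<tau>" "j \<in> selected \<tau>" "A $ i = A $ j"
    then obtain k l where kl: "\<tau> k = Inl i" "\<tau> l = Inl j" by (force simp: selected_def)
    then have "row k ?M = row l ?M" using * by (simp add: row_def completed_matrix_Inl)
    then have "k = l" using det_identical_rows[of k l ?M] assms by blast
    with kl show "i = j" by simp
  qed
  have "card (selected \<tau>) = card ((($) A) ` selected \<tau>)" using 2 by (simp add: card_image)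
  also have "\<dots> \<le> dim (rows A)"
    using 1 by (intro independent_card_le_dim) (auto simp: rows_eq_range)
  finally show "card (selected \<tau>) \<le> rank A" by (simp add: row_rank_def)
qed

lemma selected_rows_span:
  fixes A :: "real^'j^'i"
  assumes "det (completed_matrix A \<tau>) \<noteq> 0" "rank A \<le> card (selected \<tau>)"
  shows "A $ i \<in> span ((($) A) ` selected \<tau>)"
proof -
  have "rows A \<subseteq> span ((($) A) ` selected \<tau>)"
    using assms selected_rows_independent[OF assms(1)]
    by (intro card_ge_dim_independent) (auto simp: rows_eq_range card_image row_rank_def)
  then show ?thesis by (auto simp: rows_eq_range)
qed

lemma selected_rows_nullspace:
  fixes A :: "real^'j^'i"
  assumes "det (completed_matrix A \<tau>) \<noteq> 0" "rank A \<le> card (selected \<tau>)"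
    and "\<And>i. i \<in> selected \<tau> \<Longrightarrow> A $ i \<bullet> x = 0"
  shows "A *v x = 0"
  unfolding nullspace_component
proof
  fix i
  have "orthogonal x (A $ i)"
    using selected_rows_span[OF assms(1,2)]
    by (rule orthogonal_to_span) (auto simp: orthogonal_def inner_commute[of x] assms(3))
  then show "A $ i \<bullet> x = 0" by (simp add: orthogonal_def inner_commute)
qed

text \<open>Two basis extensions: from \<open>S\<close> to a basis of the row space, then by unit
  vectors to a basis of the whole space. Prescribing \<open>S\<close> later keeps all cylinder
  constraints among the selected rows.\<close>

lemma completed_matrix_exists:
  fixes A :: "real^'j^'i"
  assumes "independent ((($) A) ` S)" "inj_on (($) A) S"
  obtains \<tau> where "det (completed_matrix A \<tau>) \<noteq> 0" "S \<subseteq> selected \<tau>" "card (selected \<tau>) = rank A"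
proof -
  have "(($) A) ` S \<subseteq> rows A" by (auto simp: rows_eq_range)
  then obtain B where B: "(($) A) ` S \<subseteq> B" "B \<subseteq> rows A" "independent B" "rows A \<subseteq> span B"
    using maximal_independent_subset_extend assms(1) by blast
  obtain C where C: "B \<subseteq> C" "C \<subseteq> B \<union> Basis" "independent C" "B \<union> Basis \<subseteq> span C"
    using maximal_independent_subset_extend[of B "B \<union> Basis"] B(3) by blast
  have "span C = UNIV"
    using span_mono[of Basis "span C"] C(4) by (simp add: span_span) blast
  then have cardC: "card C = CARD('j)"
    using basis_card_eq_dim[of C UNIV] C(3) by (simp add: dim_UNIV)
  have finC: "finite C" using C(3) by (rule finiteI_independent)
  then obtain h where h: "bij_betw h (UNIV :: 'j set) C"
    using finite_same_card_bij[of "UNIV :: 'j set" C] cardC by auto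
  \<comment> \<open>Equal rows may carry different indices, so a row that comes from
    \<open>S\<close> must be given its index in \<open>S\<close>.\<close>
  define \<iota> where "\<iota> b = (if b \<in> (($) A) ` S then inv_into S (($) A) b else inv (($) A) b)" for b
  have \<iota>: "A $ \<iota> b = b" if "b \<in> B" for b
    using that B(2) unfolding \<iota>_def by (auto simp: rows_eq_range f_inv_into_f)
  define \<tau> where "\<tau> k = (if h k \<in> B then Inl (\<iota> (h k)) else Inr (SOME l. axis l 1 = h k))" for k
  have row: "completed_matrix A \<tau> $ k = h k" for k
  proof (cases "h k \<in> B")
    case True
    then show ?thesis using completed_matrix_Inl[of \<tau> k "\<iota> (h k)"] by (simp add: \<tau>_def \<iota>)
  next
    case False
    have "h k \<in> C" using h by (auto simp: bij_betw_def)
    then have "h k \<in> Basis" using False C(2) by blast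
    then have "\<exists>l. axis l 1 = h k" by (auto simp: Basis_vec_def)
    then have "axis (SOME l. axis l 1 = h k) 1 = h k" by (rule someI_ex)
    then show ?thesis using False completed_matrix_Inr[of \<tau> k] by (simp add: \<tau>_def)
  qed
  show thesis
  proof
    have "rows (completed_matrix A \<tau>) = C"
      using h by (auto simp: rows_eq_range row bij_betw_def)
    then have "rank (completed_matrix A \<tau>) = CARD('j)"
      using C(3) cardC by (simp add: row_rank_def dim_eq_card_independent)
    then show "det (completed_matrix A \<tau>) \<noteq> 0" by (simp add: det_eq_0_rank)
    have sel: "selected \<tau> = \<iota> ` B"
    proof (intro subset_antisym subsetI)
      fix i assume "i \<in> selected \<tau>"
      then obtain k where "\<tau> k = Inl i" by (force simp: selected_def)
      then show "i \<in> \<iota> ` B" by (auto simp: \<tau>_def split: if_splits)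
    next
      fix i assume "i \<in> \<iota> ` B"
      then obtain b where b: "b \<in> B" "i = \<iota> b" by blast
      then obtain k where "h k = b" using h C(1) by (metis bij_betw_iff_bijections subsetD)
      then have "\<tau> k = Inl i" using b by (simp add: \<tau>_def)
      then show "i \<in> selected \<tau>" unfolding selected_def by (metis mem_Collect_eq rangeI)
    qed
    show "S \<subseteq> selected \<tau>"
    proof
      fix i assume i: "i \<in> S"
      then have "\<iota> (A $ i) = i" using assms(2) by (simp add: \<iota>_def inv_into_f_f)
      then show "i \<in> selected \<tau>" unfolding sel using i B(1) by (metis image_eqI image_subset_iff)
    qed
    have "inj_on \<iota> B" using \<iota> by (metis inj_onI)
    then have "card (selected \<tau>) = card B" by (simp add: sel card_image)
    then show "card (selected \<tau>) = rank A"
      using basis_card_eq_dim[OF B(2,4,3)] by (simp add: row_rank_def)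
  qed
qed

lemma rank_eq_imp_nullspace_eq:
  fixes A :: "real^'n^'m" and B :: "real^'n^'k"
  assumes "{x. A *v x = 0} \<subseteq> {x. B *v x = 0}" "rank A \<le> rank B"
  shows "{x. A *v x = 0} = {x. B *v x = 0}"
  using dim_nullspace[of A] dim_nullspace[of B] assms
  by (intro subspace_dim_equal subspace_nullspace) auto

lemma ratpoly_completed_matrix:
  assumes "\<And>i j. ratpoly X (\<lambda>x. A x $ i $ j)"
  shows "ratpoly X (\<lambda>x. completed_matrix (A x) \<tau> $ i $ j)"
proof (cases "\<tau> i")
  case (Inl a)
  then show ?thesis using assms by (simp add: completed_matrix_Inl)
next
  case (Inr l)
  then show ?thesis by (simp add: completed_matrix_Inr axis_def ratpoly_0 ratpoly_1)
qed

lemma rank_semicontinuous: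
  fixes A :: "real \<Rightarrow> real^'n^'m"
  assumes "\<And>i j. isCont (\<lambda>t. A t $ i $ j) a"
  shows "eventually (\<lambda>t. rank (A a) \<le> rank (A t)) (at a)"
proof -
  obtain \<tau> where \<tau>: "det (completed_matrix (A a) \<tau>) \<noteq> 0" "card (selected \<tau>) = rank (A a)"
    using completed_matrix_exists[of "A a" "{}"] by (auto simp: independent_empty)
  have "isCont (\<lambda>t. completed_matrix (A t) \<tau> $ i $ j) a" for i j
    using assms by (cases "\<tau> i") (simp_all add: completed_matrix_Inl completed_matrix_Inr)
  then have "isCont (\<lambda>t. det (completed_matrix (A t) \<tau>)) a"
    unfolding det_def by (intro continuous_sum continuous_mult continuous_prod continuous_const) auto
  then have "eventually (\<lambda>t. det (completed_matrix (A t) \<tau>) \<noteq> 0) (at a)"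
    using \<tau>(1) unfolding isCont_def by (rule tendsto_imp_eventually_ne)
  then show ?thesis
    by (rule eventually_mono) (metis \<tau>(2) selected_rows_independent(3))
qed

text \<open>A determinant that certifies the rank at \<open>q\<close> is a rational polynomial in
  the position that is nonzero somewhere, so it is nonzero at \<open>p\<close>.\<close>

lemma rank_generic_maximal:
  fixes A :: "('v::finite \<Rightarrow> real^3) \<Rightarrow> real^'n^'m"
  assumes p: "avoids_rational_equations p" and q: "on_cylinder q"
    and A: "\<And>i j. ratpoly coord (\<lambda>p. A p $ i $ j)"
  shows "rank (A q) \<le> rank (A p)"
proof -
  obtain \<tau> where \<tau>: "det (completed_matrix (A q) \<tau>) \<noteq> 0" "card (selected \<tau>) = rank (A q)"
    using completed_matrix_exists[of "A q" "{}"] by (auto simp: independent_empty)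
  have "ratpoly coord (\<lambda>p. det (completed_matrix (A p) \<tau>))"
    by (intro ratpoly_det ratpoly_completed_matrix A)
  then have "det (completed_matrix (A p) \<tau>) \<noteq> 0"
    using p q \<tau>(1) unfolding avoids_rational_equations_def by metis
  then show ?thesis using selected_rows_independent(3) \<tau>(2) by metis
qed

section \<open>The rigidity matrix and its cokernel\<close>

text \<open>Rows are indexed by all vertex sets, with zero rows off \<open>E\<close>, so the
  matrices of different graphs have the same shape and can be compared. The vertex rows are normals
  of the cylinder. \<open>UNIV\<close> acts as the complete graph, because a set that is not a pair
  of distinct vertices gives a zero row.\<close>

definition rigidity_matrix ::
  "'v::finite set set \<Rightarrow> ('v \<Rightarrow> real^3) \<Rightarrow> real^('v \<times> 3)^('v set + 'v)" where
  "rigidity_matrix E p = (\<chi> r c. case r of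
      Inl e \<Rightarrow> (\<Sum>j\<in>UNIV. if {fst c, j} \<in> E \<and> {fst c, j} = e then p (fst c) $ snd c - p j $ snd c else 0)
    | Inr v \<Rightarrow> if fst c = v then horizontal (p v) $ snd c else 0)"

definition velocity :: "real^('v::finite \<times> 3) \<Rightarrow> 'v \<Rightarrow> real^3" where
  "velocity m v = (\<chi> k. m $ (v, k))"

lemma sum_UNIV_Plus: "(\<Sum>r\<in>UNIV. f r) = (\<Sum>a\<in>UNIV. f (Inl a)) + (\<Sum>b\<in>UNIV. f (Inr b))"
  for f :: "'a::finite + 'b::finite \<Rightarrow> 'c::comm_monoid_add"
  unfolding UNIV_Plus_UNIV[symmetric] by (subst sum.Plus) auto

lemma sum_UNIV_Times: "(\<Sum>c\<in>UNIV. f c) = (\<Sum>a\<in>UNIV. \<Sum>b\<in>UNIV. f (a, b))"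
  for f :: "'a::finite \<times> 'b::finite \<Rightarrow> 'c::comm_monoid_add"
  unfolding UNIV_Times_UNIV[symmetric] sum.cartesian_product by simp

lemma horizontal_nth: "horizontal q $ k = (if k = 3 then 0 else q $ k)"
  using exhaust_3[of k] by (auto simp: horizontal_def)

lemma equilibrium_stress_iff:
  "equilibrium_stress E p (\<lambda>e. s $ Inl e) (\<lambda>v. s $ Inr v) \<longleftrightarrow> transpose (rigidity_matrix E p) *v s = 0"
proof -
  have "(transpose (rigidity_matrix E p) *v s) $ (i, k) =
      ((\<Sum>j\<in>UNIV. weight E (\<lambda>e. s $ Inl e) i j *\<^sub>R (p i - p j)) + s $ Inr i *\<^sub>R horizontal (p i)) $ k" for i k
  proof -
    have "(\<Sum>e\<in>UNIV. rigidity_matrix E p $ Inl e $ (i, k) * s $ Inl e) =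
      (\<Sum>j\<in>UNIV. \<Sum>e\<in>UNIV. if e = {i, j} then (if {i, j} \<in> E then (p i $ k - p j $ k) * s $ Inl e else 0) else 0)"
      by (subst sum.swap) (auto simp: rigidity_matrix_def sum_distrib_right intro!: sum.cong)
    also have "\<dots> = (\<Sum>j\<in>UNIV. weight E (\<lambda>e. s $ Inl e) i j * (p i $ k - p j $ k))"
      by (auto simp: weight_def intro!: sum.cong)
    finally have 1: "(\<Sum>e\<in>UNIV. rigidity_matrix E p $ Inl e $ (i, k) * s $ Inl e) = \<dots>" .
    have "(\<Sum>v\<in>UNIV. rigidity_matrix E p $ Inr v $ (i, k) * s $ Inr v) =
      (\<Sum>v\<in>UNIV. if v = i then horizontal (p i) $ k * s $ Inr i else 0)"
      by (intro sum.cong) (auto simp: rigidity_matrix_def)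
    then have 2: "(\<Sum>v\<in>UNIV. rigidity_matrix E p $ Inr v $ (i, k) * s $ Inr v) = horizontal (p i) $ k * s $ Inr i"
      by simp
    show ?thesis
      by (simp add: matrix_vector_mult_def transpose_def sum_UNIV_Plus 1 2)
  qed
  then show ?thesis
    by (auto simp: equilibrium_stress_def vec_eq_iff)
qed

lemma sum_unordered_pair:
  fixes f :: "'v::finite \<Rightarrow> 'v \<Rightarrow> real"
  assumes "a \<noteq> b"
  shows "(\<Sum>i\<in>UNIV. \<Sum>j\<in>UNIV. if {i, j} = {a, b} then f i j else 0) = f a b + f b a"
proof -
  have "(\<Sum>i\<in>UNIV. \<Sum>j\<in>UNIV. if {i, j} = {a, b} then f i j else 0) =
    (\<Sum>c\<in>UNIV. if {fst c, snd c} = {a, b} then f (fst c) (snd c) else 0)"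
    unfolding sum_UNIV_Times by (simp cong: if_cong)
  also have "\<dots> = (\<Sum>c\<in>{(a, b), (b, a)}. f (fst c) (snd c))"
    by (rule sum.mono_neutral_cong_right) (auto simp: doubleton_eq_iff)
  finally show ?thesis using assms by simp
qed

lemma inner_vertex_row: "rigidity_matrix E p $ Inr v \<bullet> m = horizontal (p v) \<bullet> velocity m v"
proof -
  have "rigidity_matrix E p $ Inr v \<bullet> m =
    (\<Sum>i\<in>UNIV. if i = v then (\<Sum>k\<in>UNIV. horizontal (p v) $ k * m $ (v, k)) else 0)"
    unfolding inner_vec_def sum_UNIV_Times
    by (intro sum.cong) (auto simp: rigidity_matrix_def)
  then show ?thesis by (simp add: inner_vec_def velocity_def)
qed

lemma inner_edge_row_sum:
  "rigidity_matrix E p $ Inl e \<bullet> m =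
    (\<Sum>i\<in>UNIV. \<Sum>j\<in>UNIV. if {i, j} = e then if e \<in> E then (p i - p j) \<bullet> velocity m i else 0 else 0)"
proof -
  have "rigidity_matrix E p $ Inl e \<bullet> m = (\<Sum>i\<in>UNIV. \<Sum>k\<in>UNIV. \<Sum>j\<in>UNIV.
      if {i, j} = e then if e \<in> E then (p i $ k - p j $ k) * m $ (i, k) else 0 else 0)"
    unfolding inner_vec_def sum_UNIV_Times
    by (auto simp: rigidity_matrix_def sum_distrib_right intro!: sum.cong)
  also have "\<dots> = (\<Sum>i\<in>UNIV. \<Sum>j\<in>UNIV. \<Sum>k\<in>UNIV.
      if {i, j} = e then if e \<in> E then (p i $ k - p j $ k) * m $ (i, k) else 0 else 0)"
    by (subst sum.swap) simp
  also have "\<dots> = (\<Sum>i\<in>UNIV. \<Sum>j\<in>UNIV. if {i, j} = e then if e \<in> E then (p i - p j) \<bullet> velocity m i else 0 else 0)"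
    by (auto simp: inner_vec_def velocity_def intro!: sum.cong)
  finally show ?thesis .
qed

lemma inner_edge_row:
  assumes "{a, b} \<in> E"
  shows "rigidity_matrix E p $ Inl {a, b} \<bullet> m = (p a - p b) \<bullet> (velocity m a - velocity m b)"
proof (cases "a = b")
  case True
  have "(if {i, j} = {a, b} then if {a, b} \<in> E then (p i - p j) \<bullet> velocity m i else 0 else 0) = 0" for i j
    using True by auto
  then show ?thesis unfolding inner_edge_row_sum using True by simp
next
  case False
  have "rigidity_matrix E p $ Inl {a, b} \<bullet> m = (p a - p b) \<bullet> velocity m a + (p b - p a) \<bullet> velocity m b"
    unfolding inner_edge_row_sum sum_unordered_pair[OF False] using assms by simp
  then show ?thesis by (simp add: inner_diff_left inner_diff_right)
qed

lemma edge_row_eq_zero: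
  assumes "e \<notin> E \<or> (\<forall>a b. e \<noteq> {a, b})"
  shows "rigidity_matrix E p $ Inl e = 0"
proof -
  have no: "({i, j} \<in> E \<and> {i, j} = e) = False" for i j using assms by blast
  then have "rigidity_matrix E p $ Inl e $ c = 0" for c
    by (simp add: rigidity_matrix_def no cong: if_cong)
  then show ?thesis by (simp add: vec_eq_iff)
qed

lemma rigidity_matrix_nullspace:
  "rigidity_matrix E p *v m = 0 \<longleftrightarrow>
    (\<forall>v. horizontal (p v) \<bullet> velocity m v = 0) \<and>
    (\<forall>a b. {a, b} \<in> E \<longrightarrow> (p a - p b) \<bullet> (velocity m a - velocity m b) = 0)"
proof
  assume "rigidity_matrix E p *v m = 0"
  then show "(\<forall>v. horizontal (p v) \<bullet> velocity m v = 0) \<and>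
    (\<forall>a b. {a, b} \<in> E \<longrightarrow> (p a - p b) \<bullet> (velocity m a - velocity m b) = 0)"
    by (auto simp: nullspace_component simp flip: inner_vertex_row[of E] inner_edge_row)
next
  assume *: "(\<forall>v. horizontal (p v) \<bullet> velocity m v = 0) \<and>
    (\<forall>a b. {a, b} \<in> E \<longrightarrow> (p a - p b) \<bullet> (velocity m a - velocity m b) = 0)"
  have "rigidity_matrix E p $ r \<bullet> m = 0" for r
  proof (cases r)
    case (Inr v)
    then show ?thesis using * by (simp add: inner_vertex_row)
  next
    case (Inl e)
    show ?thesis
    proof (cases "e \<notin> E \<or> (\<forall>a b. e \<noteq> {a, b})")
      case True
      then show ?thesis using Inl by (simp add: edge_row_eq_zero)
    next
      case False
      then show ?thesis using Inl * by (auto simp: inner_edge_row)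
    qed
  qed
  then show "rigidity_matrix E p *v m = 0" by (simp add: nullspace_component)
qed

lemma ratpoly_coord: "ratpoly coord (\<lambda>p. p v $ k)"
  using ratpoly.var[of coord "(v, k)"] by (simp add: coord_def[abs_def])

lemma ratpoly_rigidity_matrix: "ratpoly coord (\<lambda>p. rigidity_matrix E p $ r $ c)"
proof (cases r)
  case (Inl e)
  then show ?thesis
    by (simp add: rigidity_matrix_def)
      (intro ratpoly_sum ratpoly_if ratpoly_diff ratpoly_coord ratpoly_0)
next
  case (Inr v)
  then show ?thesis
    unfolding rigidity_matrix_def horizontal_nth
    by simp (intro conjI impI ratpoly_if ratpoly_coord ratpoly_0)
qed

section \<open>Transfer of a stress to a generic position\<close>

abbreviation stress_vector_matrix :: "'v::finite set set \<Rightarrow> real^('v set + 'v) \<Rightarrow> real^('v + 'v + 'v)^('v + 'v + 'v)" where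
  "stress_vector_matrix E s \<equiv> cyl_stress_matrix E (\<lambda>e. s $ Inl e) (\<lambda>v. s $ Inr v)"

lemma ratpoly_stress_vector_matrix:
  "ratpoly (\<lambda>r s. s $ r) (\<lambda>s. stress_vector_matrix E s $ a $ b)"
proof -
  have w: "ratpoly (\<lambda>r s. s $ r) (\<lambda>s. weight E (\<lambda>e. s $ Inl e) i j)" for i j
    unfolding weight_def by (intro ratpoly_if ratpoly.var ratpoly_0)
  have o: "ratpoly (\<lambda>r s. s $ r) (\<lambda>s. stress_matrix E (\<lambda>e. s $ Inl e) $ i $ j)" for i j
    by (simp add: stress_matrix_def) (intro ratpoly_if ratpoly_sum ratpoly_uminus w)
  have d: "ratpoly (\<lambda>r s. s $ r) (\<lambda>s. diag_matrix (\<lambda>v. s $ Inr v) $ i $ j)" for i j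
    by (simp add: diag_matrix_def) (intro ratpoly_if ratpoly_0 ratpoly.var)
  show ?thesis
    by (cases a; cases b; (cases "projr a")?; (cases "projr b")?)
      (simp_all add: cyl_stress_matrix_def block_diag_def o ratpoly.add[OF o d] ratpoly_0)
qed

lemma ratpoly_tendsto:
  assumes "ratpoly X f" "\<And>i. (\<lambda>n. X i (h n)) \<longlonglongrightarrow> X i x"
  shows "(\<lambda>n. f (h n)) \<longlonglongrightarrow> f x"
  using assms by (induction rule: ratpoly.induct) (auto intro: tendsto_intros)

lemma tendsto_det:
  fixes A :: "nat \<Rightarrow> real^'n^'n"
  assumes "\<And>i j. (\<lambda>n. A n $ i $ j) \<longlonglongrightarrow> B $ i $ j"
  shows "(\<lambda>n. det (A n)) \<longlonglongrightarrow> det B"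
  unfolding det_def by (intro tendsto_sum tendsto_mult tendsto_prod tendsto_const assms)

lemma rational_approximation:
  "(\<lambda>n. of_rat (of_int \<lfloor>x * real (Suc n)\<rfloor> / of_nat (Suc n))) \<longlonglongrightarrow> (x::real)"
proof (rule tendsto_sandwich)
  show "eventually (\<lambda>n. x - inverse (real (Suc n)) \<le> of_rat (of_int \<lfloor>x * real (Suc n)\<rfloor> / of_nat (Suc n))) sequentially"
  proof (rule always_eventually, rule allI)
    fix n
    have "(x * real (Suc n) - 1) / real (Suc n) \<le> real_of_int \<lfloor>x * real (Suc n)\<rfloor> / real (Suc n)"
      by (intro divide_right_mono) linarith+
    then show "x - inverse (real (Suc n)) \<le> of_rat (of_int \<lfloor>x * real (Suc n)\<rfloor> / of_nat (Suc n))"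
      by (simp add: of_rat_divide diff_divide_distrib inverse_eq_divide del: of_nat_Suc)
  qed
  show "eventually (\<lambda>n. of_rat (of_int \<lfloor>x * real (Suc n)\<rfloor> / of_nat (Suc n)) \<le> x) sequentially"
  proof (rule always_eventually, rule allI)
    fix n
    have "real_of_int \<lfloor>x * real (Suc n)\<rfloor> / real (Suc n) \<le> x * real (Suc n) / real (Suc n)"
      by (intro divide_right_mono) linarith+
    then show "of_rat (of_int \<lfloor>x * real (Suc n)\<rfloor> / of_nat (Suc n)) \<le> x"
      by (simp add: of_rat_divide del: of_nat_Suc)
  qed
  show "(\<lambda>n. x - inverse (real (Suc n))) \<longlonglongrightarrow> x"
    using tendsto_diff[OF tendsto_const LIMSEQ_inverse_real_of_nat, of x] by simp
qed simp

text \<open>Cramer's rule writes the stresses as polynomials in the framework and in free parameters.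
  Real parameters that work at \<open>q\<close> are approximated by rational ones, so that the determinant
  certifying the rank becomes a rational equation in the framework.\<close>

lemma stress_transfer:
  fixes E :: "'v::finite set set"
  assumes p: "avoids_rational_equations p" and q: "on_cylinder q"
    and rank: "rank (rigidity_matrix E p) \<le> rank (rigidity_matrix E q)"
    and stress: "equilibrium_stress E q \<omega> l"
  shows "\<exists>\<omega>' l'. equilibrium_stress E p \<omega>' l' \<and>
    rank (cyl_stress_matrix E \<omega> l) \<le> rank (cyl_stress_matrix E \<omega>' l')"
proof -
  define s where "s = (\<chi> r. case r of Inl e \<Rightarrow> \<omega> e | Inr v \<Rightarrow> l v)"
  have s: "(\<lambda>e. s $ Inl e) = \<omega>" "(\<lambda>v. s $ Inr v) = l" by (auto simp: s_def)
  define R where "R p = transpose (rigidity_matrix E p)" for p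
  have ratR: "ratpoly coord (\<lambda>p. R p $ i $ j)" for i j
    using ratpoly_rigidity_matrix by (simp add: R_def transpose_def)
  obtain \<tau> where \<tau>: "det (completed_matrix (R q) \<tau>) \<noteq> 0" "card (selected \<tau>) = rank (R q)"
    using completed_matrix_exists[of "R q" "{}"] by (auto simp: independent_empty)
  \<comment> \<open>Selected equilibrium equations at \<open>q\<close>, completed by coordinates of
    the stress; these coordinates are the free parameters.\<close>
  define M where "M p = completed_matrix (R p) \<tau>" for p
  \<comment> \<open>The numerators in Cramer's rule: they solve the system with right-hand side
    \<open>c\<close> up to the factor \<open>det (M p)\<close>, and without the division they are
    polynomial in the position.\<close>
  define \<sigma> where "\<sigma> p c = (\<chi> k. det (\<chi> i j. if j = k then c $ i else M p $ i $ j))" for p c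
  have ratM: "ratpoly coord (\<lambda>p. M p $ i $ j)" for i j
    unfolding M_def by (intro ratpoly_completed_matrix ratR)
  have M\<sigma>: "M p *v \<sigma> p c = det (M p) *\<^sub>R c" if "det (M p) \<noteq> 0" for p c
  proof -
    have "\<sigma> p c = det (M p) *\<^sub>R (\<chi> k. det (\<chi> i j. if j = k then c $ i else M p $ i $ j) / det (M p))"
      using that by (simp add: \<sigma>_def vec_eq_iff)
    moreover have "M p *v (\<chi> k. det (\<chi> i j. if j = k then c $ i else M p $ i $ j) / det (M p)) = c"
      using cramer[OF that] by blast
    ultimately show ?thesis by (simp only: matrix_vector_mult_scaleR)
  qed
  have Mq: "det (M q) \<noteq> 0" using \<tau>(1) by (simp add: M_def)
  define c where "c = M q *v (inverse (det (M q)) *\<^sub>R s)"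
  have \<sigma>c: "\<sigma> q c = s"
  proof -
    have "M q *v \<sigma> q c = M q *v s"
      using M\<sigma>[OF Mq] Mq by (simp add: c_def matrix_vector_mult_scaleR)
    moreover have "inj ((*v) (M q))"
      using Mq invertible_det_nz[of "M q"]
      by (simp add: invertible_left_inverse matrix_left_invertible_injective)
    ultimately show ?thesis by (simp add: inj_eq)
  qed
  have c0: "c $ k = 0" if "\<tau> k = Inl i" for k i
  proof -
    have "R q *v s = 0"
      using stress equilibrium_stress_iff[of E q s] unfolding s R_def by simp
    then have "R q $ i \<bullet> s = 0" unfolding nullspace_component by blast
    then show ?thesis
      by (simp add: c_def matrix_vector_mul_component M_def completed_matrix_Inl[of \<tau> k i, OF that])
  qed
  obtain \<rho> where \<rho>: "det (completed_matrix (stress_vector_matrix E s) \<rho>) \<noteq> 0"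
    "card (selected \<rho>) = rank (stress_vector_matrix E s)"
    using completed_matrix_exists[of "stress_vector_matrix E s" "{}"] by (auto simp: independent_empty)
  define f where "f p c = det (completed_matrix (stress_vector_matrix E (\<sigma> p c)) \<rho>)" for p c
  \<comment> \<open>Rounding down sends 0 to exactly 0, so the equations recorded by
    \<open>c0\<close> survive the approximation.\<close>
  define r :: "nat \<Rightarrow> 'v set + 'v \<Rightarrow> rat" where "r n k = of_int \<lfloor>c $ k * real (Suc n)\<rfloor> / of_nat (Suc n)" for n k
  define cs where "cs n = (\<chi> k. real_of_rat (r n k))" for n
  have cs: "(\<lambda>n. cs n $ k) \<longlonglongrightarrow> c $ k" for k
    using rational_approximation[of "c $ k"] by (simp add: cs_def r_def)
  have "(\<lambda>n. \<sigma> q (cs n) $ k) \<longlonglongrightarrow> \<sigma> q c $ k" for k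
    unfolding \<sigma>_def by simp (rule tendsto_det, simp add: cs)
  then have "(\<lambda>n. stress_vector_matrix E (\<sigma> q (cs n)) $ a $ b) \<longlonglongrightarrow> stress_vector_matrix E (\<sigma> q c) $ a $ b" for a b
    by (rule ratpoly_tendsto[OF ratpoly_stress_vector_matrix])
  then have "(\<lambda>n. completed_matrix (stress_vector_matrix E (\<sigma> q (cs n))) \<rho> $ a $ b) \<longlonglongrightarrow>
      completed_matrix (stress_vector_matrix E (\<sigma> q c)) \<rho> $ a $ b" for a b
    by (cases "\<rho> a") (simp_all add: completed_matrix_Inl completed_matrix_Inr)
  then have "(\<lambda>n. f q (cs n)) \<longlonglongrightarrow> f q c"
    unfolding f_def by (rule tendsto_det)
  moreover have "f q c \<noteq> 0" using \<rho>(1) by (simp add: f_def \<sigma>c)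
  ultimately have "eventually (\<lambda>n. f q (cs n) \<noteq> 0) sequentially"
    by (rule tendsto_imp_eventually_ne)
  then obtain n where n: "f q (cs n) \<noteq> 0"
    by (auto simp: eventually_sequentially)
  have "ratpoly coord (\<lambda>p. if j = k then cs n $ i else M p $ i $ j)" for i j k
    by (cases "j = k") (simp_all add: cs_def ratpoly.const ratM)
  then have "ratpoly coord (\<lambda>p. \<sigma> p (cs n) $ k)" for k
    unfolding \<sigma>_def by simp (rule ratpoly_det, simp)
  then have "ratpoly coord (\<lambda>p. stress_vector_matrix E (\<sigma> p (cs n)) $ a $ b)" for a b
    by (rule ratpoly_comp[OF ratpoly_stress_vector_matrix])
  then have "ratpoly coord (\<lambda>p. f p (cs n))"
    unfolding f_def by (intro ratpoly_det ratpoly_completed_matrix)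
  then have fp: "f p (cs n) \<noteq> 0"
    using p q n unfolding avoids_rational_equations_def by blast
  have "ratpoly coord (\<lambda>p. det (M p))" by (intro ratpoly_det ratM)
  then have Mp: "det (M p) \<noteq> 0"
    using p q Mq unfolding avoids_rational_equations_def by blast
  \<comment> \<open>The selected equations hold by construction; as their number reaches the rank at
    \<open>p\<close>, they imply all others.\<close>
  have "R p *v \<sigma> p (cs n) = 0"
  proof (rule selected_rows_nullspace[of _ \<tau>])
    show "det (completed_matrix (R p) \<tau>) \<noteq> 0" using Mp by (simp add: M_def)
    show "rank (R p) \<le> card (selected \<tau>)" using rank unfolding \<tau>(2) by (simp add: R_def rank_transpose)
    fix i assume "i \<in> selected \<tau>"
    then obtain k where k: "\<tau> k = Inl i" by (force simp: selected_def)
    then have "cs n $ k = 0" using c0[OF k] by (simp add: cs_def r_def)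
    then have "(M p *v \<sigma> p (cs n)) $ k = 0" by (simp add: M\<sigma>[OF Mp])
    then show "R p $ i \<bullet> \<sigma> p (cs n) = 0"
      by (simp add: matrix_vector_mul_component M_def completed_matrix_Inl[of \<tau> k i, OF k])
  qed
  then have "equilibrium_stress E p (\<lambda>e. \<sigma> p (cs n) $ Inl e) (\<lambda>v. \<sigma> p (cs n) $ Inr v)"
    by (simp add: equilibrium_stress_iff R_def)
  moreover have "rank (cyl_stress_matrix E \<omega> l) \<le> rank (stress_vector_matrix E (\<sigma> p (cs n)))"
    using selected_rows_independent(3)[OF fp[unfolded f_def]] \<rho>(2) by (simp add: s)
  ultimately show ?thesis by blast
qed

section \<open>The kernel of a stress of maximum rank\<close>

text \<open>A diagonal block of the cylinder stress matrix acting on functions of the vertices; with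
  zero load it is the third block.\<close>

definition stress_operator :: "'v::finite set set \<Rightarrow> ('v set \<Rightarrow> real) \<Rightarrow> ('v \<Rightarrow> real) \<Rightarrow> ('v \<Rightarrow> real) \<Rightarrow> 'v \<Rightarrow> real" where
  "stress_operator E \<omega> l f i = (\<Sum>j\<in>UNIV. weight E \<omega> i j * (f i - f j)) + l i * f i"

lemma stress_matrix_vector:
  assumes "simple_graph E"
  shows "(\<Sum>j\<in>UNIV. (stress_matrix E \<omega> + diag_matrix l) $ i $ j * f j) = stress_operator E \<omega> l f i"
proof -
  have "{i, i} \<notin> E" using assms unfolding simple_graph_def by force
  then have w: "weight E \<omega> i i = 0" by (simp add: weight_def)
  have "(\<Sum>j\<in>UNIV. stress_matrix E \<omega> $ i $ j * f j) =
    (\<Sum>j\<in>UNIV. (if j = i then (\<Sum>k\<in>UNIV. weight E \<omega> i k) * f i else 0) - weight E \<omega> i j * f j)"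
    by (intro sum.cong) (auto simp: stress_matrix_def w)
  also have "\<dots> = (\<Sum>k\<in>UNIV. weight E \<omega> i k) * f i - (\<Sum>j\<in>UNIV. weight E \<omega> i j * f j)"
    by (simp add: sum_subtractf)
  also have "\<dots> = (\<Sum>j\<in>UNIV. weight E \<omega> i j * (f i - f j))"
    by (simp add: sum_distrib_right right_diff_distrib sum_subtractf)
  finally have 1: "(\<Sum>j\<in>UNIV. stress_matrix E \<omega> $ i $ j * f j) = \<dots>" .
  have "(\<Sum>j\<in>UNIV. diag_matrix l $ i $ j * f j) = (\<Sum>j\<in>UNIV. if j = i then l i * f i else 0)"
    by (intro sum.cong) (auto simp: diag_matrix_def)
  then show ?thesis by (simp add: stress_operator_def 1 distrib_right sum.distrib)
qed

lemma diag_matrix_zero: "diag_matrix (\<lambda>_. 0) = 0"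
  by (simp add: diag_matrix_def vec_eq_iff)

lemma cyl_stress_matrix_nullspace:
  assumes "simple_graph E"
  shows "cyl_stress_matrix E \<omega> l *v x = 0 \<longleftrightarrow>
    (\<forall>i. stress_operator E \<omega> l (\<lambda>v. x $ Inl v) i = 0) \<and>
    (\<forall>i. stress_operator E \<omega> l (\<lambda>v. x $ Inr (Inl v)) i = 0) \<and>
    (\<forall>i. stress_operator E \<omega> (\<lambda>_. 0) (\<lambda>v. x $ Inr (Inr v)) i = 0)"
proof -
  have "(cyl_stress_matrix E \<omega> l *v x) $ Inl i = stress_operator E \<omega> l (\<lambda>v. x $ Inl v) i"
    "(cyl_stress_matrix E \<omega> l *v x) $ Inr (Inl i) = stress_operator E \<omega> l (\<lambda>v. x $ Inr (Inl v)) i"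
    "(cyl_stress_matrix E \<omega> l *v x) $ Inr (Inr i) = stress_operator E \<omega> (\<lambda>_. 0) (\<lambda>v. x $ Inr (Inr v)) i" for i
    unfolding stress_matrix_vector[OF assms, symmetric]
    by (simp_all add: matrix_vector_mult_def cyl_stress_matrix_def block_diag_def sum_UNIV_Plus diag_matrix_zero)
  then show ?thesis by (auto simp: vec_eq_iff split_sum_all)
qed

lemma equilibrium_stress_operator:
  "equilibrium_stress E p \<omega> l \<longleftrightarrow>
    (\<forall>i. stress_operator E \<omega> l (\<lambda>v. p v $ 1) i = 0) \<and>
    (\<forall>i. stress_operator E \<omega> l (\<lambda>v. p v $ 2) i = 0) \<and>
    (\<forall>i. stress_operator E \<omega> (\<lambda>_. 0) (\<lambda>v. p v $ 3) i = 0)"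
  by (auto simp: equilibrium_stress_def vec_eq_iff forall_3 stress_operator_def horizontal_def)

lemma stress_operator_linear:
  "stress_operator E \<omega> l (\<lambda>v. a * f v + b * g v) i = a * stress_operator E \<omega> l f i + b * stress_operator E \<omega> l g i"
  by (simp add: stress_operator_def algebra_simps sum.distrib sum_subtractf sum_distrib_left)

lemma stress_operator_const: "stress_operator E \<omega> (\<lambda>_. 0) (\<lambda>_. c) i = 0"
  by (simp add: stress_operator_def)

text \<open>The kernel that equilibrium enforces: combinations of the two horizontal coordinates in
  each of the first two blocks, and of 1 and the height in the third.\<close>

definition trivial_vector :: "('v::finite \<Rightarrow> real^3) \<Rightarrow> real \<times> real \<times> real \<times> real \<times> real \<times> real \<Rightarrow> real^('v + 'v + 'v)" where
  "trivial_vector p = (\<lambda>(a, b, c, d, e, f). \<chi> i. case i of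
      Inl v \<Rightarrow> a * p v $ 1 + b * p v $ 2
    | Inr (Inl v) \<Rightarrow> c * p v $ 1 + d * p v $ 2
    | Inr (Inr v) \<Rightarrow> e + f * p v $ 3)"

lemma trivial_vector_nth [simp]:
  "trivial_vector p (a, b, c, d, e, f) $ Inl v = a * p v $ 1 + b * p v $ 2"
  "trivial_vector p (a, b, c, d, e, f) $ Inr (Inl v) = c * p v $ 1 + d * p v $ 2"
  "trivial_vector p (a, b, c, d, e, f) $ Inr (Inr v) = e + f * p v $ 3"
  by (simp_all add: trivial_vector_def)

lemma linear_combination_unique:
  fixes a b :: real
  assumes "x * y' - x' * y \<noteq> 0" "a * x + b * y = 0" "a * x' + b * y' = 0"
  shows "a = 0 \<and> b = 0"
proof -
  have "a * (x * y' - x' * y) = (a * x + b * y) * y' - (a * x' + b * y') * y" by algebra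
  moreover have "b * (x * y' - x' * y) = (a * x' + b * y') * x - (a * x + b * y) * x'" by algebra
  ultimately have "a * (x * y' - x' * y) = 0" "b * (x * y' - x' * y) = 0"
    unfolding assms(2,3) by simp_all
  then show ?thesis using assms(1) by simp
qed

lemma dim_trivial_vectors:
  assumes "p u $ 1 * p v $ 2 - p v $ 1 * p u $ 2 \<noteq> 0" "p u $ 3 \<noteq> p v $ 3"
  shows "dim (range (trivial_vector p)) = 6"
proof -
  have lin: "linear (trivial_vector p)"
    by (rule linearI) (auto simp: trivial_vector_def vec_eq_iff algebra_simps split: sum.split)
  have "inj (trivial_vector p)"
  proof (subst linear_injective_0[OF lin], intro allI impI)
    fix t assume *: "trivial_vector p t = 0"
    obtain a b c d e f where t: "t = (a, b, c, d, e, f)" by (metis prod_cases6)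
    have z: "a * p w $ 1 + b * p w $ 2 = 0" "c * p w $ 1 + d * p w $ 2 = 0" "e + f * p w $ 3 = 0" for w
      using arg_cong[OF *, of "\<lambda>x. x $ Inl w"] arg_cong[OF *, of "\<lambda>x. x $ Inr (Inl w)"]
        arg_cong[OF *, of "\<lambda>x. x $ Inr (Inr w)"] by (simp_all add: t)
    have "a = 0 \<and> b = 0" "c = 0 \<and> d = 0"
      using linear_combination_unique[OF assms(1) z(1)[of u] z(1)[of v]]
        linear_combination_unique[OF assms(1) z(2)[of u] z(2)[of v]] by blast+
    moreover have "f * (p u $ 3 - p v $ 3) = 0" 
      using z(3)[of u] z(3)[of v] unfolding right_diff_distrib by linarith
    then have "f = 0" using assms(2) by simp
    ultimately show "t = 0" using z(3)[of u] by (simp add: t zero_prod_def)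
  qed
  then have "dim (trivial_vector p ` UNIV) = dim (UNIV :: (real \<times> real \<times> real \<times> real \<times> real \<times> real) set)"
    using lin by (intro dim_image_eq) auto
  then show ?thesis by simp
qed

text \<open>The trivial vectors lie in the kernel and span dimension 6; \<open>u\<close> and
  \<open>v\<close> witness their independence. By rank-nullity the rank is maximal exactly if they
  fill the kernel, which can be tested block by block, and the first two blocks agree.\<close>

lemma
  fixes p :: "'v::finite \<Rightarrow> real^3"
  assumes E: "simple_graph E" and stress: "equilibrium_stress E p \<omega> l"
    and nd: "p u $ 1 * p v $ 2 - p v $ 1 * p u $ 2 \<noteq> 0" "p u $ 3 \<noteq> p v $ 3"
  shows max_rank_upper_bound: "int (rank (cyl_stress_matrix E \<omega> l)) \<le> 3 * int CARD('v) - 6"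
    and max_rank_iff: "int (rank (cyl_stress_matrix E \<omega> l)) = 3 * int CARD('v) - 6 \<longleftrightarrow>
      (\<forall>f. (\<forall>i. stress_operator E \<omega> l f i = 0) \<longrightarrow> (\<exists>a b. \<forall>w. f w = a * p w $ 1 + b * p w $ 2)) \<and>
      (\<forall>f. (\<forall>i. stress_operator E \<omega> (\<lambda>_. 0) f i = 0) \<longrightarrow> (\<exists>a b. \<forall>w. f w = a + b * p w $ 3))"
    (is "_ \<longleftrightarrow> ?ker")
proof -
  let ?A = "cyl_stress_matrix E \<omega> l"
  let ?N = "{x. ?A *v x = 0}"
  let ?T = "range (trivial_vector p)"
  have T: "dim ?T = 6" using nd by (rule dim_trivial_vectors)
  have TN: "?T \<subseteq> ?N"
  proof
    fix x assume "x \<in> ?T"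
    then obtain a b c d e f where x: "x = trivial_vector p (a, b, c, d, e, f)" by auto
    show "x \<in> ?N"
      using stress stress_operator_linear[of E \<omega> "\<lambda>_. 0" e "\<lambda>_. 1" f "\<lambda>v. p v $ 3"]
      by (simp add: cyl_stress_matrix_nullspace[OF E] x equilibrium_stress_operator
          stress_operator_linear stress_operator_const)
  qed
  have dimN: "dim ?N + rank ?A = 3 * CARD('v)" using dim_nullspace[of ?A] by simp
  have "6 \<le> dim ?N" using dim_subset[OF TN] T by simp
  with dimN show "int (rank ?A) \<le> 3 * int CARD('v) - 6" by linarith
  have "int (rank ?A) = 3 * int CARD('v) - 6 \<longleftrightarrow> dim ?N = 6" using dimN by linarith
  also have "\<dots> \<longleftrightarrow> ?N \<subseteq> ?T"
  proof
    assume "dim ?N = 6"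
    moreover have "subspace ?T"
      by (intro linear_subspace_image[of "trivial_vector p" UNIV] subspace_UNIV linearI)
        (auto simp: trivial_vector_def vec_eq_iff algebra_simps split: sum.split)
    ultimately show "?N \<subseteq> ?T"
      using subspace_dim_equal[of ?T ?N] TN T subspace_nullspace[of ?A] by simp
  next
    assume "?N \<subseteq> ?T"
    with TN have "?N = ?T" by blast
    with T show "dim ?N = 6" by simp
  qed
  also have "\<dots> \<longleftrightarrow> ?ker"
  proof
    assume NT: "?N \<subseteq> ?T"
    show ?ker
    proof (intro conjI allI impI)
      fix f assume f: "\<forall>i. stress_operator E \<omega> l f i = 0"
      let ?x = "(\<chi> i. case i of Inl v \<Rightarrow> f v | Inr _ \<Rightarrow> 0) :: real^('v + 'v + 'v)"
      have "stress_operator E \<omega> l (\<lambda>v. 0) i = 0" for i by (simp add: stress_operator_def)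
      then have "?x \<in> ?N" using f by (simp add: cyl_stress_matrix_nullspace[OF E] stress_operator_const)
      with NT obtain a b c d e h where "?x = trivial_vector p (a, b, c, d, e, h)" by auto
      then have "f w = a * p w $ 1 + b * p w $ 2" for w
        by (drule_tac arg_cong[where f = "\<lambda>x. x $ Inl w"]) simp
      then show "\<exists>a b. \<forall>w. f w = a * p w $ 1 + b * p w $ 2" by blast
    next
      fix f assume f: "\<forall>i. stress_operator E \<omega> (\<lambda>_. 0) f i = 0"
      let ?x = "(\<chi> i. case i of Inl v \<Rightarrow> 0 | Inr j \<Rightarrow> (case j of Inl v \<Rightarrow> 0 | Inr v \<Rightarrow> f v)) :: real^('v + 'v + 'v)"
      have "stress_operator E \<omega> l (\<lambda>v. 0) i = 0" for i by (simp add: stress_operator_def)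
      then have "?x \<in> ?N" using f by (simp add: cyl_stress_matrix_nullspace[OF E])
      with NT obtain a b c d e h where "?x = trivial_vector p (a, b, c, d, e, h)" by auto
      then have "f w = e + h * p w $ 3" for w
        by (drule_tac arg_cong[where f = "\<lambda>x. x $ Inr (Inr w)"]) simp
      then show "\<exists>a b. \<forall>w. f w = a + b * p w $ 3" by blast
    qed
  next
    assume ker: ?ker
    show "?N \<subseteq> ?T"
    proof
      fix x assume "x \<in> ?N"
      then have "\<exists>a b. \<forall>w. x $ Inl w = a * p w $ 1 + b * p w $ 2"
        "\<exists>a b. \<forall>w. x $ Inr (Inl w) = a * p w $ 1 + b * p w $ 2"
        "\<exists>a b. \<forall>w. x $ Inr (Inr w) = a + b * p w $ 3"
        using ker by (simp_all add: cyl_stress_matrix_nullspace[OF E])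
      then obtain a b c d e f where
        "\<And>w. x $ Inl w = a * p w $ 1 + b * p w $ 2"
        "\<And>w. x $ Inr (Inl w) = c * p w $ 1 + d * p w $ 2"
        "\<And>w. x $ Inr (Inr w) = e + f * p w $ 3" by blast
      then have "x = trivial_vector p (a, b, c, d, e, f)" by (simp add: vec_eq_iff split_sum_all)
      then show "x \<in> ?T" by blast
    qed
  qed
  finally show "int (rank ?A) = 3 * int CARD('v) - 6 \<longleftrightarrow> ?ker" .
qed

section \<open>Rigid generic frameworks are infinitesimally rigid\<close>

lemma velocity_nth: "velocity m v $ k = m $ (v, k)"
  by (simp add: velocity_def)

lemma velocity_add: "velocity (m + m') v = velocity m v + velocity m' v"
  and velocity_diff: "velocity (m - m') v = velocity m v - velocity m' v"
  and velocity_scaleR: "velocity (c *\<^sub>R m) v = c *\<^sub>R velocity m v"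
  by (simp_all add: vec_eq_iff velocity_nth)

lemma norm_velocity_le: "norm (velocity m v) \<le> norm m"
proof -
  have "velocity m v \<bullet> velocity m v = (\<Sum>k\<in>UNIV. m $ (v, k) * m $ (v, k))"
    by (simp add: inner_vec_def velocity_nth)
  also have "\<dots> \<le> (\<Sum>w\<in>UNIV. \<Sum>k\<in>UNIV. m $ (w, k) * m $ (w, k))"
    by (rule member_le_sum) (auto intro: sum_nonneg)
  also have "\<dots> = m \<bullet> m" by (simp add: inner_vec_def sum_UNIV_Times)
  finally show ?thesis by (simp add: norm_le)
qed

lemma bounded_linear_velocity: "bounded_linear (\<lambda>m. velocity m v)"
  by (rule bounded_linear_intro[of _ 1]) (simp_all add: velocity_add velocity_scaleR norm_velocity_le)

lemmas has_derivative_velocity = bounded_linear.has_derivative[OF bounded_linear_velocity]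

lemma velocity_vertex_row: "velocity (rigidity_matrix E p $ Inr w) v = (if v = w then horizontal (p v) else 0)"
  by (auto simp: vec_eq_iff velocity_nth rigidity_matrix_def)

text \<open>The vertex rows are orthonormal: they have disjoint supports, and the horizontal part of
  a point on the cylinder is a unit vector.\<close>

lemma vertex_rows_independent:
  assumes "on_cylinder p"
  shows "independent ((($) (rigidity_matrix E p)) ` range Inr)" "inj_on (($) (rigidity_matrix E p)) (range Inr)"
proof -
  let ?r = "\<lambda>v. rigidity_matrix E p $ Inr v"
  have o: "?r v \<bullet> ?r w = (if v = w then 1 else 0)" for v w
  proof -
    have "horizontal (p v) \<bullet> horizontal (p v) = 1"
      using assms by (simp add: inner_vec_def sum_3 horizontal_def on_cylinder_iff power2_eq_square)
    then show ?thesis unfolding inner_vertex_row velocity_vertex_row by (cases "v = w") simp_all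
  qed
  have eq: "v = w" if "?r v = ?r w" for v w
    using o[of v w] o[of v v] that by (auto split: if_splits)
  have "?r v \<noteq> 0" for v using o[of v v] by auto
  then have "0 \<notin> (($) (rigidity_matrix E p)) ` range Inr" by (metis (no_types, lifting) imageE)
  moreover have "pairwise orthogonal ((($) (rigidity_matrix E p)) ` range Inr)"
    using o eq by (auto simp: pairwise_def orthogonal_def)
  ultimately show "independent ((($) (rigidity_matrix E p)) ` range Inr)"
    by (rule pairwise_orthogonal_independent[rotated])
  show "inj_on (($) (rigidity_matrix E p)) (range Inr)"
    using eq by (auto intro!: inj_onI)
qed

text \<open>Every row is the gradient of a constraint: half the squared length of an edge, half the
  squared distance of a vertex from the axis, or a constant for a zero row.\<close>

lemma constraint_function_exists:
  "\<exists>G. (\<forall>x. (G has_derivative (\<lambda>m. rigidity_matrix E (velocity x) $ r \<bullet> m)) (at x)) \<and>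
    (\<forall>a b. r = Inl {a, b} \<and> {a, b} \<in> E \<longrightarrow> (\<forall>x. G x = (dist (velocity x a) (velocity x b))\<^sup>2 / 2)) \<and>
    (\<forall>v. r = Inr v \<longrightarrow> (\<forall>x. G x = ((velocity x v $ 1)\<^sup>2 + (velocity x v $ 2)\<^sup>2) / 2))"
proof (cases r)
  case (Inr v)
  have "((\<lambda>x. ((velocity x v $ 1)\<^sup>2 + (velocity x v $ 2)\<^sup>2) / 2) has_derivative
      (\<lambda>m. rigidity_matrix E (velocity x) $ Inr v \<bullet> m)) (at x)" for x
    unfolding inner_vertex_row velocity_nth
    by (auto intro!: derivative_eq_intros bounded_linear_imp_has_derivative[OF bounded_linear_vec_nth]
        simp: inner_vec_def sum_3 horizontal_def velocity_nth)
  then show ?thesis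
    using Inr by (intro exI[of _ "\<lambda>x. ((velocity x v $ 1)\<^sup>2 + (velocity x v $ 2)\<^sup>2) / 2"]) auto
next
  case (Inl e)
  show ?thesis
  proof (cases "\<exists>a b. e = {a, b} \<and> e \<in> E")
    case True
    then obtain a b where e: "e = {a, b}" "{a, b} \<in> E" by blast
    have "((\<lambda>x. (dist (velocity x a) (velocity x b))\<^sup>2 / 2) has_derivative
        (\<lambda>m. rigidity_matrix E (velocity x) $ Inl {a, b} \<bullet> m)) (at x)" for x
      unfolding inner_edge_row[OF e(2)] dist_norm power2_norm_eq_inner
      by (rule has_derivative_eq_rhs, (rule derivative_intros has_derivative_velocity)+)
        (auto simp: inner_commute inner_diff_left inner_diff_right)
    then show ?thesis using e Inl by (intro exI[of _ "\<lambda>x. (dist (velocity x a) (velocity x b))\<^sup>2 / 2"])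
      (auto simp: doubleton_eq_iff dist_commute)
  next
    case False
    then have "rigidity_matrix E p $ Inl e = 0" for p by (auto intro: edge_row_eq_zero)
    then show ?thesis using Inl False by (intro exI[of _ "\<lambda>_. 0"]) auto
  qed
qed

lemma vertex_row_cong: "rigidity_matrix E' p $ Inr v = rigidity_matrix E p $ Inr v"
  by (simp add: vec_eq_iff rigidity_matrix_def)

lemma edge_row_cong:
  assumes "e \<in> E \<longleftrightarrow> e \<in> E'"
  shows "rigidity_matrix E p $ Inl e = rigidity_matrix E' p $ Inl e"
proof -
  have "({i, j} \<in> E \<and> {i, j} = e) = ({i, j} \<in> E' \<and> {i, j} = e)" for i j
    using assms by blast
  then show ?thesis by (simp add: vec_eq_iff rigidity_matrix_def cong: if_cong)
qed

text \<open>If some edge row \<open>e\<close> were independent of the rows of \<open>E\<close>, then a maximal independent set of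
  constraints, the length of \<open>e\<close> and some coordinates form a local chart. Moving along the axis of
  the length of \<open>e\<close> keeps the selected constraints; the remaining ones are preserved as well because
  the rank is maximal at a generic point.\<close>

lemma rigid_imp_rank_complete:
  fixes E :: "'v::finite set set"
  assumes q: "avoids_rational_equations q" and rigid: "rigid_framework E q"
  shows "rank (rigidity_matrix UNIV q) \<le> rank (rigidity_matrix E q)"
proof (rule ccontr)
  assume less: "\<not> ?thesis"
  have cyl: "on_cylinder q" using q by (simp add: avoids_rational_equations_def)
  have "\<not> rows (rigidity_matrix UNIV q) \<subseteq> span (rows (rigidity_matrix E q))"
    using less dim_mono[of "rows (rigidity_matrix UNIV q)" "rows (rigidity_matrix E q)"]
    by (auto simp: row_rank_def)
  then obtain r where r: "rigidity_matrix UNIV q $ r \<notin> span (rows (rigidity_matrix E q))"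
    by (auto simp: rows_eq_range)
  have rowE: "rigidity_matrix E q $ r' \<in> span (rows (rigidity_matrix E q))" for r'
    by (rule span_base) (simp add: rows_eq_range)
  obtain e where e: "r = Inl e"
    using r rowE[of r] by (cases r) (auto simp: vertex_row_cong[of UNIV q _ E])
  have eE: "e \<notin> E"
    using r rowE[of r] edge_row_cong[of e UNIV E q] by (auto simp: e)
  obtain a b where ab: "e = {a, b}"
    using edge_row_eq_zero[of e UNIV q] r span_zero[of "rows (rigidity_matrix E q)"] unfolding e by metis
  define E' where "E' = insert e E"
  have R_e: "rigidity_matrix E' q $ Inl e \<notin> span (rows (rigidity_matrix E q))"
    using r edge_row_cong[of e UNIV E' q] by (simp add: e E'_def)
  have R_other: "rigidity_matrix E' p $ r' = rigidity_matrix E p $ r'" if "r' \<noteq> Inl e" for r' p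
  proof (cases r')
    case (Inl f)
    then have "f \<in> E' \<longleftrightarrow> f \<in> E" using that by (simp add: E'_def)
    then show ?thesis unfolding Inl by (rule edge_row_cong)
  next
    case (Inr v)
    then show ?thesis by (simp only: vertex_row_cong[of E' p v E])
  qed
  have rank_less: "rank (rigidity_matrix E q) + 1 \<le> rank (rigidity_matrix E' q)"
  proof -
    have "insert (rigidity_matrix E' q $ Inl e) (rows (rigidity_matrix E q)) \<subseteq> span (rows (rigidity_matrix E' q))"
    proof (intro insert_subsetI subsetI)
      show "rigidity_matrix E' q $ Inl e \<in> span (rows (rigidity_matrix E' q))"
        by (rule span_base) (simp add: rows_eq_range)
      fix x assume "x \<in> rows (rigidity_matrix E q)"
      then obtain r' where x: "x = rigidity_matrix E q $ r'" by (auto simp: rows_eq_range)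
      show "x \<in> span (rows (rigidity_matrix E' q))"
      proof (cases "r' = Inl e")
        case True
        then show ?thesis using eE by (simp add: x edge_row_eq_zero span_zero)
      next
        case False
        then show ?thesis unfolding x R_other[OF False, symmetric]
          by (intro span_base) (simp add: rows_eq_range)
      qed
    qed
    then have "dim (insert (rigidity_matrix E' q $ Inl e) (rows (rigidity_matrix E q))) \<le> dim (rows (rigidity_matrix E' q))"
      by (rule dim_mono)
    then show ?thesis using R_e by (simp add: dim_insert row_rank_def)
  qed
  \<comment> \<open>All vertex rows are selected, so that the curve below stays on the cylinder,
    where ranks are bounded by the rank at \<open>q\<close>.\<close>
  obtain \<tau> where \<tau>: "det (completed_matrix (rigidity_matrix E' q) \<tau>) \<noteq> 0"
    "range Inr \<subseteq> selected \<tau>" "card (selected \<tau>) = rank (rigidity_matrix E' q)"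
    using completed_matrix_exists[OF vertex_rows_independent[OF cyl, of E']] by blast
  have "Inl e \<in> selected \<tau>"
  proof (rule ccontr)
    assume no: "Inl e \<notin> selected \<tau>"
    have "rigidity_matrix E' q $ Inl e \<in> span ((($) (rigidity_matrix E' q)) ` selected \<tau>)"
      using \<tau> by (intro selected_rows_span) simp_all
    also have "\<dots> \<subseteq> span (rows (rigidity_matrix E q))"
    proof (rule span_mono, rule image_subsetI)
      fix r' assume "r' \<in> selected \<tau>"
      then have "r' \<noteq> Inl e" using no by blast
      then show "rigidity_matrix E' q $ r' \<in> rows (rigidity_matrix E q)"
        by (simp add: R_other rows_eq_range)
    qed
    finally show False using R_e by blast
  qed
  then obtain k0 where k0: "\<tau> k0 = Inl (Inl e)" by (force simp: selected_def)
  obtain G where G: "\<And>r x. (G r has_derivative (\<lambda>m. rigidity_matrix E' (velocity x) $ r \<bullet> m)) (at x)"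
    "\<And>u v x. {u, v} \<in> E' \<Longrightarrow> G (Inl {u, v}) x = (dist (velocity x u) (velocity x v))\<^sup>2 / 2"
    "\<And>v x. G (Inr v) x = ((velocity x v $ 1)\<^sup>2 + (velocity x v $ 2)\<^sup>2) / 2"
  proof -
    have "\<forall>r. \<exists>g. (\<forall>x. (g has_derivative (\<lambda>m. rigidity_matrix E' (velocity x) $ r \<bullet> m)) (at x)) \<and>
      (\<forall>a b. r = Inl {a, b} \<and> {a, b} \<in> E' \<longrightarrow> (\<forall>x. g x = (dist (velocity x a) (velocity x b))\<^sup>2 / 2)) \<and>
      (\<forall>v. r = Inr v \<longrightarrow> (\<forall>x. g x = ((velocity x v $ 1)\<^sup>2 + (velocity x v $ 2)\<^sup>2) / 2))"
      by (intro allI constraint_function_exists)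
    from choice[OF this] obtain g where g: "\<forall>r. (\<forall>x. (g r has_derivative (\<lambda>m. rigidity_matrix E' (velocity x) $ r \<bullet> m)) (at x)) \<and>
      (\<forall>a b. r = Inl {a, b} \<and> {a, b} \<in> E' \<longrightarrow> (\<forall>x. g r x = (dist (velocity x a) (velocity x b))\<^sup>2 / 2)) \<and>
      (\<forall>v. r = Inr v \<longrightarrow> (\<forall>x. g r x = ((velocity x v $ 1)\<^sup>2 + (velocity x v $ 2)\<^sup>2) / 2))" ..
    show thesis by (rule that[of g]) (simp_all add: g)
  qed
  define M where "M x = completed_matrix (rigidity_matrix E' (velocity x)) \<tau>" for x
  \<comment> \<open>The chart: its derivative is the completed matrix \<open>M\<close>, which is
    invertible at the given position.\<close>
  define \<Phi> where "\<Phi> x = (\<chi> k. case \<tau> k of Inl r \<Rightarrow> G r x | Inr c \<Rightarrow> x $ c)" for x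
  have \<Phi>': "(\<Phi> has_derivative (\<lambda>m. M x *v m)) (at x)" for x
  proof (subst has_derivative_componentwise_within, rule ballI)
    fix i :: "real^('v \<times> 3)" assume "i \<in> Basis"
    then obtain k where i: "i = axis k 1" by (auto simp: Basis_vec_def)
    show "((\<lambda>x. \<Phi> x \<bullet> i) has_derivative (\<lambda>m. (M x *v m) \<bullet> i)) (at x)"
    proof (cases "\<tau> k")
      case (Inl r)
      then show ?thesis using G(1)[of r x]
        by (simp add: i inner_axis \<Phi>_def M_def matrix_vector_mul_component completed_matrix_Inl)
    next
      case (Inr c)
      have "((\<lambda>x. x $ c) has_derivative (\<lambda>m. m $ c)) (at x)"
        by (rule bounded_linear_imp_has_derivative[OF bounded_linear_vec_nth])
      then show ?thesis using Inr
        by (simp add: i inner_axis inner_axis' \<Phi>_def M_def matrix_vector_mul_component completed_matrix_Inr)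
    qed
  qed
  define D where "D x = Blinfun (\<lambda>m. M x *v m)" for x
  have D: "blinfun_apply (D x) = (\<lambda>m. M x *v m)" for x
    unfolding D_def by (rule bounded_linear_Blinfun_apply) simp
  have contD: "continuous_on UNIV D"
  proof (rule continuous_on_blinfun_componentwise)
    fix i :: "real^('v \<times> 3)"
    have c: "continuous_on UNIV (\<lambda>x. rigidity_matrix E' (velocity x) $ r $ c)" for r c
      by (rule ratpoly_continuous[OF ratpoly_rigidity_matrix])
        (simp add: coord_def velocity_nth continuous_on_component continuous_on_id)
    have "continuous_on UNIV (\<lambda>x. M x $ k $ c)" for k c
      using c by (cases "\<tau> k") (simp_all add: M_def completed_matrix_Inl completed_matrix_Inr)
    then show "continuous_on UNIV (\<lambda>x. blinfun_apply (D x) i)"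
      unfolding D matrix_vector_mult_def 
      by (intro continuous_on_vec_lambda continuous_on_sum continuous_on_mult continuous_on_const)
  qed
  define x0 :: "real^('v \<times> 3)" where "x0 = (\<chi> c. q (fst c) $ snd c)"
  have x0: "velocity x0 = q" by (simp add: x0_def fun_eq_iff vec_eq_iff velocity_nth)
  have "invertible (M x0)" using \<tau>(1) by (simp add: invertible_det_nz M_def x0)
  then obtain B where B: "B ** M x0 = mat 1" by (auto simp: invertible_def)
  have inv: "Blinfun (\<lambda>m. B *v m) o\<^sub>L D x0 = id_blinfun"
    by (rule blinfun_eqI) (simp add: D bounded_linear_Blinfun_apply matrix_vector_mul_assoc B)
  have der: "(\<Phi> has_derivative blinfun_apply (D x)) (at x)" if "x \<in> UNIV" for x
    unfolding D by (rule \<Phi>')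
  note ift = inverse_function_theorem[OF open_UNIV der contD UNIV_I inv]
  have "\<exists>U V g g'. open U \<and> x0 \<in> U \<and> open V \<and> \<Phi> x0 \<in> V \<and> homeomorphism U V \<Phi> g \<and>
    (\<forall>y\<in>V. (g has_derivative g' y) (at y)) \<and> (\<forall>y\<in>V. g' y = Hilbert_Choice.inv (blinfun_apply (D (g y)))) \<and>
    (\<forall>y\<in>V. bij (blinfun_apply (D (g y))))"
  proof (rule ift, assumption)
    fix U V g g'
    assume "open U" "x0 \<in> U" "open V" "\<Phi> x0 \<in> V" "homeomorphism U V \<Phi> g"
      "\<And>y. y \<in> V \<Longrightarrow> (g has_derivative g' y) (at y)"
      "\<And>y. y \<in> V \<Longrightarrow> g' y = Hilbert_Choice.inv (blinfun_apply (D (g y)))"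
      "\<And>y. y \<in> V \<Longrightarrow> bij (blinfun_apply (D (g y)))"
    then show ?thesis
      by (intro exI[of _ U] exI[of _ V] exI[of _ g] exI[of _ g'] conjI ballI)
  qed
  then obtain U V g g' where IFT: "open U" "x0 \<in> U" "open V" "\<Phi> x0 \<in> V" "homeomorphism U V \<Phi> g"
    "\<forall>y\<in>V. (g has_derivative g' y) (at y)"
    "\<forall>y\<in>V. g' y = Hilbert_Choice.inv (blinfun_apply (D (g y)))"
    "\<forall>y\<in>V. bij (blinfun_apply (D (g y)))"
    by (elim exE conjE)
  obtain \<epsilon> where \<epsilon>: "\<epsilon> > 0" "\<And>P. cylinder_motion E q P \<Longrightarrow>
      (\<And>t v. t \<in> {0..1} \<Longrightarrow> dist (P t v) (q v) < \<epsilon>) \<Longrightarrow> congruent_frameworks q (P 1)"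
    using rigid unfolding rigid_framework_def by fastforce
  have gx0: "g (\<Phi> x0) = x0" using IFT(2,5) by (simp add: homeomorphism_def)
  have "continuous (at (\<Phi> x0)) g" using IFT(4,6) has_derivative_continuous by blast
  then obtain d1 where d1: "d1 > 0" "\<And>y. dist y (\<Phi> x0) < d1 \<Longrightarrow> dist (g y) x0 < \<epsilon>"
    using \<epsilon>(1) unfolding continuous_at_eps_delta gx0 by blast
  obtain d2 where d2: "d2 > 0" "ball (\<Phi> x0) d2 \<subseteq> V" using IFT(3,4) by (auto simp: open_contains_ball)
  define \<delta> where "\<delta> = min d1 d2 / 2"
  have \<delta>: "\<delta> > 0" "\<delta> < d1" "\<delta> < d2" using d1(1) d2(1) by (auto simp: \<delta>_def)
  define y where "y t = \<Phi> x0 + (t * \<delta>) *\<^sub>R axis k0 1" for t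
  have dist_y: "dist (y t) (\<Phi> x0) \<le> \<delta>" if "t \<in> {0..1}" for t
    using that \<delta>(1) by (simp add: y_def dist_norm mult_left_le_one_le)
  have yV: "y t \<in> V" if "t \<in> {0..1}" for t
    using dist_y[OF that] \<delta>(3) d2(2) by (auto simp: dist_commute subset_iff)
  have \<Phi>g: "\<Phi> (g (y t)) = y t" if "t \<in> {0..1}" for t
    using yV[OF that] IFT(5) by (simp add: homeomorphism_def)
  have y': "(y has_derivative (\<lambda>h. (h * \<delta>) *\<^sub>R axis k0 1)) (at t within S)" for t S
    unfolding y_def by (auto intro!: derivative_eq_intros)
  define c where "c t = g (y t)" for t
  define c' where "c' t = g' (y t) (\<delta> *\<^sub>R axis k0 1)" for t
  have c': "(c has_derivative (\<lambda>h. h *\<^sub>R c' t)) (at t within {0..1})" if "t \<in> {0..1}" for t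
  proof -
    have gd: "(g has_derivative g' (y t)) (at (y t))" by (rule IFT(6)[THEN bspec, OF yV[OF that]])
    have "(c has_derivative (\<lambda>h. g' (y t) ((h * \<delta>) *\<^sub>R axis k0 1))) (at t within {0..1})"
      unfolding c_def by (rule has_derivative_compose[OF y' gd])
    moreover have "g' (y t) ((h * \<delta>) *\<^sub>R axis k0 1) = h *\<^sub>R c' t" for h
      unfolding c'_def using linear_scale[OF has_derivative_linear[OF gd], of h "\<delta> *\<^sub>R axis k0 1"] by simp
    ultimately show ?thesis by simp
  qed
  have Mc': "M (c t) *v c' t = \<delta> *\<^sub>R axis k0 1" if "t \<in> {0..1}" for t
    using IFT(7,8)[THEN bspec, OF yV[OF that]] unfolding D c_def c'_def by (simp add: bij_is_surj surj_f_inv_f)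
  have Gc: "G r (c t) = G r x0 + (if r = Inl e then t * \<delta> else 0)" if r: "r \<in> selected \<tau>" and t: "t \<in> {0..1}" for r t
  proof -
    obtain k where k: "\<tau> k = Inl r" using r by (force simp: selected_def)
    have "k = k0 \<longleftrightarrow> r = Inl e"
    proof
      assume "r = Inl e"
      show "k = k0"
      proof (rule ccontr)
        assume ne: "k \<noteq> k0"
        have "row k (M x0) = row k0 (M x0)"
          using k k0 \<open>r = Inl e\<close> by (simp add: row_def M_def completed_matrix_Inl)
        then show False using det_identical_rows[OF ne, of "M x0"] \<tau>(1) by (simp add: M_def x0)
      qed
    qed (use k k0 in simp)
    moreover have "\<Phi> (c t) $ k = y t $ k" using \<Phi>g[OF t] by (simp add: c_def)
    ultimately show ?thesis using k by (auto simp: \<Phi>_def y_def axis_def)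
  qed
  have cyl_c: "on_cylinder (velocity (c t))" if "t \<in> {0..1}" for t
  proof -
    have "(velocity (c t) v $ 1)\<^sup>2 + (velocity (c t) v $ 2)\<^sup>2 = (q v $ 1)\<^sup>2 + (q v $ 2)\<^sup>2" for v
    proof -
      have "G (Inr v) (c t) = G (Inr v) x0" using Gc[OF _ that, of "Inr v"] \<tau>(2) by auto
      then show ?thesis unfolding G(3) x0 by (subst (asm) divide_cancel_right) simp
    qed
    then show ?thesis using cyl by (simp add: on_cylinder_iff)
  qed
  \<comment> \<open>Along the curve the rank of \<open>E\<close> never exceeds its value at
    \<open>q\<close>, while the selected rows other than \<open>e\<close> stay independent and
    already reach that value. They span all rows of \<open>E\<close>, and the velocity is orthogonal
    to them, so the constraints that were not selected are stationary too.\<close>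
  have const: "G r (c t) = G r x0" if r: "r \<noteq> Inl e" and t: "t \<in> {0..1}" for r t
  proof -
    have "((\<lambda>t. G r (c t)) has_derivative (\<lambda>h. 0)) (at t within {0..1})" if t: "t \<in> {0..1}" for t
    proof -
      let ?A = "rigidity_matrix E (velocity (c t))" and ?A' = "rigidity_matrix E' (velocity (c t))"
      let ?S = "selected \<tau> - {Inl e}"
      have "surj ((*v) (M (c t)))" using IFT(8)[THEN bspec, OF yV[OF t]] unfolding D c_def by (rule bij_is_surj)
      then have det: "det (completed_matrix ?A' \<tau>) \<noteq> 0"
        unfolding M_def by (metis full_rank_surjective det_eq_0_rank less_irrefl)
      note ind = selected_rows_independent[OF det]
      have img: "(($) ?A') ` ?S = (($) ?A) ` ?S" by (rule image_cong) (auto simp: R_other)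
      have "rank ?A \<le> rank (rigidity_matrix E q)"
        by (rule rank_generic_maximal[OF q cyl_c[OF t] ratpoly_rigidity_matrix])
      also have "\<dots> \<le> card ?S" using rank_less \<tau>(3) \<open>Inl e \<in> selected \<tau>\<close> by simp
      also have "\<dots> = card ((($) ?A) ` ?S)"
        unfolding img[symmetric] by (rule card_image[symmetric]) (rule inj_on_subset[OF ind(2)], blast)
      finally have "dim (rows ?A) \<le> card ((($) ?A) ` ?S)" by (simp add: row_rank_def)
      moreover have "independent ((($) ?A) ` ?S)"
        unfolding img[symmetric] by (rule independent_mono[OF ind(1)]) blast
      ultimately have "rows ?A \<subseteq> span ((($) ?A) ` ?S)"
        by (intro card_ge_dim_independent) (auto simp: rows_eq_range)
      then have "?A $ r \<in> span ((($) ?A) ` ?S)" by (auto simp: rows_eq_range)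
      moreover have "orthogonal (c' t) z" if "z \<in> (($) ?A) ` ?S" for z
      proof -
        from that obtain r' where r': "r' \<in> selected \<tau>" "r' \<noteq> Inl e" "z = ?A' $ r'" by (auto simp: R_other)
        then obtain k where k: "\<tau> k = Inl r'" by (force simp: selected_def)
        then have "k \<noteq> k0" using k0 r'(2) by auto
        then have "(M (c t) *v c' t) $ k = 0" by (simp add: Mc'[OF t] axis_def)
        then show ?thesis
          by (simp add: matrix_vector_mul_component M_def completed_matrix_Inl[of \<tau> k r', OF k] r'(3) orthogonal_def inner_commute)
      qed
      ultimately have "orthogonal (c' t) (?A $ r)" by (rule orthogonal_to_span)
      then have "?A' $ r \<bullet> c' t = 0" using r by (simp add: R_other orthogonal_def inner_commute)
      then show ?thesis using has_derivative_compose[OF c'[OF t] G(1)[of r "c t"]] by simp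
    qed
    then have "G r (c t) = G r (c 0)"
      using t by (intro has_derivative_zero_unique[of "{0..1}" "\<lambda>t. G r (c t)"]) auto
    then show ?thesis by (simp add: c_def y_def gx0)
  qed
  have dist_const: "dist (velocity (c t) u) (velocity (c t) v) = dist (q u) (q v)"
    if "{u, v} \<in> E" "t \<in> {0..1}" for u v t
  proof -
    have "G (Inl {u, v}) (c t) = G (Inl {u, v}) x0" using that eE by (intro const) auto
    then show ?thesis using that(1) by (simp add: G(2) E'_def x0)
  qed
  have "continuous_on {0..1} c"
    by (rule has_derivative_continuous_on) (rule c')
  then have "continuous_on {0..1} (\<lambda>t. velocity (c t) v)" for v
    using bounded_linear.continuous_on[OF bounded_linear_velocity] by blast
  then have "cylinder_motion E q (\<lambda>t. velocity (c t))"
    unfolding cylinder_motion_def equivalent_frameworks_def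
    using cyl_c dist_const by (simp add: c_def y_def gx0 x0)
  moreover have "dist (velocity (c t) v) (q v) < \<epsilon>" if "t \<in> {0..1}" for t v
  proof -
    have "dist (velocity (c t) v) (q v) = norm (velocity (c t - x0) v)"
      by (simp add: dist_norm velocity_diff x0)
    also have "\<dots> \<le> dist (c t) x0" by (simp add: norm_velocity_le dist_norm)
    also have "\<dots> < \<epsilon>" unfolding c_def using dist_y[OF that] \<delta>(2) by (intro d1(2)) simp
    finally show ?thesis .
  qed
  \<comment> \<open>Rigidity preserves the length of \<open>e\<close>, although the curve has raised
    half its square by \<open>\<delta>\<close>.\<close>
  ultimately have "congruent_frameworks q (velocity (c 1))" by (rule \<epsilon>(2))
  then have "dist (q a) (q b) = dist (velocity (c 1) a) (velocity (c 1) b)"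
    by (simp add: congruent_frameworks_def)
  moreover have "{a, b} \<in> E'" by (simp add: E'_def ab)
  ultimately have "G (Inl e) (c 1) = G (Inl e) x0" unfolding ab by (simp only: G(2) x0)
  moreover have "G (Inl e) (c 1) = G (Inl e) x0 + \<delta>"
    using Gc[OF \<open>Inl e \<in> selected \<tau>\<close>, of 1] by simp
  ultimately show False using \<delta>(1) by simp
qed

section \<open>Flexes of generic frameworks\<close>

lemma avoids_rational_equationsD:
  assumes "avoids_rational_equations p" "ratpoly coord f" "on_cylinder q" "f q \<noteq> 0"
  shows "f p \<noteq> 0"
  using assms unfolding avoids_rational_equations_def by blast

lemma avoids_rational_equations_rank_eq:
  assumes "avoids_rational_equations p" "avoids_rational_equations q"
  shows "rank (rigidity_matrix E p) = rank (rigidity_matrix E q)"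
  using assms rank_generic_maximal[OF _ _ ratpoly_rigidity_matrix]
  by (metis antisym avoids_rational_equations_def)

text \<open>An arbitrary position of the old vertices is completed by leaving the new ones where
  \<open>p\<close> has them.\<close>

lemma avoids_rational_equations_restrict:
  fixes p :: "'v::finite + 'w::finite \<Rightarrow> real^3"
  assumes "avoids_rational_equations p"
  shows "avoids_rational_equations (p \<circ> Inl)"
  unfolding avoids_rational_equations_def
proof (intro conjI allI impI)
  have cyl: "on_cylinder p" using assms by (simp add: avoids_rational_equations_def)
  then show "on_cylinder (p \<circ> Inl)" by (simp add: on_cylinder_def)
  fix f q assume f: "ratpoly coord f" "f (p \<circ> Inl) = 0" and q: "on_cylinder (q :: 'v \<Rightarrow> real^3)"
  have "ratpoly coord (\<lambda>p. f (p \<circ> Inl))"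
    using f(1) by (rule ratpoly_comp) (simp add: coord_def ratpoly_coord)
  moreover have "on_cylinder (case_sum q (p \<circ> Inr))"
    using q cyl by (simp add: on_cylinder_def split: sum.split)
  ultimately have "f (case_sum q (p \<circ> Inr) \<circ> Inl) = 0"
    using assms f(2) unfolding avoids_rational_equations_def by blast
  then show "f q = 0" by (simp add: comp_def)
qed

section \<open>Generic inequalities and infinitesimal motions on the cylinder\<close>

definition cross_xy :: "('v \<Rightarrow> real^3) \<Rightarrow> 'v \<Rightarrow> 'v \<Rightarrow> real" where
  "cross_xy p i j = p i $ 1 * p j $ 2 - p i $ 2 * p j $ 1"

lemma ratpoly_cross_xy: "ratpoly coord (\<lambda>p. cross_xy p i j)"
  unfolding cross_xy_def by (intro ratpoly_diff ratpoly.mult ratpoly_coord)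

text \<open>A rational polynomial that is nonzero at one simple position is nonzero at
  \<open>p\<close>; in each case such a position is exhibited.\<close>

lemma
  assumes p: "avoids_rational_equations p" and "u \<noteq> v"
  shows generic_height: "p u $ 3 \<noteq> p v $ 3"
    and generic_cross_xy: "cross_xy p u v \<noteq> 0"
    and generic_inner_xy: "p u $ 1 * p v $ 1 + p u $ 2 * p v $ 2 \<noteq> 0"
proof -
  have "ratpoly coord (\<lambda>p. p u $ 3 - p v $ 3)" by (intro ratpoly_diff ratpoly_coord)
  from avoids_rational_equationsD[OF p this, of "\<lambda>w. vector [1, 0, if w = u then 1 else 0]"] assms(2)
  show "p u $ 3 \<noteq> p v $ 3" by (simp add: on_cylinder_iff)
  from avoids_rational_equationsD[OF p ratpoly_cross_xy, of "\<lambda>w. if w = u then vector [1, 0, 0] else vector [0, 1, 0]" u v] assms(2)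
  show "cross_xy p u v \<noteq> 0" by (simp add: on_cylinder_iff cross_xy_def)
  have "ratpoly coord (\<lambda>p. p u $ 1 * p v $ 1 + p u $ 2 * p v $ 2)"
    by (intro ratpoly.add ratpoly.mult ratpoly_coord)
  from avoids_rational_equationsD[OF p this, of "\<lambda>w. vector [1, 0, 0]"]
  show "p u $ 1 * p v $ 1 + p u $ 2 * p v $ 2 \<noteq> 0" by (simp add: on_cylinder_iff)
qed

text \<open>Up to sign, the determinant of the two edge equations for the motion of \<open>a\<close>
  relative to \<open>x\<close> and \<open>y\<close>. If it is nonzero and \<open>x\<close>,
  \<open>y\<close> share a trivial motion, then a vertex \<open>a\<close> joined to both shares
  it.\<close>

definition tangent_det :: "('v \<Rightarrow> real^3) \<Rightarrow> 'v \<Rightarrow> 'v \<Rightarrow> 'v \<Rightarrow> real" where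
  "tangent_det p a x y = cross_xy p a x * (p a $ 3 - p y $ 3) - cross_xy p a y * (p a $ 3 - p x $ 3)"

lemma generic_tangent_det:
  assumes p: "avoids_rational_equations p" and "a \<noteq> x" "a \<noteq> y" "x \<noteq> y"
  shows "tangent_det p a x y \<noteq> 0"
proof (rule avoids_rational_equationsD[OF p])
  let ?q = "\<lambda>w. if w = a then vector [1, 0, 0] else if w = x then vector [0, 1, 0] else vector [1, 0, 1] :: real^3"
  show "ratpoly coord (\<lambda>p. tangent_det p a x y)"
    unfolding tangent_det_def by (intro ratpoly_diff ratpoly.mult ratpoly_cross_xy ratpoly_coord)
  show "on_cylinder ?q" by (simp add: on_cylinder_iff)
  show "tangent_det ?q a x y \<noteq> 0" using assms by (simp add: tangent_det_def cross_xy_def)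
qed

text \<open>The velocity field whose angular velocity at \<open>v\<close> is \<open>\<alpha> v\<close> and whose vertical speed is \<open>\<beta> v\<close>.\<close>

definition tangent_motion :: "('v::finite \<Rightarrow> real^3) \<Rightarrow> ('v \<Rightarrow> real) \<Rightarrow> ('v \<Rightarrow> real) \<Rightarrow> real^('v \<times> 3)" where
  "tangent_motion p \<alpha> \<beta> = (\<chi> c. vector [- \<alpha> (fst c) * p (fst c) $ 2, \<alpha> (fst c) * p (fst c) $ 1, \<beta> (fst c)] $ snd c)"

lemma velocity_tangent_motion:
  "velocity (tangent_motion p \<alpha> \<beta>) v = vector [- \<alpha> v * p v $ 2, \<alpha> v * p v $ 1, \<beta> v]"
  by (simp add: vec_eq_iff velocity_nth tangent_motion_def)

lemma edge_constraint_iff: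
  assumes "on_cylinder p"
  shows "(p i - p j) \<bullet> (velocity (tangent_motion p \<alpha> \<beta>) i - velocity (tangent_motion p \<alpha> \<beta>) j) = 0 \<longleftrightarrow>
    (p i $ 3 - p j $ 3) * (\<beta> i - \<beta> j) = cross_xy p i j * (\<alpha> i - \<alpha> j)"
  by (simp add: velocity_tangent_motion inner_vec_def sum_3 cross_xy_def) (simp add: algebra_simps)

definition flexes :: "'v::finite set set \<Rightarrow> ('v \<Rightarrow> real^3) \<Rightarrow> ('v \<Rightarrow> real) \<Rightarrow> ('v \<Rightarrow> real) \<Rightarrow> bool" where
  "flexes E p \<alpha> \<beta> \<longleftrightarrow> (\<forall>i j. {i, j} \<in> E \<longrightarrow>
    (p i $ 3 - p j $ 3) * (\<beta> i - \<beta> j) = cross_xy p i j * (\<alpha> i - \<alpha> j))"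

lemma tangent_motion_nullspace:
  assumes "on_cylinder p"
  shows "rigidity_matrix E p *v tangent_motion p \<alpha> \<beta> = 0 \<longleftrightarrow> flexes E p \<alpha> \<beta>"
  unfolding rigidity_matrix_nullspace edge_constraint_iff[OF assms] flexes_def
  by (simp add: velocity_tangent_motion inner_vec_def sum_3 horizontal_def)

lemma nullspace_tangent_motion:
  assumes cyl: "on_cylinder p" and m: "rigidity_matrix E p *v m = 0"
  obtains \<alpha> \<beta> where "m = tangent_motion p \<alpha> \<beta>" "flexes E p \<alpha> \<beta>"
proof -
  define \<alpha> where "\<alpha> v = p v $ 1 * velocity m v $ 2 - p v $ 2 * velocity m v $ 1" for v
  define \<beta> where "\<beta> v = velocity m v $ 3" for v
  have "m = tangent_motion p \<alpha> \<beta>"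
  proof -
    have "velocity m v = velocity (tangent_motion p \<alpha> \<beta>) v" for v
    proof -
      define x y where "x = p v $ 1" and "y = p v $ 2"
      define m1 m2 where "m1 = velocity m v $ 1" and "m2 = velocity m v $ 2"
      have 1: "x\<^sup>2 + y\<^sup>2 = 1" using cyl by (simp add: on_cylinder_iff x_def y_def)
      have 2: "x * m1 + y * m2 = 0"
        using m by (simp add: rigidity_matrix_nullspace inner_vec_def sum_3 horizontal_def x_def y_def m1_def m2_def)
      have "- (x * m2 - y * m1) * y = m1" using 1 2 by algebra
      moreover have "(x * m2 - y * m1) * x = m2" using 1 2 by algebra
      ultimately show ?thesis
        unfolding velocity_tangent_motion vec_eq_iff forall_3
        by (simp add: \<alpha>_def \<beta>_def x_def y_def m1_def m2_def)
    qed
    then have "m $ (v, k) = tangent_motion p \<alpha> \<beta> $ (v, k)" for v k by (metis velocity_nth)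
    then show ?thesis by (simp add: vec_eq_iff)
  qed
  with m that tangent_motion_nullspace[OF cyl] show thesis by metis
qed

text \<open>Relative to \<open>x\<close>, the edge from \<open>i\<close> to \<open>x\<close> leaves
  one unknown \<mu> at \<open>i\<close>. The edge from \<open>i\<close> to \<open>j\<close> then
  relates the unknowns at \<open>i\<close> and \<open>j\<close> with the coefficients
  \<open>K4_coeff p x i j\<close> and \<open>K4_coeff p x j i\<close>.\<close>

definition K4_coeff :: "('v \<Rightarrow> real^3) \<Rightarrow> 'v \<Rightarrow> 'v \<Rightarrow> 'v \<Rightarrow> real" where
  "K4_coeff p x i j = (p i $ 3 - p j $ 3) * cross_xy p i x - cross_xy p i j * (p i $ 3 - p x $ 3)"

text \<open>This expression is the determinant of the cyclic system for the unknowns at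
  \<open>y\<close>, \<open>a\<close>, \<open>b\<close>; four well-spread points show that it is not
  identically zero.\<close>

lemma generic_K4:
  assumes p: "avoids_rational_equations p" and d: "distinct [x, y, a, b]"
  shows "K4_coeff p x y a * K4_coeff p x a b * K4_coeff p x b y +
    K4_coeff p x a y * K4_coeff p x b a * K4_coeff p x y b \<noteq> 0"
proof (rule avoids_rational_equationsD[OF p])
  let ?q = "\<lambda>w. if w = x then vector [1, 0, 0] else if w = y then vector [0, 1, 0]
    else if w = a then vector [-1, 0, 2] else vector [0, -1, 1] :: real^3"
  show "ratpoly coord (\<lambda>p. K4_coeff p x y a * K4_coeff p x a b * K4_coeff p x b y +
    K4_coeff p x a y * K4_coeff p x b a * K4_coeff p x y b)"
    unfolding K4_coeff_def by (intro ratpoly_diff ratpoly.add ratpoly.mult ratpoly_cross_xy ratpoly_coord)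
  show "on_cylinder ?q" by (simp add: on_cylinder_iff)
  show "K4_coeff ?q x y a * K4_coeff ?q x a b * K4_coeff ?q x b y +
    K4_coeff ?q x a y * K4_coeff ?q x b a * K4_coeff ?q x y b \<noteq> 0"
    using d by (auto simp: K4_coeff_def cross_xy_def)
qed

lemma complete_flex_trivial:
  assumes p: "avoids_rational_equations p" and d: "distinct [x, y, a, b]" and f: "flexes UNIV p \<alpha> \<beta>"
  shows "\<alpha> y = \<alpha> x \<and> \<beta> y = \<beta> x"
proof -
  have e: "(p i $ 3 - p j $ 3) * (\<beta> i - \<beta> j) = cross_xy p i j * (\<alpha> i - \<alpha> j)" for i j
    using f by (simp add: flexes_def)
  define \<mu> where "\<mu> i = (\<alpha> i - \<alpha> x) / (p i $ 3 - p x $ 3)" for i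
  have \<alpha>: "\<alpha> i - \<alpha> x = \<mu> i * (p i $ 3 - p x $ 3)" if "i \<noteq> x" for i
    using generic_height[OF p that] by (simp add: \<mu>_def)
  have \<beta>: "\<beta> i - \<beta> x = \<mu> i * cross_xy p i x" if "i \<noteq> x" for i
    using generic_height[OF p that] e[of i x] by (simp add: \<mu>_def field_simps)
  have sym: "cross_xy p j i = - cross_xy p i j" for i j by (simp add: cross_xy_def)
  have K: "K4_coeff p x i j * \<mu> i + K4_coeff p x j i * \<mu> j = 0" if "i \<noteq> x" "j \<noteq> x" for i j
  proof -
    have "(p i $ 3 - p j $ 3) * ((\<beta> i - \<beta> x) - (\<beta> j - \<beta> x)) = cross_xy p i j * ((\<alpha> i - \<alpha> x) - (\<alpha> j - \<alpha> x))"
      using e[of i j] by simp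
    then show ?thesis
      unfolding \<alpha>[OF that(1)] \<alpha>[OF that(2)] \<beta>[OF that(1)] \<beta>[OF that(2)] K4_coeff_def sym[of i j]
      by (simp add: algebra_simps)
  qed
  have "(K4_coeff p x y a * K4_coeff p x a b * K4_coeff p x b y +
    K4_coeff p x a y * K4_coeff p x b a * K4_coeff p x y b) * \<mu> y = 0"
  proof -
    have "K4_coeff p x y a * \<mu> y + K4_coeff p x a y * \<mu> a = 0" "K4_coeff p x a b * \<mu> a + K4_coeff p x b a * \<mu> b = 0"
      "K4_coeff p x b y * \<mu> b + K4_coeff p x y b * \<mu> y = 0" using d by (auto intro!: K)
    then show ?thesis by algebra
  qed
  then have "\<mu> y = 0" using generic_K4[OF p d] by simp
  then show ?thesis using \<alpha>[of y] \<beta>[of y] d by auto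
qed

text \<open>The framework \<open>q\<close> that witnesses rigidity may differ from \<open>p\<close>,
  but at both the ranks take their generic values. The inclusion of kernels becomes an equality by
  dimension.\<close>

lemma rigid_nullspace_complete:
  fixes p :: "'v::finite \<Rightarrow> real^3"
  assumes p: "avoids_rational_equations p" and rigid: "rigid_on_cylinder E"
  shows "rank (rigidity_matrix UNIV p) \<le> rank (rigidity_matrix E p)"
    and "{m. rigidity_matrix UNIV p *v m = 0} = {m. rigidity_matrix E p *v m = 0}"
proof -
  obtain q where q: "generic_on_cylinder q" "rigid_framework E q"
    using rigid unfolding rigid_on_cylinder_def by blast
  note aq = generic_avoids_rational_equations[OF q(1)]
  show r: "rank (rigidity_matrix UNIV p) \<le> rank (rigidity_matrix E p)"
    using rigid_imp_rank_complete[OF aq q(2)] by (simp add: avoids_rational_equations_rank_eq[OF p aq])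
  have "{m. rigidity_matrix UNIV p *v m = 0} \<subseteq> {m. rigidity_matrix E p *v m = 0}"
    by (auto simp: rigidity_matrix_nullspace)
  then show "{m. rigidity_matrix UNIV p *v m = 0} = {m. rigidity_matrix E p *v m = 0}"
    using r by (rule rank_eq_imp_nullspace_eq)
qed

text \<open>A complete graph on at most three vertices is rigid in the sense of congruence although
  it moves nontrivially on the cylinder. The missing edge \<open>{x, y}\<close> excludes these
  cases; with four vertices or more, any vertex lies with \<open>x\<close> in a complete graph on
  four.\<close>

lemma rigid_flex_trivial:
  fixes p :: "'v::finite \<Rightarrow> real^3"
  assumes p: "avoids_rational_equations p" and rigid: "rigid_on_cylinder E"
    and xy: "x \<noteq> y" "{x, y} \<notin> E" and f: "flexes E p \<alpha> \<beta>"
  shows "\<alpha> v = \<alpha> x \<and> \<beta> v = \<beta> x"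
proof -
  have cyl: "on_cylinder p" using p by (simp add: avoids_rational_equations_def)
  have complete: "flexes UNIV p \<gamma> \<delta>" if "flexes E p \<gamma> \<delta>" for \<gamma> \<delta>
    using rigid_nullspace_complete(2)[OF p rigid] that tangent_motion_nullspace[OF cyl] by blast
  have "\<exists>a b. a \<noteq> b \<and> a \<noteq> x \<and> a \<noteq> y \<and> b \<noteq> x \<and> b \<noteq> y"
  proof (rule ccontr)
    assume "\<not> ?thesis"
    then have one: "a = b" if "a \<noteq> x" "a \<noteq> y" "b \<noteq> x" "b \<noteq> y" for a b using that by blast
    \<comment> \<open>With at most three vertices, \<open>x\<close> can be lifted while \<open>y\<close> is fixed.\<close>
    define t where "t a = - (p a $ 3 - p x $ 3) / tangent_det p a x y" for a
    define \<gamma> where "\<gamma> a = (if a = x \<or> a = y then 0 else t a * (p a $ 3 - p y $ 3))" for a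
    define \<delta> where "\<delta> a = (if a = x then 1 else if a = y then 0 else t a * cross_xy p a y)" for a
    have sym: "cross_xy p j i = - cross_xy p i j" for i j by (simp add: cross_xy_def)
    have ax: "(p a $ 3 - p x $ 3) * (\<delta> a - \<delta> x) = cross_xy p a x * (\<gamma> a - \<gamma> x)" if "a \<noteq> x" "a \<noteq> y" for a
    proof -
      have "t a * tangent_det p a x y = - (p a $ 3 - p x $ 3)"
        using generic_tangent_det[OF p that xy(1)] by (simp add: t_def)
      then show ?thesis using that by (simp add: \<gamma>_def \<delta>_def tangent_det_def algebra_simps)
    qed
    have ay: "(p a $ 3 - p y $ 3) * (\<delta> a - \<delta> y) = cross_xy p a y * (\<gamma> a - \<gamma> y)" if "a \<noteq> x" "a \<noteq> y" for a
      using that xy(1) by (simp add: \<gamma>_def \<delta>_def algebra_simps)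
    have "flexes E p \<gamma> \<delta>"
      unfolding flexes_def
    proof (intro allI impI)
      fix i j assume ij: "{i, j} \<in> E"
      have "\<not> (i = x \<and> j = y)" "\<not> (i = y \<and> j = x)" using ij xy(2) by (auto simp: insert_commute)
      then consider "i = j" | "j = x" "i \<noteq> x" "i \<noteq> y" | "j = y" "i \<noteq> x" "i \<noteq> y"
        | "i = x" "j \<noteq> x" "j \<noteq> y" | "i = y" "j \<noteq> x" "j \<noteq> y"
        using one[of i j] by blast
      then show "(p i $ 3 - p j $ 3) * (\<delta> i - \<delta> j) = cross_xy p i j * (\<gamma> i - \<gamma> j)"
      proof cases
        case 4
        then show ?thesis using ax[of j] sym[of j x] by (simp add: algebra_simps)
      next
        case 5
        then show ?thesis using ay[of j] sym[of j y] by (simp add: algebra_simps)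
      qed (use ax ay in auto)
    qed
    then have "flexes UNIV p \<gamma> \<delta>" by (rule complete)
    then have "(p x $ 3 - p y $ 3) * (\<delta> x - \<delta> y) = cross_xy p x y * (\<gamma> x - \<gamma> y)"
      by (simp add: flexes_def)
    then show False using xy(1) generic_height[OF p xy(1)] by (simp add: \<gamma>_def \<delta>_def)
  qed
  then obtain a b where ab: "a \<noteq> b" "a \<noteq> x" "a \<noteq> y" "b \<noteq> x" "b \<noteq> y" by blast
  consider "v = x" | "v = y" | "v = a" | "v = b" | "distinct [x, v, y, a]" using ab xy(1) by auto
  then show ?thesis
  proof cases
    case 2
    then show ?thesis using complete_flex_trivial[OF p _ complete[OF f], of x y a b] ab xy(1) by auto
  next
    case 3
    then show ?thesis using complete_flex_trivial[OF p _ complete[OF f], of x a y b] ab xy(1) by auto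
  next
    case 4
    then show ?thesis using complete_flex_trivial[OF p _ complete[OF f], of x b y a] ab xy(1) by auto
  next
    case 5
    then show ?thesis using complete_flex_trivial[OF p _ complete[OF f], of x v y a] by auto
  qed simp
qed

lemma linear_constant_motion:
  fixes p :: "'v::finite \<Rightarrow> real^3"
  shows "linear (\<lambda>(c, d). tangent_motion p (\<lambda>_. c) (\<lambda>_. d))"
proof (rule linearI)
  fix a b :: "real \<times> real" and r :: real
  have eq: "m = m'" if "\<And>v. velocity m v = velocity m' v" for m m' :: "real^('v \<times> 3)"
  proof -
    have "m $ (v, k) = m' $ (v, k)" for v k using that by (metis velocity_nth)
    then show ?thesis by (simp add: vec_eq_iff)
  qed
  show "(case a + b of (c, d) \<Rightarrow> tangent_motion p (\<lambda>_. c) (\<lambda>_. d)) =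
    (case a of (c, d) \<Rightarrow> tangent_motion p (\<lambda>_. c) (\<lambda>_. d)) + (case b of (c, d) \<Rightarrow> tangent_motion p (\<lambda>_. c) (\<lambda>_. d))"
    by (rule eq, cases a, cases b)
      (simp add: velocity_add velocity_tangent_motion vec_eq_iff forall_3 algebra_simps)
  show "(case r *\<^sub>R a of (c, d) \<Rightarrow> tangent_motion p (\<lambda>_. c) (\<lambda>_. d)) =
    r *\<^sub>R (case a of (c, d) \<Rightarrow> tangent_motion p (\<lambda>_. c) (\<lambda>_. d))"
    by (rule eq, cases a)
      (simp add: velocity_scaleR velocity_tangent_motion vec_eq_iff forall_3 algebra_simps)
qed

text \<open>Rotation and vertical translation always give a kernel of dimension at least 2; at
  \<open>q\<close> there is nothing else.\<close>

lemma rank_le_of_trivial_flexes: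
  fixes p q :: "'v::finite \<Rightarrow> real^3"
  assumes p: "on_cylinder p" and q: "on_cylinder q"
    and triv: "\<And>\<alpha> \<beta>. flexes E q \<alpha> \<beta> \<Longrightarrow> \<exists>c d. \<alpha> = (\<lambda>_. c) \<and> \<beta> = (\<lambda>_. d)"
  shows "rank (rigidity_matrix E p) \<le> rank (rigidity_matrix E q)"
proof -
  let ?T = "\<lambda>p (c, d). tangent_motion p (\<lambda>_. c) (\<lambda>_. d)"
  have "{m. rigidity_matrix E q *v m = 0} \<subseteq> range (?T q)"
  proof
    fix m assume "m \<in> {m. rigidity_matrix E q *v m = 0}"
    then obtain \<alpha> \<beta> where "m = tangent_motion q \<alpha> \<beta>" "flexes E q \<alpha> \<beta>"
      using nullspace_tangent_motion[OF q] by blast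
    with triv show "m \<in> range (?T q)" by fastforce
  qed
  then have "dim {m. rigidity_matrix E q *v m = 0} \<le> dim (range (?T q))" by (rule dim_subset)
  also have "\<dots> \<le> dim (UNIV :: (real \<times> real) set)"
    by (rule dim_image_le[OF linear_constant_motion])
  also have "\<dots> = dim (range (?T p))"
  proof (rule dim_image_eq[OF linear_constant_motion, symmetric])
    have "?T p t = 0 \<Longrightarrow> t = 0" for t
    proof -
      assume t: "?T p t = 0"
      obtain c d where cd: "t = (c, d)" by force
      fix v :: 'v
      have z: "velocity (?T p t) v = 0" unfolding t by (simp add: vec_eq_iff velocity_nth)
      have "d = 0" "c * p v $ 1 = 0" "c * p v $ 2 = 0"
        using z by (simp_all add: cd velocity_tangent_motion vec_eq_iff forall_3)
      moreover have "(p v $ 1)\<^sup>2 + (p v $ 2)\<^sup>2 = 1" using p by (simp add: on_cylinder_iff)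
      ultimately show "t = 0" by (auto simp: cd zero_prod_def)
    qed
    then have "inj (?T p)" unfolding linear_injective_0[OF linear_constant_motion] by blast
    then show "inj_on (?T p) (span UNIV)" by simp
  qed
  also have "\<dots> \<le> dim {m. rigidity_matrix E p *v m = 0}"
    by (intro dim_subset) (auto simp: tangent_motion_nullspace[OF p] flexes_def)
  finally show ?thesis
    using dim_nullspace[of "rigidity_matrix E p"] dim_nullspace[of "rigidity_matrix E q"] by linarith
qed

text \<open>A rigid subgraph without the edge \<open>e\<close> resolves the edge, so some stress is nonzero on it; adding a
  small multiple of that stress does not lower the rank.\<close>

lemma stress_nonzero_on_edge:
  fixes p :: "'v::finite \<Rightarrow> real^3"
  assumes p: "avoids_rational_equations p" and rigid: "rigid_on_cylinder (E - {e})" and e: "e \<in> E"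
    and stress: "equilibrium_stress E p \<omega> l"
  shows "\<exists>\<omega>' l'. equilibrium_stress E p \<omega>' l' \<and> \<omega>' e \<noteq> 0 \<and>
    rank (cyl_stress_matrix E \<omega> l) \<le> rank (cyl_stress_matrix E \<omega>' l')"
proof (cases "\<omega> e = 0")
  case False
  then show ?thesis using stress by blast
next
  case True
  define s where "s = (\<chi> r. case r of Inl e \<Rightarrow> \<omega> e | Inr v \<Rightarrow> l v)"
  have s: "(\<lambda>e. s $ Inl e) = \<omega>" "(\<lambda>v. s $ Inr v) = l" by (auto simp: s_def)
  let ?A = "transpose (rigidity_matrix E p)" and ?B = "transpose (rigidity_matrix (E - {e}) p)"
  have As: "?A *v s = 0" using stress equilibrium_stress_iff[of E p s] by (simp add: s)
  have "\<exists>s'. ?A *v s' = 0 \<and> s' $ Inl e \<noteq> 0"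
  proof (rule ccontr)
    assume no: "\<not> ?thesis"
    have "{s. ?A *v s = 0} \<subseteq> {s. ?B *v s = 0}"
    proof
      fix s' assume "s' \<in> {s. ?A *v s = 0}"
      then have A: "?A *v s' = 0" and z: "s' $ Inl e = 0" using no by auto
      have eq: "rigidity_matrix (E - {e}) p $ r $ c * s' $ r = rigidity_matrix E p $ r $ c * s' $ r" for r c
      proof (cases r)
        case (Inl f)
        then show ?thesis using z edge_row_cong[of f "E - {e}" E p] by (cases "f = e") auto
      next
        case (Inr v)
        then show ?thesis using vertex_row_cong[of "E - {e}" p v E] by simp
      qed
      have "?B *v s' = ?A *v s'"
        by (simp only: vec_eq_iff matrix_vector_mult_def transpose_def vec_lambda_beta eq simp_thms)
      then show "s' \<in> {s. ?B *v s = 0}" using A by simp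
    qed
    moreover have "rank ?A \<le> rank ?B"
    proof -
      have "{m. rigidity_matrix UNIV p *v m = 0} \<subseteq> {m. rigidity_matrix E p *v m = 0}"
        by (auto simp: rigidity_matrix_nullspace)
      from dim_subset[OF this] have "rank (rigidity_matrix E p) \<le> rank (rigidity_matrix UNIV p)"
        using dim_nullspace[of "rigidity_matrix E p"] dim_nullspace[of "rigidity_matrix UNIV p"] by linarith
      then show ?thesis using rigid_nullspace_complete(1)[OF p rigid] by (simp add: rank_transpose)
    qed
    ultimately have eq: "{s. ?A *v s = 0} = {s. ?B *v s = 0}" by (rule rank_eq_imp_nullspace_eq)
    \<comment> \<open>The zero row of the missing edge puts the unit vector at \<open>e\<close> into
      the cokernel of \<open>E - {e}\<close>. If the cokernels agreed, it would be a stress of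
      \<open>E\<close> that is nonzero on \<open>e\<close>.\<close>
    have "rigidity_matrix (E - {e}) p $ Inl e = 0" by (rule edge_row_eq_zero) simp
    then have "?B *v axis (Inl e) 1 = 0"
      by (simp add: vec_eq_iff matrix_vector_mul_component inner_axis transpose_def)
    then have "?A *v axis (Inl e) 1 = 0" using eq by blast
    with no show False by (auto simp: axis_def)
  qed
  then obtain s' where s': "?A *v s' = 0" "s' $ Inl e \<noteq> 0" by blast
  have "isCont (\<lambda>t. stress_vector_matrix E (s + t *\<^sub>R s') $ a $ b) 0" for a b
  proof -
    have "continuous_on UNIV (\<lambda>t. stress_vector_matrix E (s + t *\<^sub>R s') $ a $ b)"
      by (rule ratpoly_continuous[OF ratpoly_stress_vector_matrix]) (auto intro!: continuous_intros)
    then show ?thesis by (simp add: continuous_on_eq_continuous_at)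
  qed
  from rank_semicontinuous[where A = "\<lambda>t. stress_vector_matrix E (s + t *\<^sub>R s')", OF this]
  have "eventually (\<lambda>t. rank (stress_vector_matrix E s) \<le> rank (stress_vector_matrix E (s + t *\<^sub>R s'))) (at 0)"
    by simp
  moreover have "eventually (\<lambda>t::real. t \<noteq> 0) (at 0)" by (simp add: eventually_at_filter)
  ultimately have "eventually (\<lambda>t. rank (stress_vector_matrix E s) \<le> rank (stress_vector_matrix E (s + t *\<^sub>R s')) \<and> t \<noteq> 0) (at 0)"
    by (rule eventually_conj)
  then obtain t where t: "rank (stress_vector_matrix E s) \<le> rank (stress_vector_matrix E (s + t *\<^sub>R s'))" "t \<noteq> 0"
    using eventually_happens'[of "at (0::real)"] by auto
  define s2 where "s2 = s + t *\<^sub>R s'"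
  have "?A *v s2 = 0" using As s'(1) by (simp add: s2_def matrix_vector_right_distrib matrix_vector_mult_scaleR)
  moreover have "s2 $ Inl e \<noteq> 0" using True t(2) s'(2) by (simp add: s2_def s_def)
  moreover have "rank (cyl_stress_matrix E \<omega> l) \<le> rank (stress_vector_matrix E s2)"
    using t(1) by (simp only: s s2_def)
  ultimately show ?thesis
    unfolding equilibrium_stress_iff[symmetric] by blast
qed

section \<open>The extension\<close>

text \<open>The coefficients respect the half-turn: edges that it exchanges share \<open>P\<close>
  or \<open>Q\<close>. The preimage under \<open>Inl\<close> recovers the old edge.\<close>

definition extended_stress ::
  "('v::finite set \<Rightarrow> real) \<Rightarrow> 'v \<Rightarrow> 'v \<Rightarrow> real \<Rightarrow> real \<Rightarrow> real \<Rightarrow> ('v + bool) set \<Rightarrow> real" where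
  "extended_stress \<omega> x y P Q R e =
     (if e = {Inr False, Inr True} then R
      else if e = {Inr False, Inl x} \<or> e = {Inr True, Inl y} then P
      else if e = {Inr False, Inl y} \<or> e = {Inr True, Inl x} then Q
      else \<omega> (Inl -` e))"

definition extended_load :: "('v \<Rightarrow> real) \<Rightarrow> 'v \<Rightarrow> 'v \<Rightarrow> real \<Rightarrow> real \<Rightarrow> 'v + bool \<Rightarrow> real" where
  "extended_load l x y lx lu i = (case i of Inl v \<Rightarrow> l v + (if v = x \<or> v = y then lx else 0) | Inr _ \<Rightarrow> lu)"

lemma weight_commute: "weight E \<omega> i j = weight E \<omega> j i"
  by (simp add: weight_def insert_commute)

lemma simple_graph_K4_minus_extension:
  assumes "simple_graph E"
  shows "simple_graph (K4_minus_extension E x y)"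
  using assms unfolding simple_graph_def K4_minus_extension_def
  by (auto simp: card_image)

lemma old_edge_iff: "{Inl i, Inl j} \<in> K4_minus_extension E x y \<longleftrightarrow> {i, j} \<in> E \<and> {i, j} \<noteq> {x, y}"
proof -
  have "{Inl i, Inl j} = Inl ` {i, j}" by simp
  moreover have "Inl ` {i, j} \<in> (`) Inl ` (E - {{x, y}}) \<longleftrightarrow> {i, j} \<in> E - {{x, y}}"
    by (rule inj_image_mem_iff) (simp add: inj_def inj_image_eq_iff)
  ultimately show ?thesis
    unfolding K4_minus_extension_def by (auto simp: doubleton_eq_iff)
qed

lemma
  assumes "x \<noteq> y" and xy: "{x, y} \<in> E"
  shows weight_old: "weight (K4_minus_extension E x y) (extended_stress \<omega> x y P Q R) (Inl i) (Inl j) =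
      weight E \<omega> i j - (if {i, j} = {x, y} then \<omega> {x, y} else 0)"
    and weight_new_old: "weight (K4_minus_extension E x y) (extended_stress \<omega> x y P Q R) (Inr b) (Inl j) =
      (if j = x then if b then Q else P else if j = y then if b then P else Q else 0)"
    and weight_new: "b \<noteq> b' \<Longrightarrow> weight (K4_minus_extension E x y) (extended_stress \<omega> x y P Q R) (Inr b) (Inr b') = R"
proof -
  have preimage: "Inl -` {Inl i, Inl j} = {i, j}" by auto
  have "extended_stress \<omega> x y P Q R {Inl i, Inl j} = \<omega> {i, j}"
    unfolding extended_stress_def preimage by (simp add: doubleton_eq_iff)
  then show "weight (K4_minus_extension E x y) (extended_stress \<omega> x y P Q R) (Inl i) (Inl j) =
      weight E \<omega> i j - (if {i, j} = {x, y} then \<omega> {x, y} else 0)"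
    using xy by (auto simp: weight_def old_edge_iff)
  have "{Inr b, Inl j} \<in> K4_minus_extension E x y \<longleftrightarrow> j = x \<or> j = y"
    by (cases b) (auto simp: K4_minus_extension_def doubleton_eq_iff)
  then show "weight (K4_minus_extension E x y) (extended_stress \<omega> x y P Q R) (Inr b) (Inl j) =
      (if j = x then if b then Q else P else if j = y then if b then P else Q else 0)"
    using assms(1) by (cases b) (auto simp: weight_def extended_stress_def doubleton_eq_iff)
  assume "b \<noteq> b'"
  then have "{Inr b, Inr b'} = ({Inr False, Inr True} :: ('a + bool) set)" by (cases b) auto
  then show "weight (K4_minus_extension E x y) (extended_stress \<omega> x y P Q R) (Inr b) (Inr b') = R"
    by (simp add: weight_def extended_stress_def K4_minus_extension_def)
qed

text \<open>The stress operator of the complete graph on the two old and two new vertices, with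
  coefficient \<open>- w\<close> on the old edge so that adding it cancels a stress \<open>w\<close>
  there.\<close>

definition K4_operator :: "'v \<Rightarrow> 'v \<Rightarrow> real \<Rightarrow> real \<Rightarrow> real \<Rightarrow> real \<Rightarrow> real \<Rightarrow> real \<Rightarrow> ('v + bool \<Rightarrow> real) \<Rightarrow> 'v + bool \<Rightarrow> real" where
  "K4_operator x y w P Q R lx lu f i =
     (if i = Inl x then - w * (f (Inl x) - f (Inl y)) + P * (f (Inl x) - f (Inr False)) + Q * (f (Inl x) - f (Inr True)) + lx * f (Inl x)
      else if i = Inl y then - w * (f (Inl y) - f (Inl x)) + P * (f (Inl y) - f (Inr True)) + Q * (f (Inl y) - f (Inr False)) + lx * f (Inl y)
      else if i = Inr False then R * (f (Inr False) - f (Inr True)) + P * (f (Inr False) - f (Inl x)) + Q * (f (Inr False) - f (Inl y)) + lu * f (Inr False)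
      else if i = Inr True then R * (f (Inr True) - f (Inr False)) + P * (f (Inr True) - f (Inl y)) + Q * (f (Inr True) - f (Inl x)) + lu * f (Inr True)
      else 0)"

lemma sum_two: "finite A \<Longrightarrow> x \<in> A \<Longrightarrow> y \<in> A \<Longrightarrow> x \<noteq> y \<Longrightarrow>
    (\<Sum>j\<in>A. if j = x then a j else if j = y then b j else 0) = a x + (b y :: real)"
proof -
  assume *: "finite A" "x \<in> A" "y \<in> A" "x \<noteq> y"
  have "(\<Sum>j\<in>A. if j = x then a j else if j = y then b j else 0) =
      (\<Sum>j\<in>A. if j = x then a j else 0) + (\<Sum>j\<in>A. if j = y then b j else 0)"
    unfolding sum.distrib[symmetric] using * by (intro sum.cong) auto
  then show ?thesis using * by simp
qed

text \<open>The removed edge is treated as present in the old part and cancelled by the coefficient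
  in the second part; so the operator is additive and each summand can be handled alone.\<close>

lemma stress_operator_extension:
  fixes E :: "'v::finite set set"
  assumes xy: "x \<noteq> y" "{x, y} \<in> E"
  shows "stress_operator (K4_minus_extension E x y) (extended_stress \<omega> x y P Q R) (extended_load l x y lx lu) f i =
    (case i of Inl v \<Rightarrow> stress_operator E \<omega> l (f \<circ> Inl) v | Inr _ \<Rightarrow> 0) + K4_operator x y (\<omega> {x, y}) P Q R lx lu f i"
proof (cases i)
  case (Inl v)
  let ?W = "weight (K4_minus_extension E x y) (extended_stress \<omega> x y P Q R)"
  have old: "(\<Sum>j\<in>UNIV. ?W (Inl v) (Inl j) * (f (Inl v) - f (Inl j))) =
    (\<Sum>j\<in>UNIV. weight E \<omega> v j * (f (Inl v) - f (Inl j))) -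
    (\<Sum>j\<in>UNIV. if {v, j} = {x, y} then \<omega> {x, y} * (f (Inl v) - f (Inl j)) else 0)"
    unfolding weight_old[OF xy] sum_subtractf[symmetric] by (intro sum.cong) (auto simp: algebra_simps)
  have "(\<Sum>j\<in>UNIV. if {v, j} = {x, y} then \<omega> {x, y} * (f (Inl v) - f (Inl j)) else 0) =
    (if v = x then \<omega> {x, y} * (f (Inl x) - f (Inl y)) else if v = y then \<omega> {x, y} * (f (Inl y) - f (Inl x)) else 0)"
  proof -
    have "(\<Sum>j\<in>UNIV. if {v, j} = {x, y} then \<omega> {x, y} * (f (Inl v) - f (Inl j)) else 0) =
      (\<Sum>j\<in>UNIV. if j = (if v = x then y else x) then
        (if v = x \<or> v = y then \<omega> {x, y} * (f (Inl v) - f (Inl j)) else 0) else 0)"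
      using xy(1) by (intro sum.cong) (auto simp: doubleton_eq_iff)
    then show ?thesis using xy(1) by simp
  qed
  note old = old[unfolded this]
  have new: "?W (Inl v) (Inr b) = (if v = x then if b then Q else P else if v = y then if b then P else Q else 0)" for b
    unfolding weight_commute[of _ _ "Inl v"] by (rule weight_new_old[OF xy])
  show ?thesis
    unfolding Inl stress_operator_def sum_UNIV_Plus old
    using xy(1) by (simp add: UNIV_bool new extended_load_def K4_operator_def algebra_simps)
next
  case (Inr b)
  let ?W = "weight (K4_minus_extension E x y) (extended_stress \<omega> x y P Q R)"
  have "(\<Sum>j\<in>UNIV. ?W (Inr b) (Inl j) * (f (Inr b) - f (Inl j))) =
    (\<Sum>j\<in>UNIV. if j = x then (if b then Q else P) * (f (Inr b) - f (Inl j))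
      else if j = y then (if b then P else Q) * (f (Inr b) - f (Inl j)) else 0)"
    unfolding weight_new_old[OF xy] by (intro sum.cong) auto
  also have "\<dots> = (if b then Q else P) * (f (Inr b) - f (Inl x)) + (if b then P else Q) * (f (Inr b) - f (Inl y))"
    using xy(1) by (intro sum_two) auto
  finally have old: "(\<Sum>j\<in>UNIV. ?W (Inr b) (Inl j) * (f (Inr b) - f (Inl j))) = \<dots>" .
  have new: "?W (Inr False) (Inr True) = R" "?W (Inr True) (Inr False) = R"
    by (rule weight_new[OF xy], simp)+
  show ?thesis
    unfolding Inr stress_operator_def sum_UNIV_Plus old
    by (cases b) (simp_all add: UNIV_bool new extended_load_def K4_operator_def)
qed

lemma K4_operator_linear:
  "K4_operator x y w P Q R lx lu (\<lambda>v. a * f v + b * g v) i =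
    a * K4_operator x y w P Q R lx lu f i + b * K4_operator x y w P Q R lx lu g i"
  by (auto simp: K4_operator_def algebra_simps)

text \<open>The block of the two new vertices is symmetric under their exchange. Its eigenvectors
  are their sum and difference, with the two nonzero numbers as eigenvalues.\<close>

lemma K4_operator_determined:
  assumes "P + Q + lu \<noteq> 0" "2 * R + P + Q + lu \<noteq> 0" "f (Inl x) = 0" "f (Inl y) = 0"
    and "K4_operator x y w P Q R lx lu f (Inr False) = 0" "K4_operator x y w P Q R lx lu f (Inr True) = 0"
  shows "f (Inr False) = 0" "f (Inr True) = 0"
proof -
  define g h where "g = f (Inr False)" and "h = f (Inr True)"
  have 1: "R * (g - h) + P * g + Q * g + lu * g = 0" "R * (h - g) + P * h + Q * h + lu * h = 0"
    using assms(3-6) by (simp_all add: K4_operator_def g_def h_def)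
  have "(P + Q + lu) * (g + h) = 0" "(2 * R + P + Q + lu) * (g - h) = 0" using 1 by algebra+
  then have "g + h = 0" "g - h = 0" using assms(1,2) by simp_all
  then show "f (Inr False) = 0" "f (Inr True) = 0" by (simp_all add: g_def h_def)
qed

text \<open>The equations at the two new vertices determine the values there, so the kernel of the
  extension restricts to the kernel of the original stress.\<close>

lemma extension_kernel:
  fixes E :: "'v::finite set set" and g h :: "'v + bool \<Rightarrow> real"
  assumes xy: "x \<noteq> y" "{x, y} \<in> E"
    and nd: "P + Q + lu \<noteq> 0" "2 * R + P + Q + lu \<noteq> 0"
    and gh: "g (Inl x) * h (Inl y) - g (Inl y) * h (Inl x) \<noteq> 0"
    and K4: "\<And>i. K4_operator x y (\<omega> {x, y}) P Q R lx lu g i = 0" "\<And>i. K4_operator x y (\<omega> {x, y}) P Q R lx lu h i = 0"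
    and ker: "\<And>f. (\<forall>i. stress_operator E \<omega> l f i = 0) \<Longrightarrow> \<exists>a b. \<forall>v. f v = a * g (Inl v) + b * h (Inl v)"
    and f: "\<forall>i. stress_operator (K4_minus_extension E x y) (extended_stress \<omega> x y P Q R) (extended_load l x y lx lu) f i = 0"
  shows "\<exists>a b. \<forall>v. f v = a * g v + b * h v"
proof -
  let ?K = "K4_operator x y (\<omega> {x, y}) P Q R lx lu"
  note ext = f[unfolded stress_operator_extension[OF xy], rule_format]
  define d where "d = g (Inl x) * h (Inl y) - g (Inl y) * h (Inl x)"
  \<comment> \<open>Cramer's rule: the combination of \<open>g\<close> and \<open>h\<close> that
    agrees with \<open>f\<close> at \<open>x\<close> and \<open>y\<close>.\<close>
  define a where "a = (f (Inl x) * h (Inl y) - f (Inl y) * h (Inl x)) / d"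
  define b where "b = (g (Inl x) * f (Inl y) - g (Inl y) * f (Inl x)) / d"
  have d0: "d \<noteq> 0" using gh by (simp add: d_def)
  have "d * (a * g (Inl x) + b * h (Inl x)) = d * f (Inl x)" "d * (a * g (Inl y) + b * h (Inl y)) = d * f (Inl y)"
  proof -
    have da: "d * a = f (Inl x) * h (Inl y) - f (Inl y) * h (Inl x)"
      and db: "d * b = g (Inl x) * f (Inl y) - g (Inl y) * f (Inl x)" using d0 by (simp_all add: a_def b_def)
    show "d * (a * g (Inl x) + b * h (Inl x)) = d * f (Inl x)" "d * (a * g (Inl y) + b * h (Inl y)) = d * f (Inl y)"
      using da db unfolding d_def by algebra+
  qed
  then have fxy: "a * g (Inl x) + b * h (Inl x) = f (Inl x)" "a * g (Inl y) + b * h (Inl y) = f (Inl y)"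
    using d0 by simp_all
  \<comment> \<open>The difference vanishes at \<open>x\<close> and \<open>y\<close>, hence at the
    new vertices. So the operator of the complete graph kills \<open>f\<close>, and the old part of
    \<open>f\<close> lies in the old kernel; its coefficients there must again be \<open>a\<close>
    and \<open>b\<close>.\<close>
  define k where "k v = 1 * f v + (-1) * (a * g v + b * h v)" for v
  have Kk: "?K k i = ?K f i" for i
    unfolding k_def K4_operator_linear by (simp add: K4)
  have "?K k (Inr False) = 0" "?K k (Inr True) = 0"
    unfolding Kk using ext[of "Inr False"] ext[of "Inr True"] by simp_all
  then have "k (Inr False) = 0" "k (Inr True) = 0"
    using K4_operator_determined[OF nd, of k x y] fxy by (simp_all add: k_def)
  then have fu: "f (Inr c) = a * g (Inr c) + b * h (Inr c)" for c by (cases c) (simp_all add: k_def)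
  have "?K k i = 0" for i
    using fxy \<open>k (Inr False) = 0\<close> \<open>k (Inr True) = 0\<close> by (simp add: K4_operator_def k_def)
  then have "\<forall>v. stress_operator E \<omega> l (f \<circ> Inl) v = 0"
    unfolding Kk using ext[of "Inl _"] by simp
  from ker[OF this] obtain a' b' where ab': "\<And>v. f (Inl v) = a' * g (Inl v) + b' * h (Inl v)"
    by (auto simp: comp_def)
  have "(a - a') * g (Inl x) + (b - b') * h (Inl x) = 0" "(a - a') * g (Inl y) + (b - b') * h (Inl y) = 0"
    using fxy ab'[of x] ab'[of y] by (simp_all add: algebra_simps)
  then have "a - a' = 0 \<and> b - b' = 0" by (rule linear_combination_unique[OF gh])
  then have "f v = a * g v + b * h v" for v
    using ab' fu by (cases v) auto
  then show ?thesis by blast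
qed

text \<open>Half angles: the frame in which \<open>x\<close> and \<open>y\<close> are exchanged by a half-turn.\<close>

lemma half_turn_frame:
  fixes x y :: "real^3"
  assumes "(x $ 1)\<^sup>2 + (x $ 2)\<^sup>2 = 1" "(y $ 1)\<^sup>2 + (y $ 2)\<^sup>2 = 1"
  obtains C S c s where "C\<^sup>2 + S\<^sup>2 = 1" "c\<^sup>2 + s\<^sup>2 = 1"
    "x $ 1 = C * c - S * s" "x $ 2 = S * c + C * s" "y $ 1 = C * c + S * s" "y $ 2 = S * c - C * s"
proof -
  obtain a where a: "x $ 1 = cos a" "x $ 2 = sin a" using sincos_total_2pi[OF assms(1)] by metis
  obtain b where b: "y $ 1 = cos b" "y $ 2 = sin b" using sincos_total_2pi[OF assms(2)] by metis
  have ab: "a = (a + b) / 2 + (a - b) / 2" "b = (a + b) / 2 - (a - b) / 2" by (simp_all add: field_simps)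
  show thesis
  proof (rule that[of "cos ((a + b) / 2)" "sin ((a + b) / 2)" "cos ((a - b) / 2)" "sin ((a - b) / 2)"])
    show "x $ 1 = cos ((a + b) / 2) * cos ((a - b) / 2) - sin ((a + b) / 2) * sin ((a - b) / 2)"
      "x $ 2 = sin ((a + b) / 2) * cos ((a - b) / 2) + cos ((a + b) / 2) * sin ((a - b) / 2)"
      unfolding a by (subst ab(1), simp only: cos_add sin_add)+
    show "y $ 1 = cos ((a + b) / 2) * cos ((a - b) / 2) + sin ((a + b) / 2) * sin ((a - b) / 2)"
      "y $ 2 = sin ((a + b) / 2) * cos ((a - b) / 2) - cos ((a + b) / 2) * sin ((a - b) / 2)"
      unfolding b by (subst ab(2), simp only: cos_diff sin_diff)+
  qed simp_all
qed

text \<open>In the frame, \<open>x = (c, s, \<zeta>)\<close> and \<open>y = (c, -s, -\<zeta>)\<close>. The new vertices \<open>(s, c, k\<zeta>)\<close> and \<open>(s, -c, -k\<zeta>)\<close>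
  with \<open>k = s\<^sup>2 / c\<^sup>2\<close> are symmetric under the same half-turn, and this value of \<open>k\<close> is the one for which the
  complete graph on the four points carries a stress. The stress is given by the coefficients below up
  to the factor \<open>\<kappa>\<close>, which is chosen to cancel \<open>w\<close> on \<open>xy\<close>.\<close>

lemma special_position:
  fixes q1 :: "'v::finite \<Rightarrow> real^3"
  assumes cyl: "on_cylinder q1"
    and nd: "cross_xy q1 x y \<noteq> 0" "q1 x $ 1 * q1 y $ 1 + q1 x $ 2 * q1 y $ 2 \<noteq> 0" "q1 x $ 3 \<noteq> q1 y $ 3"
    and w: "w \<noteq> 0"
  obtains q P Q R lx lu where "on_cylinder q" "q \<circ> Inl = q1"
    "\<And>i. K4_operator x y w P Q R lx lu (\<lambda>v. q v $ 1) i = 0"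
    "\<And>i. K4_operator x y w P Q R lx lu (\<lambda>v. q v $ 2) i = 0"
    "\<And>i. K4_operator x y w P Q R 0 0 (\<lambda>v. q v $ 3) i = 0"
    "P + Q \<noteq> 0" "2 * R + P + Q \<noteq> 0" "P + Q + lu \<noteq> 0" "2 * R + P + Q + lu \<noteq> 0"
    "\<And>b. tangent_det q (Inr b) (Inl x) (Inl y) \<noteq> 0"
proof -
  have unit: "(q1 x $ 1)\<^sup>2 + (q1 x $ 2)\<^sup>2 = 1" "(q1 y $ 1)\<^sup>2 + (q1 y $ 2)\<^sup>2 = 1"
    using cyl by (simp_all add: on_cylinder_iff)
  obtain C S c s where CS: "C\<^sup>2 + S\<^sup>2 = 1" and cs: "c\<^sup>2 + s\<^sup>2 = 1"
    and x: "q1 x $ 1 = C * c - S * s" "q1 x $ 2 = S * c + C * s"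
    and y: "q1 y $ 1 = C * c + S * s" "q1 y $ 2 = S * c - C * s"
    using half_turn_frame[OF unit] by blast
  define \<zeta> where "\<zeta> = (q1 x $ 3 - q1 y $ 3) / 2"
  define z where "z = (q1 x $ 3 + q1 y $ 3) / 2"
  have xz: "q1 x $ 3 = z + \<zeta>" "q1 y $ 3 = z - \<zeta>" by (simp_all add: z_def \<zeta>_def field_simps)
  have "cross_xy q1 x y = - 2 * (s * c)"
    using CS unfolding cross_xy_def x y by algebra
  then have s0: "s \<noteq> 0" and c0: "c \<noteq> 0" using nd(1) by auto
  have "q1 x $ 1 * q1 y $ 1 + q1 x $ 2 * q1 y $ 2 = (c + s) * (c - s)"
    using CS unfolding x y by algebra
  \<comment> \<open>For \<open>c = s\<close> the new vertices would coincide with \<open>x\<close>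
    and \<open>y\<close>; for \<open>c = - s\<close> the stress of the complete graph would vanish
    on the edge to be cancelled.\<close>
  then have cs0: "c + s \<noteq> 0" "c - s \<noteq> 0" using nd(2) by auto
  have \<zeta>0: "\<zeta> \<noteq> 0" using nd(3) by (simp add: \<zeta>_def)
  define k where "k = s\<^sup>2 / c\<^sup>2"
  have k: "k * c\<^sup>2 = s\<^sup>2" using c0 by (simp add: k_def)
  define \<kappa> where "\<kappa> = - w / (s * (c + s))"
  have \<kappa>: "w = - (\<kappa> * s * (c + s))" "\<kappa> \<noteq> 0" using s0 cs0 w by (simp_all add: \<kappa>_def)
  \<comment> \<open>By the half-turn only the equations at \<open>x\<close> and at the first new
    vertex remain: two horizontal ones and one for the height at each. These values together with
    \<open>w\<close> solve them.\<close>
  define P Q R lx lu where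
    "P = - (\<kappa> * s * c)" and "Q = - (\<kappa> * s * c * (1 + 2 * s * c))" and "R = \<kappa> * c * (s + c)"
    and "lx = 2 * \<kappa> * s * (c ^ 3 - s ^ 3)" and "lu = - (2 * \<kappa> * c * (c ^ 3 - s ^ 3))"
  define q where "q i = (case i of Inl v \<Rightarrow> q1 v | Inr b \<Rightarrow>
    if b then vector [C * s + S * c, S * s - C * c, z - k * \<zeta>]
    else vector [C * s - S * c, S * s + C * c, z + k * \<zeta>])" for i
  have qx: "q (Inl v) = q1 v" for v by (simp add: q_def)
  have qu: "q (Inr False) $ 1 = C * s - S * c" "q (Inr False) $ 2 = S * s + C * c" "q (Inr False) $ 3 = z + k * \<zeta>"
    "q (Inr True) $ 1 = C * s + S * c" "q (Inr True) $ 2 = S * s - C * c" "q (Inr True) $ 3 = z - k * \<zeta>"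
    by (simp_all add: q_def)
  note defs = P_def Q_def R_def lx_def lu_def \<kappa>(1)
  have sc: "1 + s * c \<noteq> 0"
  proof -
    have "2 * (1 + s * c) = (s + c)\<^sup>2 + 1" using cs by (simp add: power2_eq_square algebra_simps)
    moreover have "0 < (s + c)\<^sup>2 + 1" using zero_le_power2[of "s + c"] by linarith
    ultimately show ?thesis by auto
  qed
  show thesis
  proof (rule that[of q P Q R lx lu])
    show "q \<circ> Inl = q1" by (simp add: fun_eq_iff qx)
    have u: "(C * s - S * c)\<^sup>2 + (S * s + C * c)\<^sup>2 = 1" "(C * s + S * c)\<^sup>2 + (S * s - C * c)\<^sup>2 = 1"
      using CS cs by algebra+
    have "(q i $ 1)\<^sup>2 + (q i $ 2)\<^sup>2 = 1" for i
    proof (cases i)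
      case (Inl v)
      then show ?thesis using cyl by (simp add: qx on_cylinder_iff)
    next
      case (Inr b)
      then show ?thesis using u by (cases b) (simp_all add: qu)
    qed
    then show "on_cylinder q" by (simp add: on_cylinder_iff)
    show "K4_operator x y w P Q R lx lu (\<lambda>v. q v $ 1) i = 0" for i
    proof -
      have "- w * (q1 x $ 1 - q1 y $ 1) + P * (q1 x $ 1 - (C * s - S * c)) + Q * (q1 x $ 1 - (C * s + S * c)) + lx * q1 x $ 1 = 0"
        "- w * (q1 y $ 1 - q1 x $ 1) + P * (q1 y $ 1 - (C * s + S * c)) + Q * (q1 y $ 1 - (C * s - S * c)) + lx * q1 y $ 1 = 0"
        "R * ((C * s - S * c) - (C * s + S * c)) + P * ((C * s - S * c) - q1 x $ 1) + Q * ((C * s - S * c) - q1 y $ 1) + lu * (C * s - S * c) = 0"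
        "R * ((C * s + S * c) - (C * s - S * c)) + P * ((C * s + S * c) - q1 y $ 1) + Q * ((C * s + S * c) - q1 x $ 1) + lu * (C * s + S * c) = 0"
        unfolding x y defs using cs by algebra+
      then show ?thesis by (simp add: K4_operator_def qx qu)
    qed
    show "K4_operator x y w P Q R lx lu (\<lambda>v. q v $ 2) i = 0" for i
    proof -
      have "- w * (q1 x $ 2 - q1 y $ 2) + P * (q1 x $ 2 - (S * s + C * c)) + Q * (q1 x $ 2 - (S * s - C * c)) + lx * q1 x $ 2 = 0"
        "- w * (q1 y $ 2 - q1 x $ 2) + P * (q1 y $ 2 - (S * s - C * c)) + Q * (q1 y $ 2 - (S * s + C * c)) + lx * q1 y $ 2 = 0"
        "R * ((S * s + C * c) - (S * s - C * c)) + P * ((S * s + C * c) - q1 x $ 2) + Q * ((S * s + C * c) - q1 y $ 2) + lu * (S * s + C * c) = 0"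
        "R * ((S * s - C * c) - (S * s + C * c)) + P * ((S * s - C * c) - q1 y $ 2) + Q * ((S * s - C * c) - q1 x $ 2) + lu * (S * s - C * c) = 0"
        unfolding x y defs using cs by algebra+
      then show ?thesis by (simp add: K4_operator_def qx qu)
    qed
    show "K4_operator x y w P Q R 0 0 (\<lambda>v. q v $ 3) i = 0" for i
    proof -
      \<comment> \<open>Each height equation is a multiple of \<open>\<zeta>\<close>, and symmetry
        leaves one for the old and one for the new vertices. The factor \<open>c\<close>, with the
        one in \<open>P\<close>, \<open>Q\<close> and \<open>R\<close>, clears the denominator of
        \<open>k\<close>.\<close>
      have 1: "- w * 2 + P * (1 - k) + Q * (1 + k) = 0"
      proof -
        have "c * (- w * 2 + P * (1 - k) + Q * (1 + k)) = 0"
          unfolding defs using cs k by algebra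
        then show ?thesis using c0 by simp
      qed
      have 2: "R * (2 * k) + P * (k - 1) + Q * (k + 1) = 0"
      proof -
        have "c * (R * (2 * k) + P * (k - 1) + Q * (k + 1)) = 0"
          unfolding defs using cs k by algebra
        then show ?thesis using c0 by simp
      qed
      have "- w * ((z + \<zeta>) - (z - \<zeta>)) + P * ((z + \<zeta>) - (z + k * \<zeta>)) + Q * ((z + \<zeta>) - (z - k * \<zeta>)) = 0"
        "- w * ((z - \<zeta>) - (z + \<zeta>)) + P * ((z - \<zeta>) - (z - k * \<zeta>)) + Q * ((z - \<zeta>) - (z + k * \<zeta>)) = 0"
        using 1 by algebra+
      moreover have "R * ((z + k * \<zeta>) - (z - k * \<zeta>)) + P * ((z + k * \<zeta>) - (z + \<zeta>)) + Q * ((z + k * \<zeta>) - (z - \<zeta>)) = 0"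
        "R * ((z - k * \<zeta>) - (z + k * \<zeta>)) + P * ((z - k * \<zeta>) - (z - \<zeta>)) + Q * ((z - k * \<zeta>) - (z + \<zeta>)) = 0"
        using 2 by algebra+
      ultimately show ?thesis by (simp add: K4_operator_def qx qu xz)
    qed
    have "P + Q = - 2 * \<kappa> * s * c * (1 + s * c)" unfolding defs by algebra
    then show "P + Q \<noteq> 0" using \<kappa>(2) s0 c0 sc by simp
    have "2 * R + P + Q = 2 * \<kappa> * c ^ 4" unfolding defs using cs by algebra
    then show "2 * R + P + Q \<noteq> 0" using \<kappa>(2) c0 by simp
    have "P + Q + lu = - 2 * \<kappa> * c\<^sup>2 * (1 + s * c)" unfolding defs using cs by algebra
    then show "P + Q + lu \<noteq> 0" using \<kappa>(2) c0 sc by simp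
    have "2 * R + P + Q + lu = 2 * \<kappa> * c * s ^ 3" unfolding defs using cs by algebra
    then show "2 * R + P + Q + lu \<noteq> 0" using \<kappa>(2) s0 c0 by simp
    have "c\<^sup>2 * tangent_det q (Inr False) (Inl x) (Inl y) = - 2 * \<zeta> * (c + s) * (c - s)"
      unfolding tangent_det_def cross_xy_def qx qu x y xz using CS cs k by algebra
    moreover have "c\<^sup>2 * tangent_det q (Inr True) (Inl x) (Inl y) = 2 * \<zeta> * (c + s) * (c - s)"
      unfolding tangent_det_def cross_xy_def qx qu x y xz using CS cs k by algebra
    ultimately show "tangent_det q (Inr b) (Inl x) (Inl y) \<noteq> 0" for b
      using \<zeta>0 cs0 by (cases b) auto
  qed
qed

section \<open>Flexes of the extension and the conclusion\<close>

lemma extended_load_zero: "extended_load (\<lambda>_. 0) x y 0 0 = (\<lambda>_. 0)"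
  by (simp add: extended_load_def fun_eq_iff split: sum.split)

text \<open>The old vertices move trivially by rigidity of the graph without the edge; each new
  vertex is joined to \<open>x\<close> and \<open>y\<close>, and the nonzero determinant makes it
  follow them.\<close>

lemma extension_flex_trivial:
  fixes p :: "'v::finite \<Rightarrow> real^3" and q :: "'v + bool \<Rightarrow> real^3"
  assumes p: "avoids_rational_equations p" and rigid: "rigid_on_cylinder (E - {{x, y}})" and xy: "x \<noteq> y"
    and q: "q \<circ> Inl = p" and det: "\<And>b. tangent_det q (Inr b) (Inl x) (Inl y) \<noteq> 0"
    and f: "flexes (K4_minus_extension E x y) q \<alpha> \<beta>"
  shows "\<exists>c d. \<alpha> = (\<lambda>_. c) \<and> \<beta> = (\<lambda>_. d)"
proof -
  have qv: "q (Inl v) = p v" for v using q by (auto simp: fun_eq_iff)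
  have e: "(q i $ 3 - q j $ 3) * (\<beta> i - \<beta> j) = cross_xy q i j * (\<alpha> i - \<alpha> j)"
    if "{i, j} \<in> K4_minus_extension E x y" for i j
    using f that by (simp add: flexes_def)
  have "flexes (E - {{x, y}}) p (\<alpha> \<circ> Inl) (\<beta> \<circ> Inl)"
    unfolding flexes_def
  proof (intro allI impI)
    fix i j assume "{i, j} \<in> E - {{x, y}}"
    then have "{Inl i, Inl j} \<in> K4_minus_extension E x y" by (simp add: old_edge_iff)
    from e[OF this] show "(p i $ 3 - p j $ 3) * ((\<beta> \<circ> Inl) i - (\<beta> \<circ> Inl) j) = cross_xy p i j * ((\<alpha> \<circ> Inl) i - (\<alpha> \<circ> Inl) j)"
      by (simp add: qv cross_xy_def)
  qed
  from rigid_flex_trivial[OF p rigid xy _ this]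
  have old: "\<alpha> (Inl v) = \<alpha> (Inl x) \<and> \<beta> (Inl v) = \<beta> (Inl x)" for v by simp
  have new: "\<alpha> (Inr b) = \<alpha> (Inl x) \<and> \<beta> (Inr b) = \<beta> (Inl x)" for b
  proof -
    have "{Inr b, Inl x} \<in> K4_minus_extension E x y" "{Inr b, Inl y} \<in> K4_minus_extension E x y"
      by (cases b; simp add: K4_minus_extension_def)+
    note ex = e[OF this(1)] and ey = e[OF this(2)]
    define a d where "a = \<alpha> (Inr b) - \<alpha> (Inl x)" and "d = \<beta> (Inr b) - \<beta> (Inl x)"
    have 1: "a * cross_xy q (Inr b) (Inl x) + d * - (q (Inr b) $ 3 - q (Inl x) $ 3) = 0"
      "a * cross_xy q (Inr b) (Inl y) + d * - (q (Inr b) $ 3 - q (Inl y) $ 3) = 0"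
      using ex ey old[of y] by (simp_all add: a_def d_def algebra_simps)
    have "cross_xy q (Inr b) (Inl x) * - (q (Inr b) $ 3 - q (Inl y) $ 3) -
        cross_xy q (Inr b) (Inl y) * - (q (Inr b) $ 3 - q (Inl x) $ 3) \<noteq> 0"
      using det[of b] by (simp add: tangent_det_def algebra_simps)
    from linear_combination_unique[OF this 1] show ?thesis by (simp add: a_def d_def)
  qed
  have "\<alpha> v = \<alpha> (Inl x) \<and> \<beta> v = \<beta> (Inl x)" for v
    using old new by (cases v) auto
  then show ?thesis by blast
qed

theorem theorem4p2:
  fixes E1 :: "'v::finite set set" and v2 v3 :: 'v and p :: "'v + bool \<Rightarrow> real^3"
  assumes "simple_graph E1"
    and "{v2, v3} \<in> E1"
    and "rigid_on_cylinder (E1 - {{v2, v3}})"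
    and "generic_on_cylinder p"
    and "has_max_rank_stress E1 (p \<circ> Inl)"
  shows "has_max_rank_stress (K4_minus_extension E1 v2 v3) p"
proof -
  let ?G = "K4_minus_extension E1 v2 v3" and ?p1 = "p \<circ> Inl"
  have ne: "v2 \<noteq> v3" using assms(1,2) by (force simp: simple_graph_def)
  have G: "simple_graph ?G" using assms(1) by (rule simple_graph_K4_minus_extension)
  have p: "avoids_rational_equations p" using assms(4) by (rule generic_avoids_rational_equations)
  have p1: "avoids_rational_equations ?p1" using p by (rule avoids_rational_equations_restrict)
  have cyl: "on_cylinder p" "on_cylinder ?p1" using p p1 by (simp_all add: avoids_rational_equations_def)
  have cross: "?p1 v2 $ 1 * ?p1 v3 $ 2 - ?p1 v3 $ 1 * ?p1 v2 $ 2 \<noteq> 0"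
    using generic_cross_xy[OF p1 ne] by (simp add: cross_xy_def mult.commute)
  have height: "?p1 v2 $ 3 \<noteq> ?p1 v3 $ 3" by (rule generic_height[OF p1 ne])
  obtain \<omega>0 l0 where s0: "equilibrium_stress E1 ?p1 \<omega>0 l0"
    "int (rank (cyl_stress_matrix E1 \<omega>0 l0)) = 3 * int CARD('v) - 6"
    using assms(5) unfolding has_max_rank_stress_def by blast
  obtain \<omega> l where s: "equilibrium_stress E1 ?p1 \<omega> l" "\<omega> {v2, v3} \<noteq> 0"
    "rank (cyl_stress_matrix E1 \<omega>0 l0) \<le> rank (cyl_stress_matrix E1 \<omega> l)"
    using stress_nonzero_on_edge[OF p1 assms(3,2) s0(1)] by blast
  have "int (rank (cyl_stress_matrix E1 \<omega> l)) = 3 * int CARD('v) - 6"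
    using max_rank_upper_bound[OF assms(1) s(1) cross height] s0(2) s(3) by linarith
  then have ker: "(\<And>f. (\<forall>i. stress_operator E1 \<omega> l f i = 0) \<Longrightarrow> \<exists>a b. \<forall>w. f w = a * ?p1 w $ 1 + b * ?p1 w $ 2)"
    "(\<And>f. (\<forall>i. stress_operator E1 \<omega> (\<lambda>_. 0) f i = 0) \<Longrightarrow> \<exists>a b. \<forall>w. f w = a + b * ?p1 w $ 3)"
    unfolding max_rank_iff[OF assms(1) s(1) cross height] by blast+
  obtain q P Q R lx lu where q: "on_cylinder q" "q \<circ> Inl = ?p1"
    and K4: "\<And>i. K4_operator v2 v3 (\<omega> {v2, v3}) P Q R lx lu (\<lambda>v. q v $ 1) i = 0"
      "\<And>i. K4_operator v2 v3 (\<omega> {v2, v3}) P Q R lx lu (\<lambda>v. q v $ 2) i = 0"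
      "\<And>i. K4_operator v2 v3 (\<omega> {v2, v3}) P Q R 0 0 (\<lambda>v. q v $ 3) i = 0"
    and nd: "P + Q \<noteq> 0" "2 * R + P + Q \<noteq> 0" "P + Q + lu \<noteq> 0" "2 * R + P + Q + lu \<noteq> 0"
    and det: "\<And>b. tangent_det q (Inr b) (Inl v2) (Inl v3) \<noteq> 0"
    using special_position[OF cyl(2) generic_cross_xy[OF p1 ne] generic_inner_xy[OF p1 ne] height s(2)] by blast
  have qv: "q (Inl v) = ?p1 v" for v using q(2) by (metis comp_apply)
  define \<Omega> where "\<Omega> = extended_stress \<omega> v2 v3 P Q R"
  define L where "L = extended_load l v2 v3 lx lu"
  have op: "stress_operator ?G \<Omega> L f i =
      (case i of Inl v \<Rightarrow> stress_operator E1 \<omega> l (f \<circ> Inl) v | Inr _ \<Rightarrow> 0) + K4_operator v2 v3 (\<omega> {v2, v3}) P Q R lx lu f i" for f i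
    unfolding \<Omega>_def L_def by (rule stress_operator_extension[OF ne assms(2)])
  have op0: "stress_operator ?G \<Omega> (\<lambda>_. 0) f i =
      (case i of Inl v \<Rightarrow> stress_operator E1 \<omega> (\<lambda>_. 0) (f \<circ> Inl) v | Inr _ \<Rightarrow> 0) + K4_operator v2 v3 (\<omega> {v2, v3}) P Q R 0 0 f i" for f i
    using stress_operator_extension[OF ne assms(2), of \<omega> P Q R "\<lambda>_. 0" 0 0 f i]
    unfolding \<Omega>_def extended_load_zero .
  have stress: "equilibrium_stress ?G q \<Omega> L"
    using s(1) unfolding equilibrium_stress_operator op op0
    by (auto simp: K4 qv comp_def split: sum.split)
  have crossq: "q (Inl v2) $ 1 * q (Inl v3) $ 2 - q (Inl v3) $ 1 * q (Inl v2) $ 2 \<noteq> 0"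
    "q (Inl v2) $ 3 \<noteq> q (Inl v3) $ 3" using cross height by (simp_all add: qv)
  have "int (rank (cyl_stress_matrix ?G \<Omega> L)) = 3 * int CARD('v + bool) - 6"
    unfolding max_rank_iff[OF G stress crossq]
  proof (intro conjI allI impI)
    fix f assume f: "\<forall>i. stress_operator ?G \<Omega> L f i = 0"
    show "\<exists>a b. \<forall>w. f w = a * q w $ 1 + b * q w $ 2"
    proof (rule extension_kernel[OF ne assms(2) nd(3,4)])
      show "q (Inl v2) $ 1 * q (Inl v3) $ 2 - q (Inl v3) $ 1 * q (Inl v2) $ 2 \<noteq> 0" by (rule crossq(1))
      show "K4_operator v2 v3 (\<omega> {v2, v3}) P Q R lx lu (\<lambda>v. q v $ 1) i = 0"
        "K4_operator v2 v3 (\<omega> {v2, v3}) P Q R lx lu (\<lambda>v. q v $ 2) i = 0" for i by (rule K4)+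
      show "\<exists>a b. \<forall>v. f v = a * q (Inl v) $ 1 + b * q (Inl v) $ 2" if "\<forall>i. stress_operator E1 \<omega> l f i = 0" for f
        using ker(1)[OF that] by (simp add: qv)
      show "\<forall>i. stress_operator ?G (extended_stress \<omega> v2 v3 P Q R) (extended_load l v2 v3 lx lu) f i = 0"
        using f unfolding \<Omega>_def L_def .
    qed
  next
    fix f assume f: "\<forall>i. stress_operator ?G \<Omega> (\<lambda>_. 0) f i = 0"
    \<comment> \<open>The third block is handled like the first, with 1 and the height in place of
      the horizontal coordinates and with all loads zero.\<close>
    have "\<exists>a b. \<forall>w. f w = a * 1 + b * q w $ 3"
    proof (rule extension_kernel[OF ne assms(2), where P = P and Q = Q and R = R and lx = 0 and lu = 0 and \<omega> = \<omega> and l = "\<lambda>_. 0"])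
      show "P + Q + 0 \<noteq> 0" "2 * R + P + Q + 0 \<noteq> 0" using nd(1,2) by simp_all
      show "1 * q (Inl v3) $ 3 - 1 * q (Inl v2) $ 3 \<noteq> 0" using crossq(2) by simp
      show "K4_operator v2 v3 (\<omega> {v2, v3}) P Q R 0 0 (\<lambda>_. 1) i = 0" for i
        by (simp add: K4_operator_def)
      show "K4_operator v2 v3 (\<omega> {v2, v3}) P Q R 0 0 (\<lambda>v. q v $ 3) i = 0" for i by (rule K4(3))
      show "\<exists>a b. \<forall>v. f v = a * 1 + b * q (Inl v) $ 3" if "\<forall>i. stress_operator E1 \<omega> (\<lambda>_. 0) f i = 0" for f
        using ker(2)[OF that] by (simp add: qv)
      show "\<forall>i. stress_operator ?G (extended_stress \<omega> v2 v3 P Q R) (extended_load (\<lambda>_. 0) v2 v3 0 0) f i = 0"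
        using f unfolding extended_load_zero \<Omega>_def .
    qed
    then show "\<exists>a b. \<forall>w. f w = a + b * q w $ 3" by simp
  qed
  \<comment> \<open>Although \<open>q\<close> is special for the complete graph on the four
    vertices, the extension has only trivial flexes there, so its rigidity matrix loses no
    rank.\<close>
  moreover have "rank (rigidity_matrix ?G p) \<le> rank (rigidity_matrix ?G q)"
    using extension_flex_trivial[OF p1 assms(3) ne q(2) det]
    by (intro rank_le_of_trivial_flexes cyl(1) q(1))
  from stress_transfer[OF p q(1) this stress]
  obtain \<omega>' l' where s': "equilibrium_stress ?G p \<omega>' l'"
    "rank (cyl_stress_matrix ?G \<Omega> L) \<le> rank (cyl_stress_matrix ?G \<omega>' l')" by blast
  moreover have "int (rank (cyl_stress_matrix ?G \<omega>' l')) \<le> 3 * int CARD('v + bool) - 6"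
    using cross height by (intro max_rank_upper_bound[OF G s'(1), of "Inl v2" "Inl v3"]) simp_all
  ultimately have "int (rank (cyl_stress_matrix ?G \<omega>' l')) = 3 * int CARD('v + bool) - 6" by linarith
  with s'(1) show ?thesis unfolding has_max_rank_stress_def by blast
qed

end
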